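(* Let $N$ be a positive integer and let $n$ be a positive integer with $\gcd(n,N)=1$. For every non-zero $f \in M^{\mathrm{mer}}_*(\Gamma_0(N))$ we have \[ T(n)\,\mathrm{div}(f) = \mathrm{div}(f|_* T(n)) \quad\text{in } \mathrm{Div}(X_0(N))_{\mathbb{Q}}. \]
   Context: $\mathbb{H}$ is the upper half-plane, $\mathbb{H}^* = \mathbb{H}\cup\mathbb{Q}\cup\{i\infty\}$, and $\mathrm{GL}_2^+(\mathbb{Q})$ acts on $\mathbb{H}^*$ by Möbius transformations. For a congruence subgroup $\Gamma\subset \mathrm{SL}_2(\mathbb{Z})$ let $X(\Gamma)=\Gamma\backslash\mathbb{H}^*$ and $X_0(N)=X(\Gamma_0(N))$; $[z]$ denotes the class of $z\in\mathbb{H}^*$. $\mathrm{Div}(X_0(N))_{\mathbb{Q}}$ is the $\mathbb{Q}$-vector space of finite formal sums $\sum n_z[z]$, $n_z\in\mathbb{Q}$. For $\alpha=\begin{pmatrix}a&b\\c&d\end{pmatrix}\in\mathrm{GL}_2^+(\mathbb{R})$ and $k\in\mathbb{Z}$, $(f|_k\alpha)(\tau)=(c\tau+d)^{-k}(\det\alpha)^{k/2}f(\alpha\tau)$. $M^{\mathrm{mer}}_k(\Gamma)$ is the space of meromorphic $f:\mathbb{H}\to\mathbb{C}$, meromorphic at every cusp, with $f|_k\gamma=f$ for all $\gamma\in\Gamma$; $M^{\mathrm{mer}}_*(\Gamma_0(N))=\bigcup_{k\in\mathbb{Z}}M^{\mathrm{mer}}_k(\Gamma_0(N))$, a multiplicative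 group after removing $0$. Order: for $z\in\mathbb{H}$, $\mathrm{ord}_\Gamma(f;[z])=\mathrm{ord}_z(f)/\omega_\Gamma(z)$, where $\mathrm{ord}_z(f)$ is the usual order of the meromorphic function and $\omega_\Gamma(z)=[\{\pm I\}\Gamma_z:\{\pm I\}]$ ($\Gamma_z$ the stabilizer). For a cusp $\rho$, choose $\sigma_\rho\in\mathrm{SL}_2(\mathbb{Z})$ with $\sigma_\rho i\infty=\rho$, let $h=[\mathrm{SL}_2(\mathbb{Z})_\infty:\{\pm I\}(\sigma_\rho^{-1}\Gamma\sigma_\rho)_\infty]$, write $(f|_k\sigma_\rho)(\tau)=\sum_{m\ge\nu}a_m e^{2\pi i m\tau/h}$ with $a_\nu\ne0$, and set $\mathrm{ord}_\Gamma(f;[\rho])=\nu$. The divisor map is $\mathrm{div}(f)=\sum_{[z]\in X_0(N)}\mathrm{ord}_{\Gamma_0(N)}(f;[z])[z]$. Hecke operators: let $\Delta_N=\{\begin{pmatrix}a&b\\c&d\end{pmatrix}\in M_2(\mathbb{Z}):ad-bc>0,\ \gcd(a,N)=1,\ N\mid c\}$ and $\Delta_N^{(n)}=\{\alpha\in\Delta_N:\det\alpha=n\}$; this set is stable under left and right multiplication by $\Gamma_0(N)$ and is a finite union of right cosets $\Gamma_0(N)\alpha$. Writing $\alpha$ over a system of representatives of $\Gamma_0(N)\backslash\Delta_N^{(n)}$: for $D=\sum n_z[z]$, $T(n)D=\sum_{[z]}n_z\sum_{\alpha}[\alpha z]$; for $f\in M^{\mathrm{mer}}_k(\Gamma_0(N))$,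 $(f|_*T(n))(\tau)=\prod_{\alpha}(f|_k\alpha)(\tau)$ (the multiplicative Hecke operator), which again lies in $M^{\mathrm{mer}}_*(\Gamma_0(N))$. *)

theory Defs
  imports "HOL-Complex_Analysis.Complex_Analysis" "HOL-Library.Poly_Mapping"
begin

section \<open>The extended upper half-plane and the action of integral matrices\<close>

text \<open>
  The only matrices that occur are those of \<open>SL\<^sub>2(\<int>)\<close> and of the Hecke sets, so matrices are
  integral throughout: the action and the slash operator are those of \<open>GL\<^sub>2\<^sup>+(\<rat>)\<close> and
  \<open>GL\<^sub>2\<^sup>+(\<real>)\<close>, restricted to integral matrices of positive determinant.
\<close>

type_synonym mat2 = "int^2^2"

definition uhp :: "complex set" where
  "uhp = {z. Im z > 0}"

datatype ext_point = Inner complex | Cusp rat | Infty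

definition ext_uhp :: "ext_point set" where
  "ext_uhp = Inner ` uhp \<union> range Cusp \<union> {Infty}"

definition moebius :: "mat2 \<Rightarrow> complex \<Rightarrow> complex" where
  "moebius A z = (of_int (A$1$1) * z + of_int (A$1$2)) / (of_int (A$2$1) * z + of_int (A$2$2))"

fun act :: "mat2 \<Rightarrow> ext_point \<Rightarrow> ext_point" where
  "act A (Inner z) = Inner (moebius A z)"
| "act A (Cusp r) =
     (if of_int (A$2$1) * r + of_int (A$2$2) = 0 then Infty
      else Cusp ((of_int (A$1$1) * r + of_int (A$1$2)) / (of_int (A$2$1) * r + of_int (A$2$2))))"
| "act A Infty = (if A$2$1 = 0 then Infty else Cusp (of_int (A$1$1) / of_int (A$2$1)))"

definition SL2Z :: "mat2 set" where
  "SL2Z = {A. det A = 1}"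

definition Gamma0 :: "nat \<Rightarrow> mat2 set" where
  "Gamma0 N = {A \<in> SL2Z. int N dvd A$2$1}"

definition stabilizer :: "mat2 set \<Rightarrow> ext_point \<Rightarrow> mat2 set" where
  "stabilizer G w = {A \<in> G. act A w = w}"

definition with_signs :: "mat2 set \<Rightarrow> mat2 set" where
  "with_signs H = H \<union> uminus ` H"

definition subgroup_index :: "mat2 set \<Rightarrow> mat2 set \<Rightarrow> nat" where
  "subgroup_index H K = card ((\<lambda>h. (\<lambda>k. k ** h) ` K) ` H)"

definition orbit :: "mat2 set \<Rightarrow> ext_point \<Rightarrow> ext_point set" where
  "orbit G w = (\<lambda>A. act A w) ` G"

definition modular_curve :: "mat2 set \<Rightarrow> ext_point set set" where
  "modular_curve G = orbit G ` ext_uhp"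


section \<open>Meromorphic modular forms\<close>

definition slash :: "(complex \<Rightarrow> complex) \<Rightarrow> int \<Rightarrow> mat2 \<Rightarrow> complex \<Rightarrow> complex" where
  "slash f k A \<tau> =
     (of_int (A$2$1) * \<tau> + of_int (A$2$2)) powi (- k)
       * of_real (real_of_int (det A) powr (real_of_int k / 2)) * f (moebius A \<tau>)"

definition cusp_width :: "mat2 set \<Rightarrow> mat2 \<Rightarrow> nat" where
  "cusp_width G \<sigma> = subgroup_index (stabilizer SL2Z Infty)
     (with_signs (stabilizer ((\<lambda>A. matrix_inv \<sigma> ** A ** \<sigma>) ` G) Infty))"

text \<open>
  \<open>F(\<tau>) = \<Sum>\<^bsub>m \<ge> \<nu>\<^esub> a\<^sub>m exp(2\<pi>im\<tau>/h)\<close> for all \<open>\<tau>\<close> of large imaginary part, the coefficients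
  being those of the formal Laurent series \<open>L\<close>, of which only finitely many with negative index
  are non-zero.
\<close>

definition has_q_expansion :: "(complex \<Rightarrow> complex) \<Rightarrow> nat \<Rightarrow> complex fls \<Rightarrow> bool" where
  "has_q_expansion F h L \<longleftrightarrow> fls_conv_radius L > 0 \<and>
     (\<exists>Y. \<forall>\<tau>. Im \<tau> > Y \<longrightarrow> F \<tau> = eval_fls L (exp (2 * of_real pi * \<i> * \<tau> / of_nat h)))"

text \<open>
  A meromorphic function is represented by its normalised version (value 0 at the poles,
  continuous elsewhere), so that identities between meromorphic functions hold pointwise on the
  upper half-plane; values outside it are irrelevant.  An expansion in \<open>exp(2\<pi>i\<tau>/h)\<close> with \<open>h\<close>
  the cusp width is the right notion of meromorphy at the cusps for groups containing \<open>-I\<close>,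
  such as \<open>Gamma0 N\<close>; otherwise odd weights and irregular cusps would need \<open>2h\<close>.
\<close>

definition mero_forms :: "mat2 set \<Rightarrow> int \<Rightarrow> (complex \<Rightarrow> complex) set" where
  "mero_forms G k = {f. f nicely_meromorphic_on uhp
     \<and> (\<forall>A\<in>G. \<forall>\<tau>\<in>uhp. slash f k A \<tau> = f \<tau>)
     \<and> (\<forall>\<sigma>\<in>SL2Z. \<exists>L. has_q_expansion (slash f k \<sigma>) (cusp_width G \<sigma>) L)}"

definition all_mero_forms :: "mat2 set \<Rightarrow> (complex \<Rightarrow> complex) set" where
  "all_mero_forms G = (\<Union>k. mero_forms G k)"

text \<open>For a non-zero form on \<open>Gamma0 N\<close> the weight is unique.\<close>

definition weight :: "mat2 set \<Rightarrow> (complex \<Rightarrow> complex) \<Rightarrow> int" where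
  "weight G f = (THE k. f \<in> mero_forms G k)"


section \<open>Orders and divisors\<close>

definition ramification :: "mat2 set \<Rightarrow> complex \<Rightarrow> nat" where
  "ramification G z = subgroup_index (with_signs (stabilizer G (Inner z))) {mat 1, - mat 1}"

definition cusp_matrix :: "ext_point \<Rightarrow> mat2" where
  "cusp_matrix \<rho> = (SOME \<sigma>. \<sigma> \<in> SL2Z \<and> act \<sigma> Infty = \<rho>)"

definition cusp_order :: "mat2 set \<Rightarrow> (complex \<Rightarrow> complex) \<Rightarrow> ext_point \<Rightarrow> int" where
  "cusp_order G f \<rho> = (let \<sigma> = cusp_matrix \<rho> in
     fls_subdegree (THE L. has_q_expansion (slash f (weight G f) \<sigma>) (cusp_width G \<sigma>) L))"

definition order_at :: "mat2 set \<Rightarrow> (complex \<Rightarrow> complex) \<Rightarrow> ext_point \<Rightarrow> rat" where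
  "order_at G f w = (case w of
       Inner z \<Rightarrow> of_int (zorder f z) / of_nat (ramification G z)
     | _ \<Rightarrow> of_int (cusp_order G f w))"

text \<open>
  Divisors with rational coefficients are finitely supported functions on classes, i.e.\ the
  elements of \<open>ext_point set \<Rightarrow>\<^sub>0 rat\<close> with support in the modular curve.  The function passed to
  \<^const>\<open>Abs_poly_mapping\<close> has finite support whenever \<open>f\<close> is a non-zero form.
\<close>

definition class_rep :: "ext_point set \<Rightarrow> ext_point" where
  "class_rep x = (SOME w. w \<in> x)"

definition divisor :: "mat2 set \<Rightarrow> (complex \<Rightarrow> complex) \<Rightarrow> (ext_point set \<Rightarrow>\<^sub>0 rat)" where
  "divisor G f = Abs_poly_mapping
     (\<lambda>x. if x \<in> modular_curve G then order_at G f (class_rep x) else 0)"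


section \<open>Hecke operators\<close>

definition hecke_set :: "nat \<Rightarrow> nat \<Rightarrow> mat2 set" where
  "hecke_set N n = {A. det A = int n \<and> coprime (A$1$1) (int N) \<and> int N dvd A$2$1}"

definition hecke_reps :: "nat \<Rightarrow> nat \<Rightarrow> mat2 set \<Rightarrow> bool" where
  "hecke_reps N n R \<longleftrightarrow> R \<subseteq> hecke_set N n \<and>
     (\<forall>B\<in>hecke_set N n. \<exists>!A. A \<in> R \<and> (\<exists>g\<in>Gamma0 N. B = g ** A))"

text \<open>
  Both operators are given by a system \<open>R\<close> of representatives of the cosets
  \<open>Gamma0 N \ hecke_set N n\<close>, and do not depend on its choice.
\<close>

definition hecke_divisor ::
    "nat \<Rightarrow> mat2 set \<Rightarrow> (ext_point set \<Rightarrow>\<^sub>0 rat) \<Rightarrow> (ext_point set \<Rightarrow>\<^sub>0 rat)" where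
  "hecke_divisor N R D =
     (\<Sum>x\<in>Poly_Mapping.keys D. \<Sum>A\<in>R.
        Poly_Mapping.single (orbit (Gamma0 N) (act A (class_rep x))) (Poly_Mapping.lookup D x))"

text \<open>
  The product of normalised meromorphic functions need not be normalised (a zero of one factor
  may cancel a pole of another), whence the \<^const>\<open>remove_sings\<close>.
\<close>

definition hecke_mult :: "nat \<Rightarrow> mat2 set \<Rightarrow> (complex \<Rightarrow> complex) \<Rightarrow> complex \<Rightarrow> complex" where
  "hecke_mult N R f = remove_sings (\<lambda>\<tau>. \<Prod>A\<in>R. slash f (weight (Gamma0 N) f) A \<tau>)"

end

theory Submission
  imports Defs
begin

no_notation fps_nth (infixl "$" 75)

text \<open>
  Let \<open>F\<close> be the product of the functions \<open>f|\<^sub>k A\<close>, where \<open>A\<close> runs through the representatives.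
  At an inner point \<open>w\<close> the order of \<open>F\<close> is the sum of the orders of \<open>f\<close> at the points \<open>A w\<close>.
  Sorting the \<open>A\<close> by the class of \<open>A w\<close>, the theorem becomes the symmetry
  \<open>\<omega>(z) #{A. [A w] = [z]} = \<omega>(w) #{A. [A z] = [w]}\<close>: both sides count, up to a factor 2, the matrices
  of the Hecke set that carry \<open>w\<close> to \<open>z\<close>, or \<open>z\<close> to \<open>w\<close>, and these correspond to each other under the
  adjugate, which preserves the Hecke set because \<open>n\<close> is prime to \<open>N\<close>.

  At a cusp \<open>\<sigma>\<infinity>\<close> one writes \<open>g A \<sigma> = \<sigma>' (a b; 0 d)\<close> with \<open>g\<close> in the group; if \<open>f|\<sigma>'\<close> grows like
  \<open>exp(2\<pi>ir\<tau>)\<close>, then \<open>f|A\<sigma>\<close> grows like \<open>exp(2\<pi>i(ra/d)\<tau>)\<close>.  For given \<open>a\<close> and \<open>d\<close> the admissible offsets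
  \<open>b\<close> are periodic modulo \<open>d h'\<close> and modulo \<open>a h\<close>, where \<open>h\<close> and \<open>h'\<close> are the widths of the two cusps.
  The cosets correspond to the offsets modulo \<open>d h'\<close> and, after passing to adjugates, the cosets of the
  opposite count correspond to the offsets modulo \<open>a h\<close>; comparing densities gives the factor
  \<open>a h / (d h')\<close>.

  That the divisors have finite support follows from the compactness of a truncated fundamental domain.
\<close>

section \<open>Integral matrices\<close>

text \<open>The order of the product at \<open>w\<close> counts the \<open>A\<close> in
  \<open>R\<close> with \<open>A w\<close> equivalent to \<open>z\<close>, whereas the Hecke divisor
  counts those with \<open>A z\<close> equivalent to \<open>w\<close>. Both counts use cosets
  \<open>Gamma0 N A\<close>, so passing from one to the other is no relabelling of \<open>R\<close>:
  the adjugate produces cosets \<open>A Gamma0 N\<close>, and the stabilisers of the two points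
  measure the discrepancy. At inner points these are finite up front and matrices can be counted; at
  cusps they are infinite and only counts modulo translations make sense, whence the two periods of
  the offsets. A second obstacle is that orders are defined through \<open>weight\<close> and
  through the expansion in the local parameter, both definite descriptions. The product must be
  shown to be a non-zero form itself before its divisor can be read off, yet a single factor
  \<open>f|A\<sigma>\<close> need not be periodic modulo the cusp width. The factors therefore
  receive orders of growth with real exponents, and periodicity is recovered only for the
  product.\<close>

definition mk :: "int \<Rightarrow> int \<Rightarrow> int \<Rightarrow> int \<Rightarrow> mat2" where
  "mk a b c d = vector [vector [a, b], vector [c, d]]"

lemma mk_nth [simp]:
  "mk a b c d $ 1 $ 1 = a" "mk a b c d $ 1 $ 2 = b"
  "mk a b c d $ 2 $ 1 = c" "mk a b c d $ 2 $ 2 = d"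
  by (simp_all add: mk_def)

lemma mat2_eq_iff:
  "A = B \<longleftrightarrow> A$1$1 = B$1$1 \<and> A$1$2 = B$1$2 \<and> A$2$1 = B$2$1 \<and> A$2$2 = B$2$2"
  for A B :: mat2
  by (auto simp: vec_eq_iff forall_2)

lemma mult_nth:
  "(A ** B) $ i $ j = A$i$1 * B$1$j + A$i$2 * B$2$j" for A B :: mat2
  by (simp add: matrix_matrix_mult_def sum_2)

lemma mat_one_nth [simp]:
  "(mat 1 :: mat2) $ 1 $ 1 = 1" "(mat 1 :: mat2) $ 1 $ 2 = 0"
  "(mat 1 :: mat2) $ 2 $ 1 = 0" "(mat 1 :: mat2) $ 2 $ 2 = 1"
  by (simp_all add: mat_def)

text \<open>The adjugate serves as an inverse without leaving the integers: \<open>A\<close> times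
  its adjugate is the scalar \<open>det A\<close>, which acts trivially on points.\<close>

definition adj :: "mat2 \<Rightarrow> mat2" where
  "adj A = mk (A$2$2) (- A$1$2) (- A$2$1) (A$1$1)"

lemma adj_nth [simp]:
  "adj A $ 1 $ 1 = A$2$2" "adj A $ 1 $ 2 = - A$1$2"
  "adj A $ 2 $ 1 = - A$2$1" "adj A $ 2 $ 2 = A$1$1"
  by (simp_all add: adj_def)

lemma adj_adj [simp]: "adj (adj A) = A"
  by (simp add: mat2_eq_iff)

lemma adj_mult: "adj (A ** B) = adj B ** adj A"
  by (simp add: mat2_eq_iff mult_nth algebra_simps)

lemma det_adj [simp]: "det (adj A) = det A"
  by (simp add: det_2 algebra_simps)

lemma mult_adj: "A ** adj A = mat (det A)" "adj A ** A = mat (det A)"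
  by (simp_all add: mat2_eq_iff mult_nth det_2 mat_def algebra_simps)

lemma scalar_mult_nth [simp]: "(mat k ** A) $ i $ j = k * A $ i $ j" for A :: mat2
  using exhaust_2[of i] by (auto simp: mult_nth mat_def)

lemma scalar_mult_right_nth [simp]: "(A ** mat k) $ i $ j = k * A $ i $ j" for A :: mat2
  using exhaust_2[of j] by (auto simp: mult_nth mat_def)

lemma adj_mult_cancel [simp]:
  assumes "det A = 1"
  shows "A ** (adj A ** B) = B" "adj A ** (A ** B) = B" "(B ** A) ** adj A = B" "(B ** adj A) ** A = B"
  by (simp_all add: matrix_mul_assoc mult_adj assms)
     (simp_all add: matrix_mul_assoc[symmetric] mult_adj assms)

lemma mult_left_cancel_det:
  fixes A B C :: mat2
  assumes "det A \<noteq> 0" "A ** B = A ** C"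
  shows "B = C"
proof -
  have "mat (det A) ** B = mat (det A) ** C"
    using assms(2) by (metis matrix_mul_assoc mult_adj(2))
  hence "det A * B$i$j = det A * C$i$j" for i j
    by (metis scalar_mult_nth)
  thus ?thesis using assms(1) by (simp add: mat2_eq_iff)
qed

lemma mult_right_cancel_det:
  fixes A B C :: mat2
  assumes "det A \<noteq> 0" "B ** A = C ** A"
  shows "B = C"
  by (metis assms adj_adj adj_mult det_adj mult_left_cancel_det)

lemma SL2Z_mult [intro]: "A \<in> SL2Z \<Longrightarrow> B \<in> SL2Z \<Longrightarrow> A ** B \<in> SL2Z"
  by (simp add: SL2Z_def det_mul)

lemma SL2Z_adj [intro]: "A \<in> SL2Z \<Longrightarrow> adj A \<in> SL2Z"
  by (simp add: SL2Z_def)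

lemma SL2Z_one [simp, intro]: "mat 1 \<in> SL2Z"
  by (simp add: SL2Z_def det_2)

lemma Gamma0_det: "A \<in> Gamma0 N \<Longrightarrow> det A = 1"
  by (simp add: Gamma0_def SL2Z_def)

lemma Gamma0_mult [intro]: "A \<in> Gamma0 N \<Longrightarrow> B \<in> Gamma0 N \<Longrightarrow> A ** B \<in> Gamma0 N"
  by (auto simp: Gamma0_def mult_nth)

lemma Gamma0_adj [intro]: "A \<in> Gamma0 N \<Longrightarrow> adj A \<in> Gamma0 N"
  by (auto simp: Gamma0_def)

lemma Gamma0_one [simp, intro]: "mat 1 \<in> Gamma0 N"
  by (simp add: Gamma0_def)

lemma det_uminus2 [simp]: "det (- A) = det A" for A :: mat2
  by (simp add: det_2)

lemma Gamma0_uminus [simp]: "- A \<in> Gamma0 N \<longleftrightarrow> A \<in> Gamma0 N"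
  by (simp add: Gamma0_def SL2Z_def)

lemma minus_mult2: "(- A) ** B = - (A ** B)" "A ** (- B) = - (A ** B)" for A B :: mat2
  by (simp_all add: mat2_eq_iff mult_nth)

lemma matrix_inv_SL2Z:
  assumes "A \<in> SL2Z" shows "matrix_inv A = adj A"
proof -
  have d: "det A = 1" using assms by (simp add: SL2Z_def)
  have "A ** matrix_inv A = mat 1 \<and> matrix_inv A ** A = mat 1"
    unfolding matrix_inv_def
    by (rule someI[of _ "adj A"]) (simp add: mult_adj d)
  thus ?thesis by (metis adj_mult_cancel(2) d matrix_mul_rid)
qed

section \<open>Stability of the Hecke set under \<open>Gamma0 N\<close> and under adjugates\<close>

lemma coprime_add_mult_iff: "coprime (x + k * m) m \<longleftrightarrow> coprime x m" for x k m :: int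
proof -
  have "gcd (x + k * m) m = gcd m (k * m + x)" by (metis gcd.commute add.commute)
  also have "\<dots> = gcd x m" by (metis gcd.commute gcd_add_mult)
  finally show ?thesis by (simp add: coprime_iff_gcd_eq_1)
qed

text \<open>A common divisor of \<open>N\<close> and the upper left entry divides the whole first
  column, hence the determinant.\<close>

lemma Gamma0_coprime:
  assumes "g \<in> Gamma0 N" shows "coprime (g$1$1) (int N)"
proof (rule coprimeI)
  fix c assume c: "c dvd g$1$1" "c dvd int N"
  have "c dvd g$2$1" using c assms by (auto simp: Gamma0_def)
  hence "c dvd det g" using c by (simp add: det_2)
  thus "is_unit c" using assms by (simp add: Gamma0_det)
qed

lemma hecke_set_mult_left:
  assumes "g \<in> Gamma0 N" "A \<in> hecke_set N n" shows "g ** A \<in> hecke_set N n"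
proof -
  have g: "det g = 1" "int N dvd g$2$1" using assms by (auto simp: Gamma0_def SL2Z_def)
  have A: "det A = n" "coprime (A$1$1) N" "int N dvd A$2$1" using assms by (auto simp: hecke_set_def)
  have "coprime (g$1$1) (int N)" using assms(1) by (rule Gamma0_coprime)
  with A(2) have "coprime (g$1$1 * A$1$1) (int N)" by simp
  moreover from A(3) obtain k where k: "A$2$1 = int N * k" by blast
  ultimately have "coprime ((g**A)$1$1) (int N)"
    using coprime_add_mult_iff[of "g$1$1 * A$1$1" "g$1$2 * k" "int N"]
    by (simp add: mult_nth algebra_simps)
  thus ?thesis using A g by (auto simp: hecke_set_def det_mul mult_nth)
qed

lemma hecke_set_mult_right:
  assumes "g \<in> Gamma0 N" "A \<in> hecke_set N n" shows "A ** g \<in> hecke_set N n"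
proof -
  have g: "det g = 1" "int N dvd g$2$1" using assms by (auto simp: Gamma0_def SL2Z_def)
  have A: "det A = n" "coprime (A$1$1) N" "int N dvd A$2$1" using assms by (auto simp: hecke_set_def)
  from g obtain k where k: "g$2$1 = int N * k" by blast
  have "coprime (g$1$1) (int N)" using assms(1) by (rule Gamma0_coprime)
  with A(2) have "coprime (A$1$1 * g$1$1) (int N)" by simp
  hence "coprime ((A**g)$1$1) (int N)"
    using k coprime_add_mult_iff[of "A$1$1 * g$1$1" "A$1$2 * k" "int N"]
    by (simp add: mult_nth algebra_simps)
  thus ?thesis using A g by (auto simp: hecke_set_def det_mul mult_nth)
qed

text \<open>Modulo \<open>N\<close> the product of the diagonal entries is \<open>n\<close>, so the
  lower right entry, which becomes the upper left one, is prime to \<open>N\<close>. This is where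
  the coprimality of \<open>n\<close> and \<open>N\<close> enters.\<close>

lemma hecke_set_adj:
  assumes "A \<in> hecke_set N n" "coprime n N" shows "adj A \<in> hecke_set N n"
proof -
  have A: "det A = n" "coprime (A$1$1) N" "int N dvd A$2$1" using assms by (auto simp: hecke_set_def)
  from A(3) obtain k where k: "A$2$1 = int N * k" by blast
  have e: "A$1$1 * A$2$2 = int n + (A$1$2 * k) * int N" using A(1) k by (simp add: det_2 algebra_simps)
  have "coprime (int n) (int N)" using assms(2) by simp
  hence "coprime (int n + (A$1$2 * k) * int N) (int N)"
    by (simp only: coprime_add_mult_iff)
  hence "coprime (A$2$2) (int N)" unfolding e[symmetric] by simp
  thus ?thesis using A by (simp add: hecke_set_def)
qed

lemma hecke_set_det: "A \<in> hecke_set N n \<Longrightarrow> det A = int n"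
  by (simp add: hecke_set_def)

section \<open>The action on the extended upper half-plane\<close>

lemma uhp_iff: "z \<in> uhp \<longleftrightarrow> Im z > 0"
  by (simp add: uhp_def)

lemma open_uhp: "open uhp"
  unfolding uhp_def by (simp add: open_halfspace_Im_gt)

lemma connected_uhp: "connected uhp"
  unfolding uhp_def by (simp add: convex_connected convex_halfspace_Im_gt)

section \<open>Moebius transformations of the upper half-plane\<close>

definition den :: "mat2 \<Rightarrow> complex \<Rightarrow> complex" where
  "den A z = of_int (A$2$1) * z + of_int (A$2$2)"

definition num :: "mat2 \<Rightarrow> complex \<Rightarrow> complex" where
  "num A z = of_int (A$1$1) * z + of_int (A$1$2)"

lemma moebius_eq: "moebius A z = num A z / den A z"
  by (simp add: moebius_def num_def den_def)

lemma den_nonzero: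
  assumes "det A \<noteq> 0" "z \<in> uhp" shows "den A z \<noteq> 0"
proof
  assume "den A z = 0"
  hence "of_int (A$2$1) * Im z = 0" "of_int (A$2$1) * Re z + of_int (A$2$2) = 0"
    by (simp_all add: den_def complex_eq_iff)
  hence "A$2$1 = 0" "A$2$2 = 0" using assms(2) by (auto simp: uhp_def)
  thus False using assms(1) by (simp add: det_2)
qed

lemma Im_moebius:
  assumes "det A > 0" "z \<in> uhp"
  shows "Im (moebius A z) = of_int (det A) * Im z / (cmod (den A z))\<^sup>2"
  unfolding moebius_eq Im_divide cmod_power2
  by (simp add: num_def den_def det_2 algebra_simps power2_eq_square)

lemma moebius_uhp [simp, intro]:
  assumes "det A > 0" "z \<in> uhp"
  shows "moebius A z \<in> uhp"
  using Im_moebius[OF assms] den_nonzero[of A z] assms by (simp add: uhp_iff)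

lemma den_mult:
  assumes "det B > 0" "z \<in> uhp"
  shows "den (A ** B) z = den A (moebius B z) * den B z"
proof -
  have "den B z \<noteq> 0" using den_nonzero[of B z] assms by simp
  thus ?thesis unfolding moebius_eq 
    by (simp add: den_def[of A] field_simps) (simp add: den_def num_def mult_nth algebra_simps)
qed

lemma moebius_mult:
  assumes "det A > 0" "det B > 0" "z \<in> uhp"
  shows "moebius (A ** B) z = moebius A (moebius B z)"
proof -
  have B: "den B z \<noteq> 0" using den_nonzero[of B z] assms by simp
  have A: "den A (moebius B z) \<noteq> 0" using den_nonzero[of A "moebius B z"] assms by simp
  have "num (A ** B) z = num A (moebius B z) * den B z"
    using B unfolding moebius_eq 
    by (simp add: num_def[of A] field_simps) (simp add: den_def num_def mult_nth algebra_simps)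
  thus ?thesis using den_mult[OF assms(2,3), of A] A B 
    by (simp add: moebius_eq[of "A**B"] moebius_eq[of A "moebius B z"])
qed

lemma moebius_one [simp]: "moebius (mat 1) z = z"
  by (simp add: moebius_def)

lemma moebius_scalar [simp]: "k \<noteq> 0 \<Longrightarrow> moebius (mat k) z = z"
  by (simp add: moebius_def mat_def)

text \<open>Cusps in homogeneous coordinates: matrices act linearly on column vectors, which removes
  the case distinctions of \<open>act\<close>. The zero vector is also sent to \<open>Infty\<close>,
  so its exclusion has to be carried along.\<close>

definition proj :: "int \<Rightarrow> int \<Rightarrow> ext_point" where
  "proj p q = (if q = 0 then Infty else Cusp (of_int p / of_int q))"

lemma proj_not_Inner [simp]: "proj p q \<noteq> Inner z" "Inner z \<noteq> proj p q"
  by (auto simp: proj_def)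

lemma act_proj:
  assumes "p \<noteq> 0 \<or> q \<noteq> 0"
  shows "act A (proj p q) = proj (A$1$1 * p + A$1$2 * q) (A$2$1 * p + A$2$2 * q)"
proof (cases "q = 0")
  case True
  with assms show ?thesis by (auto simp: proj_def)
next
  case False
  define r where "r = (of_int p / of_int q :: rat)"
  have q: "of_int q \<noteq> (0 :: rat)" using False by simp
  have a: "of_int (A$1$1 * p + A$1$2 * q) = (of_int (A$1$1) * r + of_int (A$1$2)) * of_int q"
     and b: "of_int (A$2$1 * p + A$2$2 * q) = (of_int (A$2$1) * r + of_int (A$2$2)) * of_int q"
    using q by (simp_all add: r_def field_simps)
  have c: "A$2$1 * p + A$2$2 * q = 0 \<longleftrightarrow> of_int (A$2$1) * r + of_int (A$2$2) = 0"
    using b q by (metis mult_eq_0_iff of_int_eq_0_iff)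
  show ?thesis
    unfolding proj_def act.simps if_not_P[OF False] r_def[symmetric] act.simps c a b
    using q by auto
qed

lemma act_Infty: "act A Infty = proj (A$1$1) (A$2$1)"
  by (simp add: proj_def)

lemma cusp_cases:
  assumes "\<And>z. w \<noteq> Inner z"
  obtains p q where "coprime p q" "w = proj p q"
proof (cases w)
  case (Cusp r)
  obtain p q where "quotient_of r = (p, q)" by fastforce
  hence "coprime p q" "q > 0" "r = of_int p / of_int q"
    using quotient_of_coprime quotient_of_denom_pos quotient_of_div by blast+
  thus ?thesis using that[of p q] Cusp by (simp add: proj_def)
next
  case Infty
  thus ?thesis using that[of 1 0] by (simp add: proj_def)
qed (use assms in auto)

lemma ext_uhp_cases:
  assumes "w \<in> ext_uhp"
  obtains z where "z \<in> uhp" "w = Inner z" | p q where "coprime p q" "w = proj p q"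
proof (cases "\<exists>z. w = Inner z")
  case True
  thus ?thesis using assms that by (auto simp: ext_uhp_def)
next
  case False
  thus ?thesis using cusp_cases[of w] that by metis
qed

lemma proj_in_ext_uhp [simp]: "proj p q \<in> ext_uhp"
  by (auto simp: proj_def ext_uhp_def)

lemma act_ext_uhp [simp, intro]:
  assumes "det A > 0" "w \<in> ext_uhp" shows "act A w \<in> ext_uhp"
  using assms(2)
proof (cases rule: ext_uhp_cases)
  case (1 z)
  thus ?thesis using assms by (auto simp: ext_uhp_def)
next
  case (2 p q)
  hence "p \<noteq> 0 \<or> q \<noteq> 0" by auto
  thus ?thesis using 2 by (simp add: act_proj)
qed

lemma act_mult:
  assumes "det A > 0" "det B > 0" "w \<in> ext_uhp"
  shows "act (A ** B) w = act A (act B w)"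
  using assms(3)
proof (cases rule: ext_uhp_cases)
  case (1 z)
  thus ?thesis using assms by (simp add: moebius_mult)
next
  case (2 p q)
  hence pq: "p \<noteq> 0 \<or> q \<noteq> 0" by auto
  define x y where "x = B$1$1 * p + B$1$2 * q" and "y = B$2$1 * p + B$2$2 * q"
  \<comment> \<open>The adjugate of \<open>B\<close> recovers \<open>det B\<close> times the
    original vector, so \<open>(x, y)\<close> cannot vanish.\<close>
  have "det B * p = B$2$2 * x - B$1$2 * y" "det B * q = B$1$1 * y - B$2$1 * x"
    by (simp_all add: det_2 x_def y_def algebra_simps)
  with pq assms(2) have xy: "x \<noteq> 0 \<or> y \<noteq> 0" by auto
  show ?thesis unfolding 2 act_proj[OF pq] x_def[symmetric] y_def[symmetric] act_proj[OF xy]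
    by (simp add: mult_nth x_def y_def algebra_simps)
qed

lemma act_scalar [simp]: "k \<noteq> 0 \<Longrightarrow> w \<in> ext_uhp \<Longrightarrow> act (mat k) w = w"
  using moebius_scalar[of k] by (cases w) (auto simp: mat_def)

lemma act_adj_eq:
  assumes "det A > 0" "w \<in> ext_uhp" shows "act (adj A) (act A w) = w"
  using assms by (simp flip: act_mult add: mult_adj)

lemma act_eq_iff:
  assumes "det A > 0" "w \<in> ext_uhp" "z \<in> ext_uhp" shows "act A w = z \<longleftrightarrow> act (adj A) z = w"
  using assms act_adj_eq[of A w] act_adj_eq[of "adj A" z] by auto

lemma act_uminus [simp]: "act (- A) w = act A w"
proof (cases w)
  case (Inner z)
  have "moebius (- A) z = moebius A z"
  proof -
    have "of_int ((-A)$2$1) * z + of_int ((-A)$2$2) = - (of_int (A$2$1) * z + of_int (A$2$2))"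
       "of_int ((-A)$1$1) * z + of_int ((-A)$1$2) = - (of_int (A$1$1) * z + of_int (A$1$2))"
      by (simp_all add: algebra_simps)
    thus ?thesis unfolding moebius_def by (simp only: minus_divide_left[symmetric] minus_divide_right minus_minus)
  qed
  thus ?thesis using Inner by simp
next
  case (Cusp r)
  have "of_int ((-A)$2$1) * r + of_int ((-A)$2$2) = - (of_int (A$2$1) * r + of_int (A$2$2))"
       "of_int ((-A)$1$1) * r + of_int ((-A)$1$2) = - (of_int (A$1$1) * r + of_int (A$1$2))"
    by (simp_all add: algebra_simps)
  thus ?thesis using Cusp by (simp only: act.simps) (simp only: neg_equal_0_iff_equal minus_divide_left[symmetric] minus_divide_right minus_minus)
qed auto

text \<open>A coprime pair is the first column of a matrix of determinant 1; Bezout supplies the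
  second column.\<close>

lemma ex_cusp_matrix:
  assumes "\<And>z. w \<noteq> Inner z"
  shows "\<exists>\<sigma>\<in>SL2Z. act \<sigma> Infty = w"
proof -
  from assms obtain p q where pq: "coprime p q" "w = proj p q" using cusp_cases by metis
  have "\<exists>x y. x * p + y * q = gcd p q" by (rule bezout_int)
  then obtain x y where xy: "p * x + q * y = 1"
    using pq(1) by (metis coprime_imp_gcd_eq_1 mult.commute)
  hence "mk p (-y) q x \<in> SL2Z" by (simp add: SL2Z_def det_2 algebra_simps)
  moreover have "act (mk p (-y) q x) Infty = w" by (simp only: act_Infty pq mk_nth)
  ultimately show ?thesis by blast
qed

section \<open>Orbits and class representatives\<close>

lemma orbit_eq_iff:
  assumes "w \<in> ext_uhp" "z \<in> ext_uhp"
  shows "orbit (Gamma0 N) w = orbit (Gamma0 N) z \<longleftrightarrow> (\<exists>g\<in>Gamma0 N. act g w = z)"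
proof
  assume "orbit (Gamma0 N) w = orbit (Gamma0 N) z"
  moreover have "z \<in> orbit (Gamma0 N) z"
    unfolding orbit_def using assms by (intro image_eqI[of _ _ "mat 1"]) auto
  ultimately have "z \<in> orbit (Gamma0 N) w" by simp
  thus "\<exists>g\<in>Gamma0 N. act g w = z" by (auto simp: orbit_def)
next
  have *: "orbit (Gamma0 N) (act g w) \<subseteq> orbit (Gamma0 N) w"
    if "g \<in> Gamma0 N" "w \<in> ext_uhp" for g w
    using that unfolding orbit_def
    by (auto simp: Gamma0_det simp flip: act_mult)
  assume "\<exists>g\<in>Gamma0 N. act g w = z"
  then obtain g where g: "g \<in> Gamma0 N" "act g w = z" by blast
  hence "act (adj g) z = w" using act_eq_iff[of g w z] assms by (simp add: Gamma0_det)
  thus "orbit (Gamma0 N) w = orbit (Gamma0 N) z"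
    using *[OF g(1) assms(1)] *[OF Gamma0_adj[OF g(1)] assms(2)] g(2) by auto
qed

lemma class_rep_in:
  assumes "x \<in> modular_curve (Gamma0 N)"
  shows "class_rep x \<in> ext_uhp" "orbit (Gamma0 N) (class_rep x) = x"
proof -
  from assms obtain w where w: "w \<in> ext_uhp" "x = orbit (Gamma0 N) w" by (auto simp: modular_curve_def)
  have "w \<in> x" unfolding w(2) orbit_def using w by (intro image_eqI[of _ _ "mat 1"]) auto
  hence "class_rep x \<in> x" unfolding class_rep_def by (rule someI)
  then obtain g where g: "g \<in> Gamma0 N" "act g w = class_rep x" by (auto simp: w(2) orbit_def)
  show *: "class_rep x \<in> ext_uhp" using g w by (metis Gamma0_det act_ext_uhp zero_less_one)
  show "orbit (Gamma0 N) (class_rep x) = x" using orbit_eq_iff[OF w(1) *, of N] g w by auto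
qed

lemma orbit_act [simp]:
  assumes "g \<in> Gamma0 N" "w \<in> ext_uhp"
  shows "orbit (Gamma0 N) (act g w) = orbit (Gamma0 N) w"
  using orbit_eq_iff[of w "act g w" N] assms by (auto simp: Gamma0_det)

section \<open>Finiteness of coset spaces\<close>

text \<open>
  The quotient \<open>B A\<inverse> = B adj(A) / n\<close> is congruent to \<open>A adj(A) / n = I\<close>, entry by entry modulo \<open>N\<close>.
\<close>

lemma same_coset:
  assumes A: "det A = n" and B: "det B = n" and "n > 0"
    and cong: "\<And>i j. A$i$j mod (n * int N) = B$i$j mod (n * int N)"
  shows "\<exists>g\<in>Gamma0 N. B = g ** A"
proof -
  define M where "M = B ** adj A"
  have cM: "n * int N dvd M$i$j - (A ** adj A)$i$j" for i j
    unfolding M_def mult_nth mod_eq_dvd_iff[symmetric]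
    by (intro mod_add_cong mod_mult_cong refl cong[symmetric])
  have dv: "n dvd M$i$j" for i j
  proof -
    have "n dvd M$i$j - (A ** adj A)$i$j"
      using cM[of i j] by (rule dvd_mult_left)
    moreover have "n dvd (A ** adj A)$i$j" by (simp add: mult_adj A mat_def)
    ultimately show ?thesis by (metis dvd_add diff_add_cancel)
  qed
  define g where "g = mk (M$1$1 div n) (M$1$2 div n) (M$2$1 div n) (M$2$2 div n)"
  have gM: "mat n ** g = M"
    unfolding mat2_eq_iff scalar_mult_nth g_def mk_nth by (simp add: dv)
  have "mat n ** (g ** A) = mat n ** B"
  proof -
    have "mat n ** (g ** A) = B ** (adj A ** A)"
      by (simp add: matrix_mul_assoc gM) (simp add: M_def)
    also have "\<dots> = mat n ** B" by (simp add: mult_adj A mat2_eq_iff)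
    finally show ?thesis .
  qed
  hence B': "B = g ** A"
    using mult_left_cancel_det[of "mat n" "g ** A" B] \<open>n > 0\<close> by (simp add: det_2 mat_def)
  have "det g * n = n" using B' A B by (metis det_mul)
  hence "det g = 1" using \<open>n > 0\<close> by simp
  moreover have "int N dvd g$2$1"
  proof -
    have "n * int N dvd M$2$1" using cM[of 2 1] by (simp add: mult_adj A mat_def)
    hence "n * int N dvd n * (g$2$1)" using gM scalar_mult_nth[of n g 2 1] by simp
    thus ?thesis using \<open>n > 0\<close> by simp
  qed
  ultimately show ?thesis using B' by (auto simp: Gamma0_def SL2Z_def)
qed

lemma same_coset_mod:
  assumes A: "det A = n" and B: "det B = n" and "n > 0"
    and "A$1$1 mod (n * int N) = B$1$1 mod (n * int N)" "A$1$2 mod (n * int N) = B$1$2 mod (n * int N)" 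
        "A$2$1 mod (n * int N) = B$2$1 mod (n * int N)" "A$2$2 mod (n * int N) = B$2$2 mod (n * int N)"
  shows "\<exists>g\<in>Gamma0 N. B = g ** A"
proof (rule same_coset[OF A B \<open>n > 0\<close>])
  fix i j :: 2
  show "A$i$j mod (n * int N) = B$i$j mod (n * int N)"
    using exhaust_2[of i] exhaust_2[of j] assms by auto
qed

definition red :: "int \<Rightarrow> mat2 \<Rightarrow> int \<times> int \<times> int \<times> int" where
  "red m A = (A$1$1 mod m, A$1$2 mod m, A$2$1 mod m, A$2$2 mod m)"

lemma finite_red:
  assumes "m > 0" shows "finite (red m ` S)"
proof (rule finite_subset)
  show "red m ` S \<subseteq> {0..<m} \<times> {0..<m} \<times> {0..<m} \<times> {0..<m}"
    using assms by (auto simp: red_def)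
qed auto

lemma hecke_reps_in: "hecke_reps N n R \<Longrightarrow> A \<in> R \<Longrightarrow> A \<in> hecke_set N n"
  by (auto simp: hecke_reps_def)

lemma hecke_reps_unique:
  assumes "hecke_reps N n R" "A \<in> R" "B \<in> R" "g \<in> Gamma0 N" "B = g ** A"
  shows "A = B"
proof -
  have B: "B \<in> hecke_set N n" using assms hecke_reps_in by blast
  have "B = mat 1 ** B" by simp
  with assms B show ?thesis unfolding hecke_reps_def by (metis Gamma0_one)
qed

lemma hecke_reps_obtain:
  assumes "hecke_reps N n R" "B \<in> hecke_set N n"
  obtains A g where "A \<in> R" "g \<in> Gamma0 N" "B = g ** A"
  using assms unfolding hecke_reps_def by metis

text \<open>Matrices of determinant \<open>n\<close> with equal residues modulo \<open>n N\<close>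
  share a coset, so reduction is injective on representatives.\<close>

lemma hecke_reps_finite:
  assumes "hecke_reps N n R" "N > 0" "n > 0"
  shows "finite R"
proof (rule inj_on_finite)
  show "inj_on (red (int n * int N)) R"
  proof (rule inj_onI)
    fix A B assume AB: "A \<in> R" "B \<in> R" "red (int n * int N) A = red (int n * int N) B"
    have "\<exists>g\<in>Gamma0 N. B = g ** A"
      using AB \<open>n > 0\<close> hecke_set_det[OF hecke_reps_in[OF assms(1)]]
      by (intro same_coset_mod[of A "int n"]) (auto simp: red_def)
    thus "A = B" using hecke_reps_unique[OF assms(1) AB(1,2)] by blast
  qed
  show "finite (red (int n * int N) ` R)" using assms by (intro finite_red) simp
qed auto

text \<open>Determinant 1 in the same argument: one matrix for each residue modulo \<open>N\<close>
  suffices.\<close>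

lemma finite_index:
  assumes "N > 0"
  obtains C where "finite C" "C \<subseteq> SL2Z" "\<And>A. A \<in> SL2Z \<Longrightarrow> \<exists>g\<in>Gamma0 N. \<exists>B\<in>C. A = g ** B"
proof -
  have "finite (red (int N) ` SL2Z)" using assms by (intro finite_red) simp
  then obtain C where C: "C \<subseteq> SL2Z" "finite C" "red (int N) ` SL2Z = red (int N) ` C"
    by (metis finite_subset_image order_refl)
  have "\<exists>g\<in>Gamma0 N. \<exists>B\<in>C. A = g ** B" if A: "A \<in> SL2Z" for A
  proof -
    from A C obtain B where B: "B \<in> C" "red (int N) A = red (int N) B" by (metis image_iff)
    with C A have "\<exists>g\<in>Gamma0 N. A = g ** B"
      by (intro same_coset_mod[of B 1]) (auto simp: red_def SL2Z_def)
    thus ?thesis using B by blast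
  qed
  thus ?thesis using that C by blast
qed

declare act.simps(2,3) [simp del]

section \<open>Unipotent matrices and cusp widths\<close>

text \<open>For \<open>N > 0\<close> this is the least \<open>j > 0\<close> such that
  \<open>N\<close> divides \<open>j c^2\<close>, where \<open>c\<close> is the lower left entry: a
  closed form of the index \<open>cusp_width\<close>.\<close>

definition width :: "nat \<Rightarrow> mat2 \<Rightarrow> nat" where
  "width N \<sigma> = N div gcd N (nat (\<bar>\<sigma>$2$1\<bar>) ^ 2)"

lemma width_pos: "N > 0 \<Longrightarrow> width N \<sigma> > 0"
  by (simp add: width_def div_greater_zero_iff dvd_imp_le)

lemma width_dvd_iff:
  assumes "N > 0"
  shows "int (width N \<sigma>) dvd j \<longleftrightarrow> int N dvd j * (\<sigma>$2$1)\<^sup>2"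
proof -
  define c where "c = nat \<bar>\<sigma>$2$1\<bar> ^ 2"
  have c: "int c = (\<sigma>$2$1)\<^sup>2" by (simp add: c_def)
  obtain N' c' where N': "N = N' * gcd N c" "c = c' * gcd N c" "coprime N' c'"
    using gcd_coprime_exists[of N c] assms by auto
  have g: "gcd N c > 0" using assms by simp
  have w: "width N \<sigma> = N'"
    unfolding width_def c_def[symmetric] using N'(1) g by (metis nonzero_mult_div_cancel_right not_less_zero)
  have "int N dvd j * int c \<longleftrightarrow> int N' * int (gcd N c) dvd j * int c' * int (gcd N c)"
    using N'(1,2) by (metis mult.assoc of_nat_mult)
  also have "\<dots> \<longleftrightarrow> int N' dvd j * int c'" using assms by simp
  also have "\<dots> \<longleftrightarrow> int N' dvd j" using N'(3) by (simp add: coprime_dvd_mult_left_iff)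
  finally show ?thesis by (simp add: w c)
qed

text \<open>The conjugated translation has lower left entry \<open>- j c^2\<close>. Up to sign these
  conjugates exhaust the stabiliser of the cusp in \<open>SL2Z\<close>, so the lemma determines the
  stabiliser in \<open>Gamma0 N\<close>.\<close>

lemma conj_unipotent_iff:
  assumes "N > 0" "\<sigma> \<in> SL2Z"
  shows "\<sigma> ** mk 1 j 0 1 ** adj \<sigma> \<in> Gamma0 N \<longleftrightarrow> int (width N \<sigma>) dvd j"
proof -
  have "\<sigma> ** mk 1 j 0 1 ** adj \<sigma> \<in> SL2Z"
    using assms by (auto simp: SL2Z_def det_mul) (simp add: det_2)
  moreover have "(\<sigma> ** mk 1 j 0 1 ** adj \<sigma>)$2$1 = - (j * (\<sigma>$2$1)\<^sup>2)"
    by (simp add: mult_nth algebra_simps power2_eq_square)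
  ultimately show ?thesis unfolding width_dvd_iff[OF assms(1)] Gamma0_def by simp
qed

lemma mk_mult: "mk a b c d ** mk a' b' c' d' = mk (a*a'+b*c') (a*b'+b*d') (c*a'+d*c') (c*b'+d*d')"
  by (simp add: mat2_eq_iff mult_nth)

lemma mk_eq_iff [simp]: "mk a b c d = mk a' b' c' d' \<longleftrightarrow> a = a' \<and> b = b' \<and> c = c' \<and> d = d'"
  by (auto simp: mat2_eq_iff)

lemma minus_mk [simp]: "- mk a b c d = mk (-a) (-b) (-c) (-d)"
  by (simp add: mat2_eq_iff)

lemma det_mk [simp]: "det (mk a b c d) = a * d - b * c"
  by (simp add: det_2)

lemma adj_mk [simp]: "adj (mk a b c d) = mk d (-b) (-c) a"
  by (simp add: adj_def)

lemma act_Infty_eq_iff [simp]: "act A Infty = Infty \<longleftrightarrow> A$2$1 = 0"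
  by (simp add: act.simps)

lemma upper_det_one:
  assumes "det A = 1" "A$2$1 = 0"
  obtains j where "A = mk 1 j 0 1" | j where "A = - mk 1 j 0 1"
proof -
  have "A$1$1 * A$2$2 = 1" using assms by (simp add: det_2)
  hence "A$1$1 = 1 \<and> A$2$2 = 1 \<or> A$1$1 = -1 \<and> A$2$2 = -1"
    by (rule zmult_eq_1_iff[THEN iffD1])
  thus ?thesis
  proof
    assume "A$1$1 = 1 \<and> A$2$2 = 1"
    hence "A = mk 1 (A$1$2) 0 1" using assms by (simp add: mat2_eq_iff)
    thus ?thesis by (rule that(1))
  next
    assume "A$1$1 = -1 \<and> A$2$2 = -1"
    hence "A = - mk 1 (- A$1$2) 0 1" using assms by (simp add: mat2_eq_iff)
    thus ?thesis by (rule that(2))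
  qed
qed

text \<open>Up to sign the stabiliser of infinity consists of the integral translations, and the
  part coming from the conjugated group consists of the translations by multiples of
  \<open>h\<close>. As \<open>subgroup_index\<close> counts cosets as sets, these are listed
  explicitly.\<close>

lemma cusp_width_eq:
  assumes "N > 0" "\<sigma> \<in> SL2Z"
  shows "cusp_width (Gamma0 N) \<sigma> = width N \<sigma>"
proof -
  define h where "h = int (width N \<sigma>)"
  have h: "h > 0" using width_pos[OF assms(1)] by (simp add: h_def)
  define U where "U = (\<lambda>j::int. mk 1 j 0 1)"
  have d: "det \<sigma> = 1" using assms by (simp add: SL2Z_def)
  have U_eq: "U i = U j \<longleftrightarrow> i = j" "- U i = - U j \<longleftrightarrow> i = j" "- U i \<noteq> U j" "U i \<noteq> - U j" for i j
    by (auto simp: U_def simp del: minus_mk)  auto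
  have U_mult: "U i ** U j = U (i + j)" for i j by (simp add: U_def mk_mult)
  have H: "stabilizer SL2Z Infty = range U \<union> range (\<lambda>j. - U j)"
  proof (intro equalityI subsetI)
    fix A assume "A \<in> stabilizer SL2Z Infty"
    hence "det A = 1" "A$2$1 = 0" by (auto simp: stabilizer_def SL2Z_def)
    thus "A \<in> range U \<union> range (\<lambda>j. - U j)"
      by (cases rule: upper_det_one) (auto simp: U_def)
  next
    fix A assume "A \<in> range U \<union> range (\<lambda>j. - U j)"
    thus "A \<in> stabilizer SL2Z Infty" by (auto simp: stabilizer_def SL2Z_def U_def)
  qed
  have conj: "(\<lambda>A. matrix_inv \<sigma> ** A ** \<sigma>) ` Gamma0 N = {B. \<sigma> ** B ** adj \<sigma> \<in> Gamma0 N}"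
  proof (intro equalityI subsetI)
    fix B assume "B \<in> {B. \<sigma> ** B ** adj \<sigma> \<in> Gamma0 N}"
    hence "\<sigma> ** B ** adj \<sigma> \<in> Gamma0 N" by simp
    moreover have "B = matrix_inv \<sigma> ** (\<sigma> ** B ** adj \<sigma>) ** \<sigma>"
      using d by (simp add: matrix_inv_SL2Z assms flip: matrix_mul_assoc) (simp add: matrix_mul_assoc)
    ultimately show "B \<in> (\<lambda>A. matrix_inv \<sigma> ** A ** \<sigma>) ` Gamma0 N" by blast
  next
    fix B assume "B \<in> (\<lambda>A. matrix_inv \<sigma> ** A ** \<sigma>) ` Gamma0 N"
    then obtain A where "A \<in> Gamma0 N" "B = adj \<sigma> ** A ** \<sigma>"
      by (auto simp: matrix_inv_SL2Z assms)
    moreover from this(2) have "\<sigma> ** B ** adj \<sigma> = A" using d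
      by (simp flip: matrix_mul_assoc) (simp add: matrix_mul_assoc)
    ultimately show "B \<in> {B. \<sigma> ** B ** adj \<sigma> \<in> Gamma0 N}" by simp
  qed
  have memU: "\<sigma> ** U j ** adj \<sigma> \<in> Gamma0 N \<longleftrightarrow> h dvd j"
     "\<sigma> ** (- U j) ** adj \<sigma> \<in> Gamma0 N \<longleftrightarrow> h dvd j" for j
    using conj_unipotent_iff[OF assms] by (simp_all add: minus_mult2 U_def h_def del: minus_mk)
  have K: "with_signs (stabilizer ((\<lambda>A. matrix_inv \<sigma> ** A ** \<sigma>) ` Gamma0 N) Infty)
     = U ` {j. h dvd j} \<union> (\<lambda>j. - U j) ` {j. h dvd j}" (is "with_signs ?S = ?K")
  proof -
    have "?S \<subseteq> ?K"
    proof
      fix A assume "A \<in> ?S"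
      hence A: "\<sigma> ** A ** adj \<sigma> \<in> Gamma0 N" "A$2$1 = 0"
        unfolding conj stabilizer_def by (auto)
      have "det (\<sigma> ** A ** adj \<sigma>) = 1" using A(1) by (rule Gamma0_det)
      hence "det A = 1" by (simp add: det_mul d)
      with A(2) consider j where "A = U j" | j where "A = - U j" 
        unfolding U_def using upper_det_one by metis
      thus "A \<in> ?K" using A(1) memU by cases auto
    qed
    moreover have "?K \<subseteq> ?S"
    proof -
      have "U j \<in> ?S" "- U j \<in> ?S" if "h dvd j" for j
        using memU[of j] that unfolding conj stabilizer_def mem_Collect_eq act_Infty_eq_iff
        by (simp_all add: U_def)
      thus ?thesis by blast
    qed
    moreover have "uminus ` ?K \<subseteq> ?K" by auto
    ultimately show ?thesis unfolding with_signs_def by (metis Un_absorb2 subset_antisym)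
  qed
  \<comment> \<open>The common coset of \<open>U j\<close> and \<open>- U j\<close>, which depends
    only on \<open>j\<close> modulo \<open>h\<close>.\<close>
  define C where "C = (\<lambda>j. U ` {i. h dvd i - j} \<union> (\<lambda>i. - U i) ` {i. h dvd i - j})"
  have cos: "(\<lambda>k. k ** U j) ` ?K = C j" "(\<lambda>k. k ** (- U j)) ` ?K = C j" for j
  proof -
    have "(\<lambda>i. i + j) ` {j. h dvd j} = {i. h dvd i - j}"
    proof (intro equalityI subsetI)
      fix i assume "i \<in> {i. h dvd i - j}"
      thus "i \<in> (\<lambda>i. i + j) ` {j. h dvd j}" by (intro image_eqI[of _ _ "i - j"]) auto
    qed auto
    hence 1: "(\<lambda>i. F (i + j)) ` {j. h dvd j} = F ` {i. h dvd i - j}" for F :: "int \<Rightarrow> mat2"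
      by (metis image_image)
    show "(\<lambda>k. k ** U j) ` ?K = C j"
      unfolding image_Un image_image minus_mult2 U_mult C_def 1 by (simp only: 1[of U] 1[of "\<lambda>i. - U i"])
    show "(\<lambda>k. k ** (- U j)) ` ?K = C j"
      unfolding image_Un image_image minus_mult2 U_mult C_def minus_minus 
      by (simp only: 1[of U] 1[of "\<lambda>i. - U i"] Un_commute)
  qed
  have Ceq: "C i = C j \<longleftrightarrow> h dvd i - j" for i j
  proof
    assume "C i = C j"
    moreover have "U i \<in> C i" by (auto simp: C_def)
    ultimately have "U i \<in> C j" by simp
    thus "h dvd i - j" by (auto simp: C_def U_eq)
  next
    assume *: "h dvd i - j"
    have "h dvd k - i \<longleftrightarrow> h dvd k - j" for k
      using dvd_diff[OF _ *, of "k - j"] dvd_add[OF _ *, of "k - i"] by auto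
    thus "C i = C j" by (simp add: C_def)
  qed
  have "subgroup_index (stabilizer SL2Z Infty) (with_signs (stabilizer ((\<lambda>A. matrix_inv \<sigma> ** A ** \<sigma>) ` Gamma0 N) Infty))
    = card (range C)"
    unfolding subgroup_index_def H K image_Un[of "\<lambda>h. (\<lambda>k. k ** h) ` ?K"] image_image cos by simp
  also have "range C = C ` {0..<h}"
  proof -
    have "C j = C (j mod h)" "j mod h \<in> {0..<h}" for j
      using h by (auto simp: Ceq minus_mod_eq_mult_div)
    thus ?thesis by blast
  qed
  also have "card \<dots> = card {0..<h}"
  proof (rule card_image, rule inj_onI)
    fix i j assume ij: "i \<in> {0..<h}" "j \<in> {0..<h}" "C i = C j"
    hence "i mod h = j mod h" unfolding Ceq by (simp only: mod_eq_dvd_iff)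
    moreover have "i mod h = i" "j mod h = j" using ij by auto
    ultimately show "i = j" by simp
  qed
  finally show ?thesis by (simp add: cusp_width_def h_def)
qed

section \<open>Counting at the cusps\<close>

lemma card_periodic:
  fixes P :: "int \<Rightarrow> bool" and p :: int
  assumes per: "\<And>b. P (b + p) \<longleftrightarrow> P b" and "p > 0"
  shows "card {b. P b \<and> 0 \<le> b \<and> b < int k * p} = k * card {b. P b \<and> 0 \<le> b \<and> b < p}"
proof (induction k)
  case (Suc k)
  have per': "P (b + int k * p) \<longleftrightarrow> P b" for k b
    by (induction k arbitrary: b) (auto simp: algebra_simps per simp flip: add.assoc)
  let ?A = "\<lambda>u v. {b. P b \<and> u \<le> b \<and> b < v}"
  have fin: "finite (?A u v)" for u v by (rule finite_subset[of _ "{u..v}"]) auto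
  have kp: "int k * p \<ge> 0" using assms by simp
  have "?A 0 (int (Suc k) * p) = ?A 0 (int k * p) \<union> ?A (int k * p) (int k * p + p)"
  proof -
    have "int (Suc k) * p = int k * p + p" by (simp add: algebra_simps)
    moreover have "?A 0 (m + p) = ?A 0 m \<union> ?A m (m + p)" if "m \<ge> 0" for m
      using that assms(2) by auto
    ultimately show ?thesis using kp by simp
  qed
  moreover have "?A 0 (int k * p) \<inter> ?A (int k * p) (int k * p + p) = {}" by auto
  ultimately have "card (?A 0 (int (Suc k) * p)) = card (?A 0 (int k * p)) + card (?A (int k * p) (int k * p + p))"
    by (simp add: card_Un_disjoint fin)
  also have "card (?A (int k * p) (int k * p + p)) = card (?A 0 p)"
  proof (rule bij_betw_same_card)
    define m where "m = int k * p"
    have m: "P (b - m) \<longleftrightarrow> P b" "P (b + m) \<longleftrightarrow> P b" for b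
      using per'[of "b - m" k] per'[of b k] by (simp_all add: m_def)
    show "bij_betw (\<lambda>b. b - int k * p) (?A (int k * p) (int k * p + p)) (?A 0 p)"
      unfolding m_def[symmetric] by (rule bij_betwI[of _ _ _ "\<lambda>b. b + m"]) (auto simp: m)
  qed
  finally show ?case using Suc by simp
qed auto

text \<open>Both sides count the solutions in a common window of length \<open>p q\<close>;
  densities are thus compared through finite cardinalities.\<close>

lemma card_periodic_swap:
  fixes P :: "int \<Rightarrow> bool" and p q :: nat
  assumes "\<And>b. P (b + int p) \<longleftrightarrow> P b" "\<And>b. P (b + int q) \<longleftrightarrow> P b" "p > 0" "q > 0"
  shows "q * card {b. P b \<and> 0 \<le> b \<and> b < int p} = p * card {b. P b \<and> 0 \<le> b \<and> b < int q}"
  using card_periodic[of P "int p" q] card_periodic[of P "int q" p] assms by (simp add: mult.commute)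

lemma card_periodic_uminus:
  fixes P :: "int \<Rightarrow> bool" and p :: int
  assumes per: "\<And>b. P (b + p) \<longleftrightarrow> P b" and "p > 0"
  shows "card {b. P (- b) \<and> 0 \<le> b \<and> b < p} = card {b. P b \<and> 0 \<le> b \<and> b < p}"
proof (rule bij_betw_same_card)
  have per': "P (p - b) \<longleftrightarrow> P (- b)" for b using per[of "- b"] by simp
  have per'': "P (b - p) \<longleftrightarrow> P b" for b using per[of "b - p"] by simp
  \<comment> \<open>Reflection modulo \<open>p\<close>; zero is treated separately because
    \<open>p - 0\<close> falls outside the half-open window.\<close>
  show "bij_betw (\<lambda>b. if b = 0 then 0 else p - b) {b. P (- b) \<and> 0 \<le> b \<and> b < p} {b. P b \<and> 0 \<le> b \<and> b < p}"
    by (rule bij_betwI[of _ _ _ "\<lambda>b. if b = 0 then 0 else p - b"]) 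
       (use assms(2) in \<open>auto simp: per' per''\<close>)
qed

text \<open>
  Up to sign, the matrices \<open>\<sigma>' (a b; 0 d) \<sigma>\<inverse>\<close> with \<open>a d = n\<close> are all the integral matrices of
  determinant \<open>n\<close> that carry the cusp \<open>\<sigma>\<infinity>\<close> to \<open>\<sigma>'\<infinity>\<close>; left multiplication by the stabiliser of \<open>\<sigma>'\<infinity>\<close> in
  \<open>Gamma0 N\<close> translates \<open>b\<close> by multiples of \<open>d\<close> times the width of \<open>\<sigma>'\<infinity>\<close>.
\<close>

definition offsets :: "nat \<Rightarrow> nat \<Rightarrow> mat2 \<Rightarrow> mat2 \<Rightarrow> nat \<Rightarrow> int set" where
  "offsets N n \<sigma> \<sigma>' a = {b. \<sigma>' ** mk (int a) b 0 (int (n div a)) ** adj \<sigma> \<in> hecke_set N n}"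

definition cusp_index :: "nat \<Rightarrow> nat \<Rightarrow> mat2 \<Rightarrow> mat2 \<Rightarrow> (nat \<times> int) set" where
  "cusp_index N n \<sigma> \<sigma>' = (SIGMA a:{a. a dvd n}.
     {b. b \<in> offsets N n \<sigma> \<sigma>' a \<and> 0 \<le> b \<and> b < int (n div a * width N \<sigma>')})"

lemma offsets_periodic_left:
  assumes "N > 0" "\<sigma>' \<in> SL2Z"
  shows "b + int (n div a * width N \<sigma>') \<in> offsets N n \<sigma> \<sigma>' a \<longleftrightarrow> b \<in> offsets N n \<sigma> \<sigma>' a"
proof -
  have d: "det \<sigma>' = 1" using assms by (simp add: SL2Z_def)
  have eq: "\<sigma>' ** mk (int a) (b + j * int (n div a)) 0 (int (n div a)) ** adj \<sigma>
     = (\<sigma>' ** mk 1 j 0 1 ** adj \<sigma>') ** (\<sigma>' ** mk (int a) b 0 (int (n div a)) ** adj \<sigma>)" for b j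
  proof -
    have "mk (int a) (b + j * int (n div a)) 0 (int (n div a)) = mk 1 j 0 1 ** mk (int a) b 0 (int (n div a))"
      by (simp add: mk_mult)
    thus ?thesis using d by (simp add: matrix_mul_assoc)
  qed
  have G: "\<sigma>' ** mk 1 j 0 1 ** adj \<sigma>' \<in> Gamma0 N" if "int (width N \<sigma>') dvd j" for j
    using conj_unipotent_iff[OF assms] that by blast
  have 1: "b + j * int (n div a) \<in> offsets N n \<sigma> \<sigma>' a" if "b \<in> offsets N n \<sigma> \<sigma>' a" "int (width N \<sigma>') dvd j" for b j
    using that unfolding offsets_def mem_Collect_eq eq by (blast intro: hecke_set_mult_left G)
  show ?thesis
    using 1[of b "int (width N \<sigma>')"] 1[of "b + int (n div a * width N \<sigma>')" "- int (width N \<sigma>')"]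
    by (auto simp: mult.commute)
qed

lemma div_div_eq_self:
  fixes a n :: nat
  assumes "a dvd n" "n > 0"
  shows "n div (n div a) = a" "n div a dvd n"
  using assms by (auto elim!: dvdE)

text \<open>The adjugate exchanges the diagonal entries \<open>a\<close> and \<open>n div a\<close>,
  negates \<open>b\<close> and swaps the two cusps, while preserving the Hecke set.\<close>

lemma offsets_adj:
  assumes "coprime n N" "n > 0" "a dvd n"
  shows "b \<in> offsets N n \<sigma>' \<sigma> a \<longleftrightarrow> - b \<in> offsets N n \<sigma> \<sigma>' (n div a)"
proof -
  have *: "n div (n div a) = a" using assms(2,3) by (auto elim!: dvdE)
  have "adj (\<sigma> ** mk (int a) b 0 (int (n div a)) ** adj \<sigma>') = \<sigma>' ** mk (int (n div a)) (- b) 0 (int a) ** adj \<sigma>"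
    by (simp add: adj_mult matrix_mul_assoc)
  thus ?thesis unfolding offsets_def mem_Collect_eq *
    by (metis adj_adj assms(1) hecke_set_adj)
qed

text \<open>Right multiplication by the stabiliser of the source cusp moves \<open>b\<close> by
  multiples of \<open>a\<close> times its width. Under the adjugate this becomes the periodicity
  from the left with the cusps swapped.\<close>

lemma offsets_periodic_right:
  assumes "N > 0" "n > 0" "coprime n N" "\<sigma> \<in> SL2Z" "a dvd n"
  shows "b + int (a * width N \<sigma>) \<in> offsets N n \<sigma> \<sigma>' a \<longleftrightarrow> b \<in> offsets N n \<sigma> \<sigma>' a"
proof -
  have *: "n div (n div a) = a" "n div a dvd n" using assms(2,5) by (auto elim!: dvdE)
  have adj: "c \<in> offsets N n \<sigma> \<sigma>' a \<longleftrightarrow> - c \<in> offsets N n \<sigma>' \<sigma> (n div a)" for c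
    using offsets_adj[OF assms(3,2,5)] .
  show ?thesis unfolding adj
    using offsets_periodic_left[OF assms(1,4), of "- b - int (a * width N \<sigma>)" n "n div a" \<sigma>']
    by (simp add: *)
qed

lemma upper_cases:
  fixes M :: mat2
  assumes "det M = int n" "n > 0" "M$2$1 = 0"
  obtains a b where "a dvd n" "M = mk (int a) b 0 (int (n div a))"
    | a b where "a dvd n" "- M = mk (int a) b 0 (int (n div a))"
proof -
  have *: "\<exists>a b. a dvd n \<and> M = mk (int a) b 0 (int (n div a))"
    if M: "det M = int n" "M$2$1 = 0" "M$1$1 > 0" for M :: mat2
  proof -
    have e: "M$1$1 * M$2$2 = int n" using M by (simp add: det_2)
    have "nat (M$1$1) dvd n" using e M(3) by (metis dvd_triv_left int_dvd_int_iff nat_0_le order_less_imp_le)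
    moreover have "M$2$2 = int (n div nat (M$1$1))"
      using e M(3) by (metis nat_0_le nonzero_mult_div_cancel_left order_less_imp_le order_less_irrefl zdiv_int)
    ultimately show ?thesis using M
      by (intro exI[of _ "nat (M$1$1)"] exI[of _ "M$1$2"]) (simp add: mat2_eq_iff)
  qed
  have "M$1$1 \<noteq> 0" using assms by (auto simp: det_2)
  hence "M$1$1 > 0 \<or> (-M)$1$1 > 0" by auto
  thus ?thesis using *[of M] *[of "-M"] assms that by auto
qed

text \<open>If \<open>A\<close> carries the first cusp to one equivalent to the second, some
  \<open>g A \<sigma>\<close> is \<open>\<sigma>'\<close> times a triangular matrix. The freedom in
  \<open>g\<close> is the stabiliser of the second cusp in \<open>Gamma0 N\<close>, that is, a sign
  and a translation by a multiple of the width; requiring \<open>a > 0\<close> and reducing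
  \<open>b\<close> uses it up. The relation is kept as a second conclusion because the orders at the
  cusp are read off from it.\<close>

lemma cusp_index_bij:
  assumes "N > 0" "n > 0" "hecke_reps N n R" "\<sigma> \<in> SL2Z" "\<sigma>' \<in> SL2Z"
  obtains \<phi> where
    "bij_betw \<phi> (cusp_index N n \<sigma> \<sigma>')
       {A\<in>R. orbit (Gamma0 N) (act A (act \<sigma> Infty)) = orbit (Gamma0 N) (act \<sigma>' Infty)}"
    "\<And>a b. (a, b) \<in> cusp_index N n \<sigma> \<sigma>' \<Longrightarrow>
       \<exists>g\<in>Gamma0 N. g ** \<phi> (a, b) ** \<sigma> = \<sigma>' ** mk (int a) b 0 (int (n div a))"
proof -
  have d: "det \<sigma> = 1" "det \<sigma>' = 1" using assms by (auto simp: SL2Z_def)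
  let ?I = "cusp_index N n \<sigma> \<sigma>'"
  let ?T = "{A\<in>R. orbit (Gamma0 N) (act A (act \<sigma> Infty)) = orbit (Gamma0 N) (act \<sigma>' Infty)}"
  let ?M = "\<lambda>a b. mk (int a) b 0 (int (n div a))"
  have ext: "act \<sigma> Infty \<in> ext_uhp" "act \<sigma>' Infty \<in> ext_uhp" by (simp_all add: act_Infty)
  have Inf: "Infty \<in> ext_uhp" by (simp add: ext_uhp_def)
  have "\<exists>A. A \<in> R \<and> (\<exists>g\<in>Gamma0 N. g ** A ** \<sigma> = \<sigma>' ** ?M a b)" if "(a, b) \<in> ?I" for a b
  proof -
    have "\<sigma>' ** ?M a b ** adj \<sigma> \<in> hecke_set N n"
      using that by (auto simp: cusp_index_def offsets_def)
    then obtain A g where A: "A \<in> R" "g \<in> Gamma0 N" "\<sigma>' ** ?M a b ** adj \<sigma> = g ** A"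
      using hecke_reps_obtain[OF assms(3)] by metis
    have "g ** A ** \<sigma> = \<sigma>' ** ?M a b" unfolding A(3)[symmetric] using d by simp
    thus ?thesis using A by blast
  qed
  then obtain \<phi>' where \<phi>': "\<And>a b. (a, b) \<in> ?I \<Longrightarrow> \<phi>' a b \<in> R"
    "\<And>a b. (a, b) \<in> ?I \<Longrightarrow> \<exists>g\<in>Gamma0 N. g ** \<phi>' a b ** \<sigma> = \<sigma>' ** ?M a b"
    by metis
  define \<phi> where "\<phi> = case_prod \<phi>'"
  have \<phi>: "\<phi> (a, b) \<in> R" "\<exists>g\<in>Gamma0 N. g ** \<phi> (a, b) ** \<sigma> = \<sigma>' ** ?M a b" if "(a, b) \<in> ?I" for a b
    using \<phi>' that by (auto simp: \<phi>_def)
  have detR: "det A > 0" if "A \<in> R" for A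
    using hecke_set_det[OF hecke_reps_in[OF assms(3) that]] assms(2) by simp
  have "bij_betw \<phi> ?I ?T"
  proof (rule bij_betw_imageI)
    show "inj_on \<phi> ?I"
    proof (rule inj_onI, clarify)
      fix a b a' b' assume I: "(a, b) \<in> ?I" "(a', b') \<in> ?I" and eq: "\<phi> (a, b) = \<phi> (a', b')"
      obtain g where g: "g \<in> Gamma0 N" "g ** \<phi> (a, b) ** \<sigma> = \<sigma>' ** ?M a b" using \<phi>(2)[OF I(1)] by blast
      obtain g' where g': "g' \<in> Gamma0 N" "g' ** \<phi> (a, b) ** \<sigma> = \<sigma>' ** ?M a' b'" 
        using \<phi>(2)[OF I(2)] unfolding eq by blast
      \<comment> \<open>\<open>\<gamma>\<close> carries one triangular matrix to the other, as both
        come from the same representative. It has determinant 1 and fixes infinity, hence is a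
        translation up to sign.\<close>
      define \<gamma> where "\<gamma> = adj \<sigma>' ** (g' ** adj g) ** \<sigma>'"
      have gG: "g' ** adj g \<in> Gamma0 N" using g g' by blast
      have "\<gamma> ** ?M a b = adj \<sigma>' ** (g' ** (adj g ** (\<sigma>' ** ?M a b)))"
        by (simp add: \<gamma>_def matrix_mul_assoc)
      also have "\<dots> = adj \<sigma>' ** (g' ** \<phi> (a, b) ** \<sigma>)"
        unfolding g(2)[symmetric] using g(1) by (simp add: Gamma0_det flip: matrix_mul_assoc)
      also have "\<dots> = ?M a' b'" unfolding g' using d by simp
      finally have \<gamma>: "\<gamma> ** ?M a b = ?M a' b'" .
      have ab: "a dvd n" "a > 0" "a' dvd n" "a' > 0" "n div a > 0" "0 \<le> b" "b < int (n div a * width N \<sigma>')" 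
           "0 \<le> b'" "b' < int (n div a' * width N \<sigma>')"
        using I \<open>n > 0\<close> by (auto simp: cusp_index_def dvd_imp_le intro!: Nat.gr0I elim!: dvdE)
      have "det \<gamma> = 1" using Gamma0_det[OF gG] d by (simp add: \<gamma>_def det_mul)
      moreover have c: "\<gamma>$2$1 = 0" using arg_cong[OF \<gamma>, of "\<lambda>A. A$2$1"] ab by (simp add: mult_nth)
      ultimately consider j where "\<gamma> = mk 1 j 0 1" | j where "\<gamma> = - mk 1 j 0 1"
        using upper_det_one by metis
      thus "a = a' \<and> b = b'"
      proof cases
        case (1 j)
        hence eqs: "a' = a" "b' = b + j * int (n div a)" using \<gamma> by (auto simp: mk_mult)
        have "\<sigma>' ** mk 1 j 0 1 ** adj \<sigma>' = g' ** adj g"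
          using d unfolding 1[symmetric] \<gamma>_def by (simp flip: matrix_mul_assoc) (simp add: matrix_mul_assoc)
        with gG have "int (width N \<sigma>') dvd j"
          using conj_unipotent_iff[OF assms(1,5), of j] by simp
        then obtain t where t: "j = int (width N \<sigma>') * t" by blast
        define P where "P = int (n div a * width N \<sigma>')"
        have "b' = b + P * t" using eqs t by (simp add: P_def algebra_simps)
        hence "b' mod P = b mod P" by simp
        thus ?thesis using ab eqs by (simp add: P_def)
      next
        case (2 j)
        \<comment> \<open>The sign is excluded because both \<open>a\<close> and \<open>a'\<close>
          are positive.\<close>
        hence "int a' = - int a" using \<gamma> by (simp add: mk_mult)
        thus ?thesis using ab by simp
      qed
    qed
    show "\<phi> ` ?I = ?T"
    proof (intro equalityI subsetI)
      fix A assume "A \<in> \<phi> ` ?I"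
      then obtain a b where ab: "(a, b) \<in> ?I" "A = \<phi> (a, b)" by auto
      from \<phi>[OF ab(1)] obtain g where A: "A \<in> R" and g: "g \<in> Gamma0 N" "g ** A ** \<sigma> = \<sigma>' ** ?M a b"
        unfolding ab(2) by blast
      have nn: "int a * int (n div a) > 0" using ab(1) \<open>n > 0\<close> by (auto simp: cusp_index_def elim!: dvdE)
      have "act (g ** A ** \<sigma>) Infty = act (\<sigma>' ** ?M a b) Infty" by (simp only: g)
      also have "\<dots> = act \<sigma>' (act (?M a b) Infty)"
        by (rule act_mult) (use d nn Inf in auto)
      also have "act (?M a b) Infty = Infty" by simp
      also have "act (g ** A ** \<sigma>) Infty = act g (act A (act \<sigma> Infty))"
        using detR[OF A] Gamma0_det[OF g(1)] d ext Inf by (simp add: act_mult det_mul)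
      finally have "orbit (Gamma0 N) (act A (act \<sigma> Infty)) = orbit (Gamma0 N) (act \<sigma>' Infty)"
        using detR[OF A] ext g(1) by (subst orbit_eq_iff) auto
      thus "A \<in> ?T" using A by simp
    next
      fix A assume "A \<in> ?T"
      hence A: "A \<in> R" and o: "orbit (Gamma0 N) (act A (act \<sigma> Infty)) = orbit (Gamma0 N) (act \<sigma>' Infty)"
        by auto
      obtain g where g: "g \<in> Gamma0 N" "act g (act A (act \<sigma> Infty)) = act \<sigma>' Infty"
        using o detR[OF A] ext by (subst (asm) orbit_eq_iff) auto
      define M where "M = adj \<sigma>' ** g ** A ** \<sigma>"
      have A': "A \<in> hecke_set N n" using hecke_reps_in[OF assms(3) A] .
      have detM: "det M = int n" using hecke_set_det[OF A'] Gamma0_det[OF g(1)] d by (simp add: M_def det_mul)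
      have "act M Infty = act (adj \<sigma>') (act g (act A (act \<sigma> Infty)))"
        using detR[OF A] Gamma0_det[OF g(1)] d ext Inf by (simp add: M_def act_mult det_mul)
      also have "\<dots> = Infty" unfolding g using d Inf by (intro act_adj_eq) auto
      finally have M21: "M$2$1 = 0" by (simp only: act_Infty_eq_iff)
      have *: "\<exists>a b g. a dvd n \<and> g \<in> Gamma0 N \<and> g ** A ** \<sigma> = \<sigma>' ** ?M a b"
        using detM \<open>n > 0\<close> M21
      proof (cases rule: upper_cases)
        case (1 a b)
        have "g ** A ** \<sigma> = \<sigma>' ** M" using d by (simp add: M_def flip: matrix_mul_assoc)
        thus ?thesis using 1 g by metis
      next
        case (2 a b)
        have "(- g) ** A ** \<sigma> = \<sigma>' ** (- M)" using d by (simp add: M_def minus_mult2 flip: matrix_mul_assoc)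
        thus ?thesis using 2 g by (metis Gamma0_uminus)
      qed
      then obtain a b g where g: "a dvd n" "g \<in> Gamma0 N" "g ** A ** \<sigma> = \<sigma>' ** ?M a b" by blast
      define h where "h = int (width N \<sigma>')"
      define e where "e = int (n div a)"
      have h: "h > 0" using width_pos[OF assms(1)] by (simp add: h_def)
      have e: "e > 0" using g(1) \<open>n > 0\<close> by (auto simp: e_def elim!: dvdE)
      \<comment> \<open>A multiple of the width, so that the conjugated translation lies in
        \<open>Gamma0 N\<close>; it replaces \<open>b\<close> by its residue modulo
        \<open>e h\<close>.\<close>
      define j where "j = - h * (b div (e * h))"
      define g2 where "g2 = (\<sigma>' ** mk 1 j 0 1 ** adj \<sigma>') ** g"
      have "\<sigma>' ** mk 1 j 0 1 ** adj \<sigma>' \<in> Gamma0 N"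
        using conj_unipotent_iff[OF assms(1,5), of j] by (simp add: j_def h_def)
      hence g2: "g2 \<in> Gamma0 N" unfolding g2_def using g(2) by (rule Gamma0_mult)
      have b': "b + j * e = b mod (e * h)"
        by (simp add: j_def minus_mult_div_eq_mod[symmetric] algebra_simps)
      have "g2 ** A ** \<sigma> = \<sigma>' ** (mk 1 j 0 1 ** (adj \<sigma>' ** (g ** A ** \<sigma>)))"
        by (simp add: g2_def matrix_mul_assoc)
      also have "\<dots> = \<sigma>' ** (mk 1 j 0 1 ** ?M a b)" using d unfolding g by simp
      also have "mk 1 j 0 1 ** ?M a b = ?M a (b mod (e * h))"
        unfolding mk_mult b'[symmetric] by (simp add: e_def)
      finally have g2': "g2 ** A ** \<sigma> = \<sigma>' ** ?M a (b mod (e * h))" .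
      have "\<sigma>' ** ?M a (b mod (e * h)) ** adj \<sigma> = g2 ** A"
        unfolding g2'[symmetric] using d by simp
      also have "\<dots> \<in> hecke_set N n" using g2 A' by (rule hecke_set_mult_left)
      finally have I: "(a, b mod (e * h)) \<in> ?I"
        using e h g(1) unfolding cusp_index_def offsets_def by (simp add: e_def h_def)
      obtain g3 where g3: "g3 \<in> Gamma0 N" "g3 ** \<phi> (a, b mod (e * h)) ** \<sigma> = \<sigma>' ** ?M a (b mod (e * h))" 
        using \<phi>(2)[OF I] by blast
      have "g3 ** \<phi> (a, b mod (e * h)) = g2 ** A"
        by (rule mult_right_cancel_det[of \<sigma>]) (use g3 g2' d in auto)
      hence "\<phi> (a, b mod (e * h)) = adj g3 ** g2 ** A"
        using g3(1) by (metis Gamma0_det adj_mult_cancel(2) matrix_mul_assoc)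
      hence "A = \<phi> (a, b mod (e * h))"
        using hecke_reps_unique[OF assms(3) A \<phi>(1)[OF I], of "adj g3 ** g2"] g2 g3(1) by blast
      thus "A \<in> \<phi> ` ?I" using I by blast
    qed
  qed
  thus ?thesis using that \<phi>(2) by blast
qed

text \<open>For each \<open>a\<close> the summand turns the number of offsets in one period into the
  number in the other period. By \<open>offsets_adj\<close> the latter offsets belong to the pair of
  cusps in the opposite order and to the divisor \<open>n div a\<close>, so the total is the size of
  the opposite \<open>cusp_index\<close>.\<close>

lemma cusp_count:
  assumes "N > 0" "n > 0" "coprime n N" "hecke_reps N n R" "\<sigma> \<in> SL2Z" "\<sigma>' \<in> SL2Z"
  shows "(\<Sum>(a, b)\<in>cusp_index N n \<sigma> \<sigma>'. of_nat (a * width N \<sigma>) / of_nat (n div a * width N \<sigma>'))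
    = (of_nat (card {A\<in>R. orbit (Gamma0 N) (act A (act \<sigma>' Infty)) = orbit (Gamma0 N) (act \<sigma> Infty)}) :: real)"
proof -
  let ?c = "\<lambda>a p. card {b. b \<in> offsets N n \<sigma> \<sigma>' a \<and> 0 \<le> b \<and> b < int p}"
  have fin: "finite {a. a dvd n}" using assms(2) by simp
  have fin': "finite {b. P b \<and> 0 \<le> b \<and> b < int p}" for P p
    by (rule finite_subset[of _ "{0..<int p}"]) auto
  have w: "width N \<sigma> > 0" "width N \<sigma>' > 0" using width_pos[OF assms(1)] by auto
  have pos: "a > 0" "n div a > 0" if "a dvd n" for a using that assms(2) by (auto elim!: dvdE intro!: Nat.gr0I)
  have "(\<Sum>(a, b)\<in>cusp_index N n \<sigma> \<sigma>'. of_nat (a * width N \<sigma>) / of_nat (n div a * width N \<sigma>') :: real)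
    = (\<Sum>a | a dvd n. of_nat (?c a (n div a * width N \<sigma>')) * (of_nat (a * width N \<sigma>) / of_nat (n div a * width N \<sigma>')))"
    unfolding cusp_index_def using fin fin' by (subst sum.Sigma[symmetric]) auto
  also have "\<dots> = (\<Sum>a | a dvd n. of_nat (?c a (a * width N \<sigma>)))"
  proof (rule sum.cong[OF refl])
    fix a assume "a \<in> {a. a dvd n}"
    hence a: "a dvd n" by simp
    define p q where "p = n div a * width N \<sigma>'" and "q = a * width N \<sigma>"
    have p: "p > 0" "q > 0" using pos[OF a] w by (auto simp: p_def q_def)
    have "q * ?c a p = p * ?c a q"
      by (rule card_periodic_swap)
         (use p offsets_periodic_left[OF assms(1,6)] offsets_periodic_right[OF assms(1-3,5) a]
          in \<open>simp_all add: p_def q_def del: of_nat_mult\<close>)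
    from arg_cong[OF this, of "of_nat :: nat \<Rightarrow> real"]
    have "of_nat q * of_nat (?c a p) = (of_nat p * of_nat (?c a q) :: real)"
      by (simp only: of_nat_mult)
    thus "of_nat (?c a (n div a * width N \<sigma>')) * (of_nat (a * width N \<sigma>) / of_nat (n div a * width N \<sigma>')) 
       = (of_nat (?c a (a * width N \<sigma>)) :: real)"
      using p unfolding p_def[symmetric] q_def[symmetric] by (simp add: field_simps)
  qed
  also have "\<dots> = of_nat (\<Sum>a | a dvd n. ?c a (a * width N \<sigma>))" by simp
  \<comment> \<open>The adjugate interchanges \<open>a\<close> and \<open>n div a\<close>, so the
    divisors are reindexed to match.\<close>
  also have "(\<Sum>a | a dvd n. ?c a (a * width N \<sigma>)) = (\<Sum>a | a dvd n. ?c (n div a) (n div a * width N \<sigma>))"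
    by (rule sum.reindex_bij_witness[of _ "\<lambda>a. n div a" "\<lambda>a. n div a"]) 
       (use assms(2) in \<open>auto simp: div_div_eq_self\<close>)
  also have "\<dots> = (\<Sum>a | a dvd n. card {b. b \<in> offsets N n \<sigma>' \<sigma> a \<and> 0 \<le> b \<and> b < int (n div a * width N \<sigma>)})"
  proof (rule sum.cong[OF refl])
    fix a assume "a \<in> {a. a dvd n}"
    hence a: "a dvd n" by simp
    hence a': "n div a dvd n" "n div (n div a) = a" using assms(2) by (auto elim!: dvdE)
    have "card {b. - b \<in> offsets N n \<sigma> \<sigma>' (n div a) \<and> 0 \<le> b \<and> b < int (n div a * width N \<sigma>)}
        = ?c (n div a) (n div a * width N \<sigma>)"
      by (rule card_periodic_uminus)
         (use offsets_periodic_right[OF assms(1-3,5) a'(1)] pos[OF a] w in \<open>simp_all del: of_nat_mult\<close>)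
    thus "?c (n div a) (n div a * width N \<sigma>) = 
       card {b. b \<in> offsets N n \<sigma>' \<sigma> a \<and> 0 \<le> b \<and> b < int (n div a * width N \<sigma>)}"
      by (simp add: offsets_adj[OF assms(3,2) a])
  qed
  also have "\<dots> = card (cusp_index N n \<sigma>' \<sigma>)"
    unfolding cusp_index_def using fin fin' by (subst card_SigmaI) auto
  also have "\<dots> = card {A\<in>R. orbit (Gamma0 N) (act A (act \<sigma>' Infty)) = orbit (Gamma0 N) (act \<sigma> Infty)}"
    by (rule cusp_index_bij[OF assms(1,2,4,6,5)]) (rule bij_betw_same_card)
  finally show ?thesis .
qed

section \<open>Counting at interior points\<close>

text \<open>The imaginary part \<open>c Im z\<close> bounds \<open>c\<close>, and the triangle
  inequality then bounds \<open>d\<close>.\<close>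

lemma finite_lattice_points:
  assumes "z \<in> uhp"
  shows "finite {(c, d). cmod (of_int c * z + of_int d) \<le> K}"
proof (rule finite_subset)
  define C where "C = \<lceil>K / Im z\<rceil>"
  define D where "D = \<lceil>K + of_int C * cmod z\<rceil>"
  have z: "Im z > 0" using assms by (simp add: uhp_iff)
  show "{(c, d). cmod (of_int c * z + of_int d) \<le> K} \<subseteq> {-C..C} \<times> {-D..D}"
  proof clarify
    fix c d assume cd: "cmod (of_int c * z + of_int d) \<le> K"
    have "\<bar>of_int c\<bar> * Im z = \<bar>Im (of_int c * z + of_int d)\<bar>" using z by (simp add: abs_mult)
    also have "\<dots> \<le> K" using cd abs_Im_le_cmod order_trans by blast
    finally have "\<bar>of_int c\<bar> \<le> K / Im z" using z by (simp add: pos_le_divide_eq)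
    hence c: "\<bar>c\<bar> \<le> C" unfolding C_def by linarith
    have "cmod (of_int d) \<le> cmod (of_int c * z + of_int d) + cmod (of_int c * z)"
      by (metis add_diff_cancel_left' norm_triangle_ineq4)
    also have "cmod (of_int c * z) \<le> of_int C * cmod z"
      using c by (simp add: norm_mult mult_right_mono flip: of_int_abs)
    finally have "\<bar>of_int d\<bar> \<le> K + of_int C * cmod z" using cd by simp
    hence "\<bar>d\<bar> \<le> D" unfolding D_def by linarith
    thus "c \<in> {-C..C} \<and> d \<in> {-D..D}" using c by auto
  qed
qed auto

definition stab :: "nat \<Rightarrow> complex \<Rightarrow> mat2 set" where
  "stab N z = stabilizer (Gamma0 N) (Inner z)"

lemma stab_iff: "A \<in> stab N z \<longleftrightarrow> A \<in> Gamma0 N \<and> moebius A z = z"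
  by (simp add: stab_def stabilizer_def)

text \<open>The bottom row determines the matrix, because \<open>num A z = z * den A z\<close> and
  \<open>1, z\<close> are linearly independent over the reals. Invariance of \<open>Im z\<close>
  forces \<open>|c z + d| = 1\<close>, which leaves finitely many bottom rows.\<close>

lemma finite_stab:
  assumes "z \<in> uhp" shows "finite (stab N z)"
proof (rule inj_on_finite)
  let ?f = "\<lambda>A::mat2. (A$2$1, A$2$2)"
  show "inj_on ?f (stab N z)"
  proof (rule inj_onI)
    fix A B assume AB: "A \<in> stab N z" "B \<in> stab N z" "?f A = ?f B"
    have *: "num A z = z * den A z" if "A \<in> stab N z" for A
      using that den_nonzero[of A z] assms by (auto simp: stab_iff moebius_eq Gamma0_det field_simps)
    have "den A z = den B z" using AB by (simp add: den_def)
    hence "num A z = num B z" using * AB by simp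
    hence "of_int (A$1$1 - B$1$1) * z + of_int (A$1$2 - B$1$2) = 0" by (simp add: num_def algebra_simps)
    hence "Im (of_int (A$1$1 - B$1$1) * z + of_int (A$1$2 - B$1$2)) = 0" 
      "Re (of_int (A$1$1 - B$1$1) * z + of_int (A$1$2 - B$1$2)) = 0" by simp_all
    hence "A$1$1 = B$1$1" "A$1$2 = B$1$2" using assms by (auto simp: uhp_iff)
    thus "A = B" using AB by (simp add: mat2_eq_iff)
  qed
  show "?f ` stab N z \<subseteq> {(c, d). cmod (of_int c * z + of_int d) \<le> 1}"
  proof clarify
    fix A assume A: "A \<in> stab N z"
    hence "det A = 1" "moebius A z = z" by (auto simp: stab_iff dest: Gamma0_det)
    hence "Im z = Im z / (cmod (den A z))\<^sup>2" using Im_moebius[of A z] assms by simp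
    moreover have "den A z \<noteq> 0" using den_nonzero[of A z] assms A by (auto simp: stab_iff Gamma0_det)
    ultimately have "(cmod (den A z))\<^sup>2 = 1" using assms by (simp add: uhp_iff field_simps)
    hence "cmod (den A z) = 1" by (simp add: power2_eq_1_iff) (metis norm_ge_zero not_one_le_zero neg_0_le_iff_le order_trans)
    thus "cmod (of_int (A$2$1) * z + of_int (A$2$2)) \<le> 1" by (simp add: den_def)
  qed
  show "finite {(c, d). cmod (of_int c * z + of_int d) \<le> 1}" by (rule finite_lattice_points) fact
qed

text \<open>As \<open>- I\<close> lies in \<open>Gamma0 N\<close>, adjoining signs changes nothing,
  and each coset of \<open>{I, - I}\<close> is a pair of distinct matrices; hence the factor
  2.\<close>

lemma card_stab:
  assumes "z \<in> uhp" shows "card (stab N z) = 2 * ramification (Gamma0 N) z"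
proof -
  let ?f = "\<lambda>h::mat2. (\<lambda>k. k ** h) ` {mat 1, - mat 1}"
  have f: "?f h = {h, - h}" for h by (simp add: minus_mult2)
  have ws: "with_signs (stabilizer (Gamma0 N) (Inner z)) = stab N z"
    by (auto simp: with_signs_def stab_def stabilizer_def simp del: act.simps)
  have "card (stab N z) = (\<Sum>A\<in>stab N z. 1)" by simp
  also have "\<dots> = (\<Sum>y\<in>?f ` stab N z. \<Sum>A | A \<in> stab N z \<and> ?f A = y. 1)"
    by (rule sum.image_gen) (rule finite_stab, fact)
  also have "\<dots> = (\<Sum>y\<in>?f ` stab N z. 2)"
  proof (rule sum.cong[OF refl])
    fix y assume "y \<in> ?f ` stab N z"
    then obtain B where B: "B \<in> stab N z" "y = ?f B" by blast
    have "- B \<in> stab N z" using B by (auto simp: stab_def stabilizer_def simp del: act.simps)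
    hence "{A. A \<in> stab N z \<and> ?f A = y} = {B, - B}" using B unfolding f
      by (auto simp: doubleton_eq_iff)
    moreover have "B \<noteq> - B"
    proof
      assume "B = - B"
      hence "B$i$j = 0" for i j by (metis equation_minus_iff neg_equal_zero vector_uminus_component)
      hence "det B = 0" by (simp add: det_2)
      thus False using B(1) by (auto simp: stab_iff dest: Gamma0_det)
    qed
    ultimately show "(\<Sum>A | A \<in> stab N z \<and> ?f A = y. 1) = 2" by simp
  qed
  also have "\<dots> = 2 * ramification (Gamma0 N) z"
    by (simp add: ramification_def subgroup_index_def ws)
  finally show ?thesis .
qed

lemma ramification_pos:
  assumes "z \<in> uhp" shows "ramification (Gamma0 N) z > 0"
proof -
  have "mat 1 \<in> stab N z" by (simp add: stab_iff)
  hence "card (stab N z) > 0" using finite_stab[OF assms] by (auto simp: card_gt_0_iff)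
  thus ?thesis using card_stab[OF assms, of N] by simp
qed

definition transporter :: "nat \<Rightarrow> nat \<Rightarrow> complex \<Rightarrow> complex \<Rightarrow> mat2 set" where
  "transporter N n w z = {B \<in> hecke_set N n. act B (Inner w) = Inner z}"

text \<open>A matrix carrying \<open>w\<close> to \<open>z\<close> is \<open>g A\<close> with a
  unique \<open>A\<close> in \<open>R\<close>; for fixed \<open>A\<close> the admissible
  \<open>g\<close> form one coset of the stabiliser of \<open>z\<close>, with \<open>t A\<close> as
  chosen base point.\<close>

lemma card_transporter:
  assumes "n > 0" "hecke_reps N n R" "w \<in> uhp" "z \<in> uhp"
  shows "card (transporter N n w z) = card (stab N z) *
    card {A\<in>R. orbit (Gamma0 N) (act A (Inner w)) = orbit (Gamma0 N) (Inner z)}"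
proof -
  let ?T = "{A\<in>R. orbit (Gamma0 N) (act A (Inner w)) = orbit (Gamma0 N) (Inner z)}"
  have ext: "Inner w \<in> ext_uhp" "Inner z \<in> ext_uhp" using assms by (auto simp: ext_uhp_def)
  have R: "A \<in> hecke_set N n" "det A > 0" if "A \<in> R" for A
    using hecke_reps_in[OF assms(2) that] hecke_set_det assms(1) by auto
  define t where "t = (\<lambda>A. SOME g. g \<in> Gamma0 N \<and> act g (act A (Inner w)) = Inner z)"
  have ex: "\<exists>g. g \<in> Gamma0 N \<and> act g (act A (Inner w)) = Inner z" if "A \<in> ?T" for A
    using that orbit_eq_iff[OF act_ext_uhp[OF R(2) ext(1)] ext(2), of A N] by blast
  have t: "t A \<in> Gamma0 N" "act (t A) (act A (Inner w)) = Inner z" if "A \<in> ?T" for A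
    using someI_ex[OF ex[OF that]] unfolding t_def by auto
  have "bij_betw (\<lambda>(g, A). g ** t A ** A) (stab N z \<times> ?T) (transporter N n w z)"
  proof (rule bij_betw_imageI)
    show "inj_on (\<lambda>(g, A). g ** t A ** A) (stab N z \<times> ?T)"
    proof (rule inj_onI, clarify)
      fix g A g' A'
      assume A: "A \<in> R" "orbit (Gamma0 N) (act A (Inner w)) = orbit (Gamma0 N) (Inner z)"
        and A': "A' \<in> R" "orbit (Gamma0 N) (act A' (Inner w)) = orbit (Gamma0 N) (Inner z)"
        and g: "g \<in> stab N z" "g' \<in> stab N z" and eq: "g ** t A ** A = g' ** t A' ** A'"
      define u u' where "u = g ** t A" and "u' = g' ** t A'"
      have u: "u \<in> Gamma0 N" "u' \<in> Gamma0 N" using t A A' g by (auto simp: u_def u'_def stab_iff)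
      have "A' = adj u' ** u ** A" using eq u(2) unfolding u_def[symmetric] u'_def[symmetric]
        by (metis Gamma0_det adj_mult_cancel(2) matrix_mul_assoc)
      hence AA: "A = A'" using hecke_reps_unique[OF assms(2) A(1) A'(1), of "adj u' ** u"] u by blast
      have "g ** t A = g' ** t A" 
        using eq mult_right_cancel_det[of A] R(2)[OF A(1)] unfolding AA by simp
      hence "g = g'" using mult_right_cancel_det[of "t A"] t(1)[of A] A by (simp add: Gamma0_det)
      thus "g = g' \<and> A = A'" using AA by simp
    qed
    show "(\<lambda>(g, A). g ** t A ** A) ` (stab N z \<times> ?T) = transporter N n w z"
    proof (intro equalityI subsetI)
      fix B assume "B \<in> (\<lambda>(g, A). g ** t A ** A) ` (stab N z \<times> ?T)"
      then obtain g A where g: "g \<in> stab N z" "A \<in> ?T" "B = g ** t A ** A" by auto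
      have A: "A \<in> R" "t A \<in> Gamma0 N" "g \<in> Gamma0 N" using g t by (auto simp: stab_iff)
      have "B \<in> hecke_set N n" unfolding g(3) using A R by (intro hecke_set_mult_left Gamma0_mult)
      moreover have "act B (Inner w) = act g (act (t A) (act A (Inner w)))"
        unfolding g(3) using A R ext by (simp add: act_mult det_mul Gamma0_det del: act.simps)
      hence "act B (Inner w) = Inner z" using t(2)[OF g(2)] g(1) by (simp add: stab_iff)
      ultimately show "B \<in> transporter N n w z" by (simp add: transporter_def del: act.simps)
    next
      fix B assume "B \<in> transporter N n w z"
      hence B: "B \<in> hecke_set N n" "act B (Inner w) = Inner z" by (auto simp: transporter_def)
      obtain A g where A: "A \<in> R" "g \<in> Gamma0 N" "B = g ** A" using hecke_reps_obtain[OF assms(2) B(1)] by metis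
      have gz: "act g (act A (Inner w)) = Inner z"
        using B(2) A R ext by (simp add: act_mult Gamma0_det del: act.simps)
      have T: "A \<in> ?T" using gz A R ext by (auto simp: orbit_eq_iff simp del: act.simps)
      have tA: "t A \<in> Gamma0 N" "act (t A) (act A (Inner w)) = Inner z" using t T by auto
      define k where "k = g ** adj (t A)"
      have "act k (Inner z) = act g (act (adj (t A)) (act (t A) (act A (Inner w))))"
        using A tA(1) ext unfolding tA(2) by (simp add: k_def act_mult Gamma0_det del: act.simps)
      also have "\<dots> = Inner z" using tA(1) A R ext gz by (subst act_adj_eq) (auto simp: Gamma0_det simp del: act.simps)
      finally have "k \<in> stab N z" using A tA(1) by (auto simp: stab_iff k_def)
      moreover have "k ** t A ** A = B" using tA(1) A by (simp add: k_def Gamma0_det)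
      ultimately show "B \<in> (\<lambda>(g, A). g ** t A ** A) ` (stab N z \<times> ?T)" using T by (intro image_eqI[of _ _ "(k, A)"]) auto
    qed
  qed
  from bij_betw_same_card[OF this] show ?thesis by (simp add: card_cartesian_product)
qed

lemma inner_count:
  assumes "n > 0" "coprime n N" "hecke_reps N n R" "w \<in> uhp" "z \<in> uhp"
  shows "ramification (Gamma0 N) z * card {A\<in>R. orbit (Gamma0 N) (act A (Inner w)) = orbit (Gamma0 N) (Inner z)}
    = ramification (Gamma0 N) w * card {A\<in>R. orbit (Gamma0 N) (act A (Inner z)) = orbit (Gamma0 N) (Inner w)}"
proof -
  have ext: "Inner w \<in> ext_uhp" "Inner z \<in> ext_uhp" using assms by (auto simp: ext_uhp_def)
  have "bij_betw adj (transporter N n w z) (transporter N n z w)"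
    by (rule bij_betwI[of _ _ _ adj])
       (use act_eq_iff[OF _ ext] act_eq_iff[OF _ ext(2,1)] assms hecke_set_adj
         in \<open>auto simp: transporter_def hecke_set_det simp del: act.simps\<close>)
  hence "card (transporter N n w z) = card (transporter N n z w)" by (rule bij_betw_same_card)
  thus ?thesis unfolding card_transporter[OF assms(1,3,4,5)] card_transporter[OF assms(1,3,5,4)]
    card_stab[OF assms(4)] card_stab[OF assms(5)] by simp
qed

section \<open>Order of growth at the cusp infinity\<close>

definition ee :: "real \<Rightarrow> complex \<Rightarrow> complex" where
  "ee r \<tau> = exp (2 * of_real pi * \<i> * of_real r * \<tau>)"

lemma ee_add: "ee (r + s) \<tau> = ee r \<tau> * ee s \<tau>"
  by (simp add: ee_def ring_distribs flip: exp_add)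

lemma ee_add_arg: "ee r (\<tau> + \<tau>') = ee r \<tau> * ee r \<tau>'"
  by (simp add: ee_def ring_distribs flip: exp_add)

lemma ee_0 [simp]: "ee 0 \<tau> = 1"
  by (simp add: ee_def)

lemma ee_nonzero [simp]: "ee r \<tau> \<noteq> 0"
  by (simp add: ee_def)

lemma ee_minus_mult [simp]: "ee r \<tau> * ee (- r) \<tau> = 1" "ee (- r) \<tau> * ee r \<tau> = 1"
  by (simp_all flip: ee_add)

lemma ee_powi: "ee r \<tau> powi m = ee (of_int m * r) \<tau>"
  by (simp add: ee_def exp_power_int mult_ac)

lemma norm_ee: "cmod (ee r \<tau>) = exp (- (2 * pi * r * Im \<tau>))"
  by (simp add: ee_def)

lemma ee_sum: "ee (\<Sum>x\<in>A. f x) \<tau> = (\<Prod>x\<in>A. ee (f x) \<tau>)"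
  by (induction A rule: infinite_finite_induct) (auto simp: ee_add)

lemma holomorphic_ee [holomorphic_intros]: "(\<lambda>\<tau>. ee r \<tau>) holomorphic_on A"
  unfolding ee_def by (intro holomorphic_intros)

lemma q_eq_ee: "exp (2 * of_real pi * \<i> * \<tau> / of_nat h) = ee (1 / real h) \<tau>"
  by (simp add: ee_def)

text \<open>\<open>Im \<tau>\<close> grows with no restriction on the real part, so that limits
  along this filter match limits as the local parameter tends to 0.\<close>

abbreviation (input) at_cusp :: "complex filter" where
  "at_cusp \<equiv> filtercomap Im at_top"

lemma eventually_at_cusp: "eventually P at_cusp \<longleftrightarrow> (\<exists>Y. \<forall>\<tau>. Im \<tau> > Y \<longrightarrow> P \<tau>)"
  by (simp add: eventually_filtercomap_at_top_dense)

lemma at_cusp_not_bot [simp]: "at_cusp \<noteq> bot"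
proof -
  have "\<exists>\<tau>. Im \<tau> > Y" for Y by (intro exI[of _ "Complex 0 (Y + 1)"]) simp
  thus ?thesis by (auto simp: trivial_limit_def eventually_at_cusp)
qed

lemma ee_tendsto_0:
  assumes "r > 0" shows "(ee r \<longlongrightarrow> 0) at_cusp"
proof (rule tendsto_norm_zero_cancel)
  have "((\<lambda>y. exp (- (2 * pi * r * y))) \<longlongrightarrow> 0) at_top"
    using assms by real_asymp
  thus "((\<lambda>\<tau>. cmod (ee r \<tau>)) \<longlongrightarrow> 0) at_cusp"
    unfolding norm_ee by (rule filterlim_compose[OF _ filterlim_filtercomap])
qed

text \<open>
  The exponent \<open>r\<close> refers to \<open>exp(2\<pi>i\<tau>)\<close>, not to the local parameter \<open>exp(2\<pi>i\<tau>/h)\<close> of a cusp of width \<open>h\<close>,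
  so that functions with different periods can be multiplied and compared; the order at the cusp is
  \<open>h r\<close>.
\<close>

definition qord :: "(complex \<Rightarrow> complex) \<Rightarrow> real \<Rightarrow> bool" where
  "qord g r \<longleftrightarrow> (\<exists>Y. g holomorphic_on {\<tau>. Im \<tau> > Y}) \<and>
     (\<exists>c. c \<noteq> 0 \<and> ((\<lambda>\<tau>. g \<tau> * ee (- r) \<tau>) \<longlongrightarrow> c) at_cusp)"

text \<open>If \<open>r < s\<close>, the two normalisations differ by the factor
  \<open>ee (s - r)\<close>, which tends to 0 and contradicts the non-zero limit for
  \<open>r\<close>.\<close>

lemma qord_unique:
  assumes "qord g r" "qord g s" shows "r = s"
proof -
  have *: "\<not> r < s" if "qord g r" "qord g s" for r s
  proof
    assume "r < s"
    from that obtain c d where c: "c \<noteq> 0" "((\<lambda>\<tau>. g \<tau> * ee (- r) \<tau>) \<longlongrightarrow> c) at_cusp"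
       and d: "((\<lambda>\<tau>. g \<tau> * ee (- s) \<tau>) \<longlongrightarrow> d) at_cusp"
      by (auto simp: qord_def)
    have "((\<lambda>\<tau>. (g \<tau> * ee (- s) \<tau>) * ee (s - r) \<tau>) \<longlongrightarrow> d * 0) at_cusp"
      using \<open>r < s\<close> by (intro tendsto_mult d ee_tendsto_0) simp
    moreover have "(\<lambda>\<tau>. (g \<tau> * ee (- s) \<tau>) * ee (s - r) \<tau>) = (\<lambda>\<tau>. g \<tau> * ee (- r) \<tau>)"
      by (simp add: mult.assoc flip: ee_add)
    ultimately have "((\<lambda>\<tau>. g \<tau> * ee (- r) \<tau>) \<longlongrightarrow> 0) at_cusp" by simp
    with c show False using tendsto_unique[OF at_cusp_not_bot] by blast
  qed
  show ?thesis using *[OF assms] *[OF assms(2,1)] by simp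
qed

lemma qord_cong:
  assumes "qord g r" "\<And>\<tau>. Im \<tau> > Y \<Longrightarrow> g \<tau> = g' \<tau>"
  shows "qord g' r"
proof -
  from assms obtain Z c where g: "g holomorphic_on {\<tau>. Im \<tau> > Z}" "c \<noteq> 0" "((\<lambda>\<tau>. g \<tau> * ee (- r) \<tau>) \<longlongrightarrow> c) at_cusp"
    by (auto simp: qord_def)
  have "g holomorphic_on {\<tau>. Im \<tau> > max Y Z}" using g(1) by (rule holomorphic_on_subset) auto
  hence "g' holomorphic_on {\<tau>. Im \<tau> > max Y Z}" by (rule holomorphic_transform) (auto simp: assms)
  moreover have "((\<lambda>\<tau>. g' \<tau> * ee (- r) \<tau>) \<longlongrightarrow> c) at_cusp"
    by (rule Lim_transform_eventually[OF g(3)]) (auto simp: eventually_at_cusp assms(2) intro!: exI[of _ Y])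
  ultimately show ?thesis using g(2) unfolding qord_def by blast
qed

lemma qord_eventually:
  assumes "qord g r"
  obtains Y where "g holomorphic_on {\<tau>. Im \<tau> > Y}" "\<And>\<tau>. Im \<tau> > Y \<Longrightarrow> g \<tau> \<noteq> 0"
proof -
  from assms obtain Z c where g: "g holomorphic_on {\<tau>. Im \<tau> > Z}" "c \<noteq> 0" "((\<lambda>\<tau>. g \<tau> * ee (- r) \<tau>) \<longlongrightarrow> c) at_cusp"
    by (auto simp: qord_def)
  from tendsto_imp_eventually_ne[OF g(3,2)]
  obtain Y where Y: "\<And>\<tau>. Im \<tau> > Y \<Longrightarrow> g \<tau> * ee (- r) \<tau> \<noteq> 0" unfolding eventually_at_cusp by blast
  show ?thesis
  proof (rule that[of "max Y Z"])
    show "g holomorphic_on {\<tau>. Im \<tau> > max Y Z}" using g(1) by (rule holomorphic_on_subset) auto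
  qed (use Y in auto)
qed

lemma qord_prod:
  assumes "finite A" "\<And>x. x \<in> A \<Longrightarrow> qord (g x) (r x)"
  shows "qord (\<lambda>\<tau>. \<Prod>x\<in>A. g x \<tau>) (\<Sum>x\<in>A. r x)"
proof -
  have "\<forall>x\<in>A. \<exists>Y. g x holomorphic_on {\<tau>. Im \<tau> > Y}" using assms by (auto simp: qord_def)
  then obtain Y where Y: "\<And>x. x \<in> A \<Longrightarrow> g x holomorphic_on {\<tau>. Im \<tau> > Y x}" by metis
  have "\<forall>x\<in>A. \<exists>c. c \<noteq> 0 \<and> ((\<lambda>\<tau>. g x \<tau> * ee (- r x) \<tau>) \<longlongrightarrow> c) at_cusp" using assms by (auto simp: qord_def)
  then obtain c where c: "\<And>x. x \<in> A \<Longrightarrow> c x \<noteq> 0" "\<And>x. x \<in> A \<Longrightarrow> ((\<lambda>\<tau>. g x \<tau> * ee (- r x) \<tau>) \<longlongrightarrow> c x) at_cusp"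
    by metis
  have "g x holomorphic_on {\<tau>. Im \<tau> > Max (Y ` A)}" if "x \<in> A" for x
    using Y[OF that]
  proof (rule holomorphic_on_subset)
    have "Y x \<le> Max (Y ` A)" using assms(1) that by simp
    thus "{\<tau>. Im \<tau> > Max (Y ` A)} \<subseteq> {\<tau>. Im \<tau> > Y x}" by auto
  qed
  hence "(\<lambda>\<tau>. \<Prod>x\<in>A. g x \<tau>) holomorphic_on {\<tau>. Im \<tau> > Max (Y ` A)}"
    by (intro holomorphic_on_prod)
  moreover have "((\<lambda>\<tau>. \<Prod>x\<in>A. g x \<tau> * ee (- r x) \<tau>) \<longlongrightarrow> (\<Prod>x\<in>A. c x)) at_cusp"
    by (intro tendsto_prod c)
  hence "((\<lambda>\<tau>. (\<Prod>x\<in>A. g x \<tau>) * ee (- (\<Sum>x\<in>A. r x)) \<tau>) \<longlongrightarrow> (\<Prod>x\<in>A. c x)) at_cusp"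
    by (simp add: prod.distrib ee_sum flip: sum_negf)
  moreover have "(\<Prod>x\<in>A. c x) \<noteq> 0" using c(1) assms(1) by simp
  ultimately show ?thesis unfolding qord_def by blast
qed

text \<open>Without the power of \<open>q\<close> given by the subdegree, a convergent power series
  remains; its constant term is the leading coefficient of \<open>L\<close> and serves as the
  limit.\<close>

lemma qord_of_q_expansion:
  assumes "has_q_expansion F h L" "L \<noteq> 0" "h > 0"
  shows "qord F (of_int (fls_subdegree L) / real h)"
proof -
  from assms(1) obtain Y where L: "fls_conv_radius L > 0"
    and Y: "\<And>\<tau>. Im \<tau> > Y \<Longrightarrow> F \<tau> = eval_fls L (ee (1 / real h) \<tau>)"
    unfolding has_q_expansion_def q_eq_ee by blast
  define q where "q = ee (1 / real h)"
  define s where "s = fls_subdegree L"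
  have q0: "(q \<longlongrightarrow> 0) at_cusp" unfolding q_def using assms(3) by (intro ee_tendsto_0) simp
  have "open (eball 0 (fls_conv_radius L))" "0 \<in> eball 0 (fls_conv_radius L)"
    using L by (auto simp: zero_ereal_def)
  hence "eventually (\<lambda>\<tau>. q \<tau> \<in> eball 0 (fls_conv_radius L)) at_cusp"
    using q0 by (rule topological_tendstoD[rotated])
  then obtain Z where Z: "\<And>\<tau>. Im \<tau> > Z \<Longrightarrow> q \<tau> \<in> eball 0 (fls_conv_radius L)" 
    unfolding eventually_at_cusp by blast
  have "(\<lambda>\<tau>. eval_fls L (q \<tau>)) holomorphic_on {\<tau>. Im \<tau> > max Y Z}"
    unfolding q_def using Z by (intro holomorphic_intros) (auto simp: q_def)
  hence "F holomorphic_on {\<tau>. Im \<tau> > max Y Z}"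
    by (rule holomorphic_transform) (use Y q_def in auto)
  moreover have "((\<lambda>\<tau>. F \<tau> * ee (- (of_int s / real h)) \<tau>) \<longlongrightarrow> eval_fps (fls_base_factor_to_fps L) 0) at_cusp"
  proof (rule Lim_transform_eventually)
    have "isCont (eval_fps (fls_base_factor_to_fps L)) 0"
      using L by (intro continuous_eval_fps continuous_ident) (auto simp: fls_conv_radius_altdef zero_ereal_def)
    thus "((\<lambda>\<tau>. eval_fps (fls_base_factor_to_fps L) (q \<tau>)) \<longlongrightarrow> eval_fps (fls_base_factor_to_fps L) 0) at_cusp"
      using q0 by (rule isCont_tendsto_compose)
    have "eval_fps (fls_base_factor_to_fps L) (q \<tau>) = F \<tau> * ee (- (of_int s / real h)) \<tau>" if "Im \<tau> > Y" for \<tau>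
      using Y[OF that] by (simp add: eval_fls_def q_def ee_powi s_def mult.assoc flip: ee_add)
    thus "eventually (\<lambda>\<tau>. eval_fps (fls_base_factor_to_fps L) (q \<tau>) = F \<tau> * ee (- (of_int s / real h)) \<tau>) at_cusp"
      unfolding eventually_at_cusp by blast
  qed
  moreover have "eval_fps (fls_base_factor_to_fps L) 0 \<noteq> 0"
    using assms(2) by (simp add: eval_fps_at_0)
  ultimately show ?thesis unfolding qord_def s_def by blast
qed

text \<open>The local parameter maps the half-plane above \<open>max Y Y'\<close> onto the punctured
  disc of radius \<open>\<delta>\<close>, so the two series agree near 0. Uniqueness is needed to
  evaluate the definite description in \<open>cusp_order\<close>.\<close>

lemma q_expansion_unique:
  assumes "has_q_expansion F h L" "has_q_expansion F h L'" "h > 0"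
  shows "L = L'"
proof -
  have *: "\<exists>Y. \<forall>\<tau>. Im \<tau> > Y \<longrightarrow> F \<tau> = eval_fls L (ee (1 / real h) \<tau>)" "fls_conv_radius L > 0"
    if "has_q_expansion F h L" for L
    using that unfolding has_q_expansion_def q_eq_ee by auto
  obtain Y where Y: "\<And>\<tau>. Im \<tau> > Y \<Longrightarrow> F \<tau> = eval_fls L (ee (1 / real h) \<tau>)" using *(1)[OF assms(1)] by blast
  obtain Y' where Y': "\<And>\<tau>. Im \<tau> > Y' \<Longrightarrow> F \<tau> = eval_fls L' (ee (1 / real h) \<tau>)" using *(1)[OF assms(2)] by blast
  define \<delta> where "\<delta> = exp (- (2 * pi * max Y Y' / real h))"
  have "eval_fls L q = eval_fls L' q" if q: "q \<noteq> 0" "cmod q < \<delta>" for q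
  proof -
    define \<tau> where "\<tau> = of_nat h * Ln q / (2 * of_real pi * \<i>)"
    have "ee (1 / real h) \<tau> = q" using q assms(3) by (simp add: ee_def \<tau>_def)
    moreover have "Im \<tau> > max Y Y'"
    proof -
      have "exp (- (2 * pi * (Im \<tau>) / real h)) = cmod q"
        unfolding calculation[symmetric] norm_ee by simp
      hence "exp (- (2 * pi * (Im \<tau>) / real h)) < exp (- (2 * pi * max Y Y' / real h))"
        using q by (simp add: \<delta>_def)
      thus ?thesis using assms(3) by (simp add: divide_less_cancel)
    qed
    ultimately show ?thesis using Y[of \<tau>] Y'[of \<tau>] by simp
  qed
  moreover have "\<delta> > 0" by (simp add: \<delta>_def)
  ultimately have "eventually (\<lambda>q. eval_fls L q = eval_fls L' q) (at 0)"
    unfolding eventually_at by (intro exI[of _ \<delta>]) auto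
  hence "eval_fls L' has_laurent_expansion L"
    using *(2)[OF assms(1)] by (simp add: has_laurent_expansion_def)
  moreover have "eval_fls L' has_laurent_expansion L'"
    using *(2)[OF assms(2)] by (rule eval_fls_has_laurent_expansion)
  ultimately show ?thesis by (rule has_laurent_expansion_unique)
qed

text \<open>Translation by \<open>h\<close> preserves the filter and multiplies the non-zero limit
  by \<open>ee (- r) h\<close>, which must therefore be 1.\<close>

lemma qord_integral:
  assumes "qord g r" and per: "\<And>\<tau>. Im \<tau> > Y \<Longrightarrow> g (\<tau> + of_nat h) = g \<tau>"
  obtains m :: int where "real h * r = of_int m"
proof -
  from assms obtain c where c: "c \<noteq> 0" "((\<lambda>\<tau>. g \<tau> * ee (- r) \<tau>) \<longlongrightarrow> c) at_cusp"
    by (auto simp: qord_def)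
  have "filterlim (\<lambda>\<tau>. \<tau> + of_nat h) at_cusp at_cusp"
    unfolding filterlim_iff
  proof (intro allI impI)
    fix P assume "eventually P at_cusp"
    then obtain Y where "\<And>\<tau>. Im \<tau> > Y \<Longrightarrow> P \<tau>" unfolding eventually_at_cusp by blast
    thus "eventually (\<lambda>\<tau>. P (\<tau> + of_nat h)) at_cusp"
      unfolding eventually_at_cusp by (intro exI[of _ Y]) auto
  qed
  from filterlim_compose[OF c(2) this]
  have "((\<lambda>\<tau>. g (\<tau> + of_nat h) * ee (- r) (\<tau> + of_nat h)) \<longlongrightarrow> c) at_cusp" .
  moreover have "((\<lambda>\<tau>. g (\<tau> + of_nat h) * ee (- r) (\<tau> + of_nat h)) \<longlongrightarrow> c * ee (- r) (of_nat h)) at_cusp"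
  proof (rule Lim_transform_eventually)
    show "((\<lambda>\<tau>. (g \<tau> * ee (- r) \<tau>) * ee (- r) (of_nat h)) \<longlongrightarrow> c * ee (- r) (of_nat h)) at_cusp"
      by (intro tendsto_mult c tendsto_const)
    show "eventually (\<lambda>\<tau>. (g \<tau> * ee (- r) \<tau>) * ee (- r) (of_nat h) = 
         g (\<tau> + of_nat h) * ee (- r) (\<tau> + of_nat h)) at_cusp"
      unfolding eventually_at_cusp by (intro exI[of _ Y]) (auto simp: per ee_add_arg)
  qed
  ultimately have "c = c * ee (- r) (of_nat h)" using tendsto_unique[OF at_cusp_not_bot] by blast
  hence "ee (- r) (of_nat h) = 1" using c(1) by simp
  then obtain n :: int where n: "2 * pi * (- r * real h) = of_int (2 * n) * pi"
    unfolding ee_def exp_eq_1 by (auto simp: algebra_simps)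
  hence "pi * (real h * r) = pi * of_int (- n)" by (simp add: algebra_simps)
  hence "real h * r = of_int (- n)" by (simp only: mult_cancel_left pi_neq_zero simp_thms)
  thus ?thesis by (rule that)
qed

text \<open>
  Periodicity forces \<open>h r\<close> to be an integer, so \<open>g(\<tau>) exp(- 2\<pi>ir\<tau>)\<close> descends to a punctured disc in
  \<open>exp(2\<pi>i\<tau>/h)\<close>, where its singularity at 0 is removable.
\<close>

lemma ex_q_expansion:
  assumes g: "qord g r" and per: "\<And>\<tau>. Im \<tau> > Y \<Longrightarrow> g (\<tau> + of_nat h) = g \<tau>" and h: "h > 0"
  shows "\<exists>L. has_q_expansion g h L"
proof -
  obtain m :: int where m: "real h * r = of_int m" using qord_integral[OF g per] by metis
  from g obtain Z c where Z: "g holomorphic_on {\<tau>. Im \<tau> > Z}" and c: "((\<lambda>\<tau>. g \<tau> * ee (- r) \<tau>) \<longlongrightarrow> c) at_cusp"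
    by (auto simp: qord_def)
  define W where "W = max Y Z"
  have W: "g holomorphic_on {\<tau>. Im \<tau> > W}" "\<And>\<tau>. Im \<tau> > W \<Longrightarrow> g (\<tau> + of_nat h) = g \<tau>"
    by (rule holomorphic_on_subset[OF Z]) (use per in \<open>auto simp: W_def\<close>)
  define q where "q = ee (1 / real h)"
  \<comment> \<open>A section of \<open>q\<close> from the principal logarithm. It jumps by
    \<open>h\<close> across the negative real axis, but \<open>g (t z)\<close> does not, by
    periodicity.\<close>
  define t where "t = (\<lambda>z. of_nat h * Ln z / (2 * of_real pi * \<i>))"
  have qt: "q (t z) = z" if "z \<noteq> 0" for z using that h by (simp add: q_def t_def ee_def)
  define \<delta> where "\<delta> = exp (- (2 * pi * W / real h))"
  have norm_q: "cmod (q \<tau>) < \<delta> \<longleftrightarrow> Im \<tau> > W" for \<tau>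
    using h by (simp add: \<delta>_def q_def norm_ee divide_less_cancel)
  have perZ: "g (\<tau> + of_int n * of_nat h) = g \<tau>" if "Im \<tau> > W" for \<tau> n
  proof -
    have *: "g (\<tau> + of_nat k * of_nat h) = g \<tau>" if "Im \<tau> > W" for \<tau> k
    proof (induction k)
      case (Suc k)
      have "g (\<tau> + of_nat (Suc k) * of_nat h) = g ((\<tau> + of_nat k * of_nat h) + of_nat h)"
        by (simp add: algebra_simps)
      also have "\<dots> = g (\<tau> + of_nat k * of_nat h)" using that by (intro W) simp
      finally show ?case using Suc by simp
    qed auto
    show ?thesis
    proof (cases "n \<ge> 0")
      case True
      thus ?thesis using *[OF that, of "nat n"] by simp
    next
      case False
      have "g ((\<tau> + of_int n * of_nat h) + of_nat (nat (- n)) * of_nat h) = g (\<tau> + of_int n * of_nat h)"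
        using that by (intro *) simp
      thus ?thesis using False by simp
    qed
  qed
  have gq: "g \<tau> = g \<tau>'" if "q \<tau> = q \<tau>'" "Im \<tau> > W" for \<tau> \<tau>'
  proof -
    from that(1) obtain n where "2 * of_real pi * \<i> * \<tau> / of_nat h = 2 * of_real pi * \<i> * \<tau>' / of_nat h + (of_int (2 * n) * pi) * \<i>"
      unfolding q_def ee_def exp_eq by auto
    hence "2 * of_real pi * \<i> * \<tau> = 2 * of_real pi * \<i> * (\<tau>' + of_int n * of_nat h)"
      using h by (simp add: field_simps)
    hence "\<tau> = \<tau>' + of_int n * of_nat h" by simp
    moreover have "Im \<tau>' > W" using that norm_q by metis
    ultimately show ?thesis using perZ by simp
  qed
  define G where "G = (\<lambda>z. g (t z) * z powi (- m))"
  have hol: "(\<lambda>z. g (t z)) analytic_on {z0}" if z0: "z0 \<noteq> 0" "cmod z0 < \<delta>" for z0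
  proof -
    \<comment> \<open>Another branch, analytic at \<open>z0\<close> even on the cut of
      \<open>Ln\<close>, since only the logarithm of \<open>z / z0\<close>, close to 1, is
      taken.\<close>
    define s where "s = (\<lambda>z. t z0 + of_nat h * Ln (z / z0) / (2 * of_real pi * \<i>))"
    have s: "s analytic_on {z0}" unfolding s_def using z0 by (intro analytic_intros) auto
    have qs: "q (s z) = z" if "z \<noteq> 0" for z
    proof -
      have "q (s z) = q (t z0) * q (of_nat h * Ln (z / z0) / (2 * of_real pi * \<i>))" by (simp add: s_def q_def ee_add_arg)
      also have "q (of_nat h * Ln (z / z0) / (2 * of_real pi * \<i>)) = z / z0"
        using h that z0 by (simp add: q_def ee_def)
      finally show ?thesis using qt[OF z0(1)] z0 by simp
    qed
    have "g analytic_on {\<tau>. Im \<tau> > W}" using W(1) open_halfspace_Im_gt by (simp add: analytic_on_open)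
    moreover have "Im (s z0) > W" using qs[OF z0(1)] z0 norm_q by metis
    ultimately have "g analytic_on s ` {z0}"
      using analytic_on_subset[of g "{\<tau>. Im \<tau> > W}" "s ` {z0}"] by auto
    from analytic_on_compose[OF s this]
    have "(\<lambda>z. g (s z)) analytic_on {z0}" by (simp add: o_def)
    moreover have "eventually (\<lambda>z. g (s z) = g (t z)) (nhds z0)"
    proof -
      have "eventually (\<lambda>z. z \<in> ball 0 \<delta> - {0}) (nhds z0)"
        using z0 by (intro eventually_nhds_in_open) auto
      thus ?thesis
      proof eventually_elim
        case (elim z)
        hence z: "z \<noteq> 0" "cmod z < \<delta>" by auto
        show ?case by (rule gq) (use z qs qt norm_q in \<open>auto, metis\<close>)
      qed
    qed
    ultimately show ?thesis by (subst analytic_at_cong[OF _ refl]) (auto elim: eventually_mono)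
  qed
  have "isolated_singularity_at G 0"
    unfolding isolated_singularity_at_def
  proof (intro exI conjI)
    show "\<delta> > 0" by (simp add: \<delta>_def)
    show "G analytic_on ball 0 \<delta> - {0}"
      unfolding G_def
    proof (rule analytic_on_mult)
      show "(\<lambda>z. g (t z)) analytic_on ball 0 \<delta> - {0}"
        by (subst analytic_on_analytic_at) (auto intro: hol)
      show "(\<lambda>z. z powi (- m)) analytic_on ball 0 \<delta> - {0}" by (intro analytic_intros) auto
    qed
  qed
  moreover have "G \<midarrow>0\<rightarrow> c"
  proof -
    have "filterlim t at_cusp (at 0)"
      unfolding filterlim_iff
    proof (intro allI impI)
      fix P assume "eventually P at_cusp"
      then obtain V where V: "\<And>\<tau>. Im \<tau> > V \<Longrightarrow> P \<tau>" unfolding eventually_at_cusp by blast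
      define \<epsilon> where "\<epsilon> = exp (- (2 * pi * V / real h))"
      have "P (t z)" if "z \<noteq> 0" "cmod z < \<epsilon>" for z
      proof (rule V)
        have "cmod (q (t z)) < \<epsilon>" using qt that by simp
        thus "Im (t z) > V" using h by (simp add: q_def norm_ee \<epsilon>_def divide_less_cancel)
      qed
      moreover have "\<epsilon> > 0" by (simp add: \<epsilon>_def)
      ultimately show "eventually (\<lambda>z. P (t z)) (at 0)"
        unfolding eventually_at by (intro exI[of _ \<epsilon>]) auto
    qed
    from filterlim_compose[OF c this]
    have "((\<lambda>z. g (t z) * ee (- r) (t z)) \<longlongrightarrow> c) (at 0)" .
    moreover have "ee (- r) (t z) = z powi (- m)" if "z \<noteq> 0" for z
    proof -
      have "z powi (- m) = q (t z) powi (- m)" using qt[OF that] by simp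
      also have "\<dots> = ee (of_int (- m) * (1 / real h)) (t z)" unfolding q_def ee_powi ..
      also have "of_int (- m) * (1 / real h) = - r" using h m[symmetric] by simp
      finally show ?thesis ..
    qed
    hence "eventually (\<lambda>z. g (t z) * ee (- r) (t z) = G z) (at 0)"
      unfolding G_def eventually_at by (intro exI[of _ 1]) auto
    ultimately show ?thesis by (rule Lim_transform_eventually)
  qed
  hence "not_essential G 0" by blast
  ultimately have "G has_laurent_expansion laurent_expansion G 0"
    by (rule not_essential_has_laurent_expansion_0)
  hence "(\<lambda>z. G z * z powi m) has_laurent_expansion fls_shift (- m) (laurent_expansion G 0)"
    by (rule has_laurent_expansion_shift)
  then obtain L where L: "(\<lambda>z. G z * z powi m) has_laurent_expansion L" by blast
  then obtain \<epsilon> where \<epsilon>: "\<epsilon> > 0" "\<And>z. z \<noteq> 0 \<Longrightarrow> cmod z < \<epsilon> \<Longrightarrow> eval_fls L z = G z * z powi m"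
    unfolding has_laurent_expansion_def eventually_at by (auto simp: dist_norm)
  have "eventually (\<lambda>\<tau>. cmod (q \<tau>) < \<epsilon>) at_cusp"
  proof -
    have "((\<lambda>\<tau>. cmod (q \<tau>)) \<longlongrightarrow> 0) at_cusp"
      unfolding q_def using h by (intro tendsto_norm_zero ee_tendsto_0) simp
    thus ?thesis using \<epsilon>(1) by (rule order_tendstoD)
  qed
  then obtain V where V: "\<And>\<tau>. Im \<tau> > V \<Longrightarrow> cmod (q \<tau>) < \<epsilon>" unfolding eventually_at_cusp by blast
  have "g \<tau> = eval_fls L (q \<tau>)" if "Im \<tau> > max W V" for \<tau>
  proof -
    have q0: "q \<tau> \<noteq> 0" by (simp add: q_def)
    have "eval_fls L (q \<tau>) = G (q \<tau>) * q \<tau> powi m" using \<epsilon>(2)[OF q0 V] that by simp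
    also have "\<dots> = g (t (q \<tau>))" using q0 by (simp add: G_def power_int_minus)
    also have "\<dots> = g \<tau>" by (rule gq[symmetric]) (use qt q0 that in auto)
    finally show ?thesis ..
  qed
  thus ?thesis using L unfolding has_q_expansion_def q_eq_ee q_def[symmetric] has_laurent_expansion_def by blast
qed

section \<open>The slash operator\<close>

definition fac :: "int \<Rightarrow> mat2 \<Rightarrow> complex \<Rightarrow> complex" where
  "fac k A \<tau> = den A \<tau> powi (- k) * of_real (real_of_int (det A) powr (real_of_int k / 2))"

lemma slash_eq: "slash f k A \<tau> = fac k A \<tau> * f (moebius A \<tau>)"
  by (simp add: slash_def fac_def den_def)

lemma fac_nonzero: "det A > 0 \<Longrightarrow> \<tau> \<in> uhp \<Longrightarrow> fac k A \<tau> \<noteq> 0"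
  using den_nonzero[of A \<tau>] by (simp add: fac_def)

lemma fac_mult:
  assumes "det A > 0" "det B > 0" "\<tau> \<in> uhp"
  shows "fac k (A ** B) \<tau> = fac k A (moebius B \<tau>) * fac k B \<tau>"
  using assms by (simp add: fac_def den_mult det_mul powr_mult power_int_mult_distrib)

lemma slash_mult:
  assumes "det A > 0" "det B > 0" "\<tau> \<in> uhp"
  shows "slash (slash f k A) k B \<tau> = slash f k (A ** B) \<tau>"
  using assms by (simp add: slash_eq fac_mult moebius_mult mult_ac)

lemma slash_cong:
  assumes "f (moebius A \<tau>) = g (moebius A \<tau>)" shows "slash f k A \<tau> = slash g k A \<tau>"
  using assms by (simp add: slash_eq)

lemma analytic_den [analytic_intros]: "(\<lambda>\<tau>. den A \<tau>) analytic_on S"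
  unfolding den_def by (intro analytic_intros)

lemma analytic_num: "(\<lambda>\<tau>. num A \<tau>) analytic_on S"
  unfolding num_def by (intro analytic_intros)

lemma analytic_moebius: "det A > 0 \<Longrightarrow> moebius A analytic_on uhp"
  unfolding moebius_eq[abs_def] by (intro analytic_on_divide analytic_den analytic_num) (auto dest: den_nonzero[of A, rotated])

lemma analytic_fac: "det A > 0 \<Longrightarrow> fac k A analytic_on uhp"
  unfolding fac_def[abs_def]
  by (intro analytic_on_mult analytic_on_power_int analytic_den analytic_on_const) (auto dest: den_nonzero[of A, rotated])

text \<open>The factor in front of \<open>\<tau> - w\<close> has neither zeros nor poles in the
  upper half-plane. This gives injectivity as well as the order 1 needed for composition.\<close>

lemma moebius_diff:
  assumes "det A > 0" "\<tau> \<in> uhp" "w \<in> uhp"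
  shows "moebius A \<tau> - moebius A w = of_int (det A) / (den A \<tau> * den A w) * (\<tau> - w)"
proof -
  have "den A \<tau> \<noteq> 0" "den A w \<noteq> 0" using den_nonzero[of A] assms by auto
  thus ?thesis unfolding moebius_eq
    by (simp add: field_simps) (simp add: num_def den_def det_2 algebra_simps)
qed

lemma filterlim_moebius:
  assumes "det A > 0" "z \<in> uhp"
  shows "filterlim (moebius A) (at (moebius A z)) (at z)"
proof (rule filterlim_atI)
  have "isCont (moebius A) z"
    using analytic_on_subset[OF analytic_moebius[OF assms(1)], of "{z}"] assms(2)
    by (intro analytic_at_imp_isCont) auto
  thus "(moebius A \<longlongrightarrow> moebius A z) (at z)" by (simp add: isCont_def)
  have "eventually (\<lambda>w. w \<in> uhp - {z}) (at z)"
    using assms(2) open_uhp by (intro eventually_at_in_open) auto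
  thus "eventually (\<lambda>w. moebius A w \<noteq> moebius A z) (at z)"
  proof eventually_elim
    case (elim w)
    hence "den A w \<noteq> 0" "den A z \<noteq> 0" using den_nonzero[of A] assms by auto
    thus ?case using moebius_diff[OF assms(1), of w z] elim assms by auto
  qed
qed

lemma eventually_moebius:
  assumes "det A > 0" "z \<in> uhp" "eventually P (at (moebius A z))"
  shows "eventually (\<lambda>w. P (moebius A w)) (at z)"
  using filterlim_moebius[OF assms(1,2)] assms(3) unfolding filterlim_iff by blast

lemma meromorphic_slash:
  assumes "f meromorphic_on uhp" "det A > 0"
  shows "slash f k A meromorphic_on uhp"
proof -
  have "(\<lambda>\<tau>. f (moebius A \<tau>)) meromorphic_on uhp"
    using assms by (intro meromorphic_on_compose[OF assms(1)] analytic_moebius) auto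
  moreover have "fac k A meromorphic_on uhp"
    using assms by (intro analytic_on_imp_meromorphic_on analytic_fac)
  ultimately have "(\<lambda>\<tau>. fac k A \<tau> * f (moebius A \<tau>)) meromorphic_on uhp"
    by (intro meromorphic_on_mult)
  thus ?thesis by (simp add: slash_eq[abs_def])
qed

lemma nicely_meromorphic_slash:
  assumes "f nicely_meromorphic_on uhp" "det A > 0"
  shows "slash f k A nicely_meromorphic_on uhp"
  unfolding nicely_meromorphic_on_def
proof (intro conjI ballI)
  show "slash f k A meromorphic_on uhp"
    using assms by (intro meromorphic_slash) (auto simp: nicely_meromorphic_on_def)
  fix z assume z: "z \<in> uhp"
  have Az: "moebius A z \<in> uhp" using assms z by auto
  have fac: "fac k A analytic_on {z}" using analytic_on_subset[OF analytic_fac[OF assms(2)]] z by blast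
  from assms(1) Az have "is_pole f (moebius A z) \<and> f (moebius A z) = 0 \<or> f \<midarrow>moebius A z\<rightarrow> f (moebius A z)"
    by (auto simp: nicely_meromorphic_on_def)
  thus "is_pole (slash f k A) z \<and> slash f k A z = 0 \<or> slash f k A \<midarrow>z\<rightarrow> slash f k A z"
  proof
    assume p: "is_pole f (moebius A z) \<and> f (moebius A z) = 0"
    have "is_pole (\<lambda>w. f (moebius A w)) z"
      using p filterlim_compose[OF _ filterlim_moebius[OF assms(2) z]] unfolding is_pole_def by blast
    hence "is_pole (\<lambda>\<tau>. fac k A \<tau> * f (moebius A \<tau>)) z"
      using fac fac_nonzero[OF assms(2) z] by (intro is_pole_mult_analytic_nonzero1)
    thus ?thesis using p by (simp add: slash_eq[abs_def])
  next
    assume "f \<midarrow>moebius A z\<rightarrow> f (moebius A z)"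
    from filterlim_compose[OF this filterlim_moebius[OF assms(2) z]]
    have "(\<lambda>\<tau>. fac k A \<tau> * f (moebius A \<tau>)) \<midarrow>z\<rightarrow> fac k A z * f (moebius A z)"
      using analytic_at_imp_isCont[OF fac] by (intro tendsto_mult) (auto simp: isCont_def)
    thus ?thesis by (simp add: slash_eq[abs_def])
  qed
qed

text \<open>The value at a point is determined by the values nearby: 0 at a pole, the limit
  otherwise. Identities known off a discrete set thereby become pointwise.\<close>

lemma nicely_meromorphic_eqI:
  assumes "f nicely_meromorphic_on S" "g nicely_meromorphic_on S" "z \<in> S"
    and ev: "eventually (\<lambda>w. f w = g w) (at z)"
  shows "f z = g z"
proof -
  have f: "is_pole f z \<and> f z = 0 \<or> f \<midarrow>z\<rightarrow> f z" and g: "is_pole g z \<and> g z = 0 \<or> g \<midarrow>z\<rightarrow> g z"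
    using assms by (auto simp: nicely_meromorphic_on_def)
  have p: "is_pole f z \<longleftrightarrow> is_pole g z" using ev by (intro is_pole_cong) auto
  show ?thesis
  proof (cases "is_pole f z")
    case True
    thus ?thesis using p assms(1-3) is_pole_zero_at_nicely_mero by metis
  next
    case False
    hence "f \<midarrow>z\<rightarrow> f z" "g \<midarrow>z\<rightarrow> g z" using f g p by auto
    moreover from this(1) have "g \<midarrow>z\<rightarrow> f z" using ev by (rule Lim_transform_eventually)
    ultimately show ?thesis using LIM_unique by blast
  qed
qed

text \<open>The automorphy factor does not vanish and the Moebius map is locally biholomorphic, so
  the order is merely transported. The condition that \<open>f\<close> is non-zero near the point
  keeps \<open>zorder\<close> meaningful.\<close>

lemma zorder_slash:
  assumes "f meromorphic_on uhp" "det A > 0" "z \<in> uhp" "eventually (\<lambda>w. f w \<noteq> 0) (at (moebius A z))"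
  shows "zorder (slash f k A) z = zorder f (moebius A z)"
proof -
  have Az: "moebius A z \<in> uhp" using assms by auto
  have fac: "fac k A analytic_on {z}" using analytic_on_subset[OF analytic_fac[OF assms(2)]] assms(3) by blast
  have mo: "moebius A analytic_on {z}" using analytic_on_subset[OF analytic_moebius[OF assms(2)]] assms(3) by blast
  have f: "f meromorphic_on {moebius A z}" using assms(1) Az meromorphic_on_subset by blast
  have ev: "eventually (\<lambda>w. f (moebius A w) \<noteq> 0) (at z)" by (rule eventually_moebius) fact+
  have "zorder (slash f k A) z = zorder (\<lambda>w. fac k A w * (f \<circ> moebius A) w) z"
    by (simp add: slash_eq[abs_def])
  also have "\<dots> = zorder (fac k A) z + zorder (f \<circ> moebius A) z"
  proof (rule zorder_mult)
    show "fac k A meromorphic_on {z}" using fac by (rule analytic_on_imp_meromorphic_on)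
    have "eventually (\<lambda>w. w \<in> uhp - {z}) (at z)"
      using assms(3) open_uhp by (intro eventually_at_in_open) auto
    hence "eventually (\<lambda>w. fac k A w \<noteq> 0) (at z)"
      by eventually_elim (use fac_nonzero[OF assms(2)] in auto)
    thus "frequently (\<lambda>w. fac k A w \<noteq> 0) (at z)" by (rule eventually_frequently[rotated]) simp
    show "(f \<circ> moebius A) meromorphic_on {z}"
      using meromorphic_on_compose[OF f mo] by (simp add: o_def)
    show "frequently (\<lambda>w. (f \<circ> moebius A) w \<noteq> 0) (at z)"
      using ev by (intro eventually_frequently) auto
  qed
  also have "zorder (fac k A) z = 0" using fac fac_nonzero[OF assms(2,3)] by (rule zorder_eq_0I)
  also have "zorder (f \<circ> moebius A) z = zorder f (moebius A z) * zorder (\<lambda>x. moebius A x - moebius A z) z"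
  proof (rule zorder_compose')
    show "isolated_singularity_at f (moebius A z)" "not_essential f (moebius A z)"
      using f by (auto simp: meromorphic_at_iff)
    show "eventually (\<lambda>w. moebius A w \<noteq> moebius A z) (at z)"
      using filterlim_moebius[OF assms(2,3)] by (simp add: filterlim_at)
  qed fact+
  also have "zorder (\<lambda>x. moebius A x - moebius A z) z = 1"
  proof (rule zorder_eqI[OF open_uhp assms(3)])
    have d: "den A w \<noteq> 0" if "w \<in> uhp" for w using den_nonzero[of A w] assms that by auto
    show "(\<lambda>w. of_int (det A) / (den A w * den A z)) holomorphic_on uhp"
      using d assms(3) by (intro holomorphic_on_divide holomorphic_on_mult holomorphic_on_const analytic_imp_holomorphic analytic_den) auto
    show "of_int (det A) / (den A z * den A z) \<noteq> 0" using d[OF assms(3)] assms(2) by simp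
    show "moebius A w - moebius A z = of_int (det A) / (den A w * den A z) * (w - z) powi 1"
      if "w \<in> uhp" for w using moebius_diff[OF assms(2) that assms(3)] by simp
  qed
  finally show ?thesis by simp
qed

text \<open>For lower left entry 0 the automorphy factor is constant and the map is affine. The
  exponent is scaled by \<open>a / d\<close>, while \<open>b\<close> changes only the limit.\<close>

lemma qord_slash_upper:
  assumes "qord g r" "a > 0" "d > 0"
  shows "qord (slash g k (mk a b 0 d)) (r * of_int a / of_int d)"
proof -
  define A where "A = mk a b 0 d"
  define s where "s = r * of_int a / of_int d"
  have m: "moebius A \<tau> = (of_int a * \<tau> + of_int b) / of_int d" for \<tau> by (simp add: A_def moebius_def)
  define C where "C = fac k A 0"
  have fac: "fac k A \<tau> = C" for \<tau> by (simp add: C_def fac_def A_def den_def)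
  have C: "C \<noteq> 0" using assms by (simp add: C_def fac_def A_def den_def)
  have Im: "Im (moebius A \<tau>) = (of_int a * Im \<tau> + 0) / of_int d" for \<tau> by (simp add: m)
  from assms(1) obtain Y c where Y: "g holomorphic_on {\<tau>. Im \<tau> > Y}" and c: "c \<noteq> 0" "((\<lambda>\<tau>. g \<tau> * ee (- r) \<tau>) \<longlongrightarrow> c) at_cusp"
    by (auto simp: qord_def)
  define Z where "Z = Y * of_int d / of_int a"
  have Z: "Im (moebius A \<tau>) > Y \<longleftrightarrow> Im \<tau> > Z" for \<tau>
    using assms(2,3) unfolding Im Z_def by (simp add: field_simps)
  have "moebius A holomorphic_on {\<tau>. Im \<tau> > Z}" unfolding m[abs_def] using assms(3) by (intro holomorphic_intros) auto
  hence "g \<circ> moebius A holomorphic_on {\<tau>. Im \<tau> > Z}"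
    by (rule holomorphic_on_compose_gen[OF _ Y]) (use Z in auto)
  hence "slash g k A holomorphic_on {\<tau>. Im \<tau> > Z}"
    unfolding slash_eq[abs_def] fac o_def by (intro holomorphic_on_mult holomorphic_on_const)
  moreover have "filterlim (moebius A) at_cusp at_cusp"
    unfolding filterlim_iff
  proof (intro allI impI)
    fix P assume "eventually P at_cusp"
    then obtain V where V: "\<And>\<tau>. Im \<tau> > V \<Longrightarrow> P \<tau>" unfolding eventually_at_cusp by blast
    have "P (moebius A \<tau>)" if "Im \<tau> > V * of_int d / of_int a" for \<tau>
      using that assms(2,3) by (intro V) (simp add: Im field_simps)
    thus "eventually (\<lambda>\<tau>. P (moebius A \<tau>)) at_cusp" unfolding eventually_at_cusp by blast
  qed
  from filterlim_compose[OF c(2) this]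
  have lim: "((\<lambda>\<tau>. g (moebius A \<tau>) * ee (- r) (moebius A \<tau>)) \<longlongrightarrow> c) at_cusp" .
  have e: "ee (- s) \<tau> = ee (- r) (moebius A \<tau>) * ee r (of_int b / of_int d)" for \<tau>
  proof -
    have "moebius A \<tau> = of_int a * \<tau> / of_int d + of_int b / of_int d" by (simp add: m add_divide_distrib)
    hence "ee (- r) (moebius A \<tau>) = ee (- r) (of_int a * \<tau> / of_int d) * ee (- r) (of_int b / of_int d)"
      by (simp only: ee_add_arg)
    moreover have "ee (- r) (of_int a * \<tau> / of_int d) = ee (- s) \<tau>" by (simp add: ee_def s_def mult_ac)
    ultimately show ?thesis by (simp add: mult.assoc)
  qed
  have "((\<lambda>\<tau>. C * ee r (of_int b / of_int d) * (g (moebius A \<tau>) * ee (- r) (moebius A \<tau>))) \<longlongrightarrow> 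
     C * ee r (of_int b / of_int d) * c) at_cusp"
    by (intro tendsto_mult tendsto_const lim)
  hence "((\<lambda>\<tau>. slash g k A \<tau> * ee (- s) \<tau>) \<longlongrightarrow> C * ee r (of_int b / of_int d) * c) at_cusp"
    unfolding slash_eq fac e by (simp add: mult_ac)
  moreover have "C * ee r (of_int b / of_int d) * c \<noteq> 0" using C c by simp
  ultimately show ?thesis unfolding qord_def A_def s_def by blast
qed

section \<open>Non-zero meromorphic forms\<close>

text \<open>Instantiated both for \<open>f\<close> and for its Hecke product, so that both divisors
  are read off by the same lemmas.\<close>

locale nonzero_form =
  fixes N :: nat and k :: int and f :: "complex \<Rightarrow> complex"
  assumes N_pos: "N > 0"
    and form: "f \<in> mero_forms (Gamma0 N) k"
    and nonzero: "\<exists>\<tau>\<in>uhp. f \<tau> \<noteq> 0"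
begin

lemma nicely: "f nicely_meromorphic_on uhp"
  using form by (simp add: mero_forms_def)

lemma meromorphic: "f meromorphic_on uhp"
  using nicely by (simp add: nicely_meromorphic_on_def)

lemma slash_Gamma0: "g \<in> Gamma0 N \<Longrightarrow> \<tau> \<in> uhp \<Longrightarrow> slash f k g \<tau> = f \<tau>"
  using form by (simp add: mero_forms_def)

lemma slash_left:
  assumes "g \<in> Gamma0 N" "det A > 0" "\<tau> \<in> uhp"
  shows "slash f k (g ** A) \<tau> = slash f k A \<tau>"
proof -
  have "slash f k (g ** A) \<tau> = slash (slash f k g) k A \<tau>"
    using assms by (simp add: slash_mult Gamma0_det)
  also have "\<dots> = slash f k A \<tau>" using assms by (intro slash_cong slash_Gamma0) auto
  finally show ?thesis .
qed

lemma cosparse_nonzero: "eventually (\<lambda>z. f z \<noteq> 0) (cosparse uhp)"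
  using nicely_meromorphic_imp_constant_or_avoid[OF nicely open_uhp connected_uhp, of 0] nonzero by blast

lemma eventually_nonzero: "z \<in> uhp \<Longrightarrow> eventually (\<lambda>z. f z \<noteq> 0) (at z)"
  using cosparse_nonzero open_uhp by (simp add: eventually_cosparse_open_eq)

text \<open>Invariance in both weights, at a point where \<open>f\<close> does not vanish, equates
  two powers of \<open>|c z + d|\<close>; where this modulus exceeds 1 the exponents must
  agree.\<close>

lemma weight_unique:
  assumes "f \<in> mero_forms (Gamma0 N) l" shows "l = k"
proof (rule ccontr)
  assume "l \<noteq> k"
  \<comment> \<open>The lower left entry must be non-zero: for translations the automorphy factor is
    1 in every weight.\<close>
  define g where "g = mk 1 0 (int N) 1"
  have g: "g \<in> Gamma0 N" by (simp add: g_def Gamma0_def SL2Z_def)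
  obtain z where z: "z \<in> uhp" "f z \<noteq> 0" "cmod (den g z) > 1"
  proof -
    have "eventually (\<lambda>z. f z \<noteq> 0) (at (Complex 0 2))" by (rule eventually_nonzero) (simp add: uhp_iff)
    moreover have "eventually (\<lambda>z. z \<in> {z. Im z > 1} - {Complex 0 2}) (at (Complex 0 2))"
      using open_halfspace_Im_gt[of 1] by (intro eventually_at_in_open) auto
    ultimately have "eventually (\<lambda>z. f z \<noteq> 0 \<and> Im z > 1) (at (Complex 0 2))"
      by eventually_elim auto
    then obtain z where z: "f z \<noteq> 0" "Im z > 1" 
      using eventually_happens[of _ "at (Complex 0 2)"] by auto
    have "1 < real N * Im z" using z(2) N_pos by (simp add: less_1_mult' le_less_trans mult_le_cancel_right1 order_less_le_trans)
    also have "\<dots> = \<bar>Im (den g z)\<bar>" using z by (simp add: den_def g_def)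
    also have "\<dots> \<le> cmod (den g z)" by (rule abs_Im_le_cmod)
    finally show ?thesis using z by (intro that[of z]) (simp_all add: uhp_iff)
  qed
  have "slash f l g z = f z" "slash f k g z = f z"
    using form assms g z by (auto simp: mero_forms_def)
  hence "fac l g z * f (moebius g z) = fac k g z * f (moebius g z)" "f (moebius g z) \<noteq> 0"
    using z(2) by (auto simp: slash_eq)
  hence "den g z powi (- l) = den g z powi (- k)" using g by (simp add: fac_def Gamma0_det)
  hence "cmod (den g z) powi (- l) = cmod (den g z) powi (- k)" by (metis norm_power_int)
  moreover have "- l < - k \<or> - k < - l" using \<open>l \<noteq> k\<close> by linarith
  ultimately show False using power_int_strict_increasing[OF _ z(3)] by (metis less_irrefl)
qed

lemma weight_eq: "weight (Gamma0 N) f = k"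
  unfolding weight_def using form weight_unique by (rule the_equality)

lemma ex_expansion:
  assumes "\<sigma> \<in> SL2Z"
  obtains L where "has_q_expansion (slash f k \<sigma>) (width N \<sigma>) L" "L \<noteq> 0"
proof -
  obtain L where L: "has_q_expansion (slash f k \<sigma>) (width N \<sigma>) L"
    using form assms cusp_width_eq[OF N_pos assms] unfolding mero_forms_def by auto
  \<comment> \<open>A zero expansion would make \<open>f\<close> vanish on an open set, although it
    is non-zero in a punctured neighbourhood of every point.\<close>
  moreover have "L \<noteq> 0"
  proof
    assume "L = 0"
    with L obtain Y where Y: "\<And>\<tau>. Im \<tau> > Y \<Longrightarrow> slash f k \<sigma> \<tau> = 0"
      unfolding has_q_expansion_def by auto
    define z where "z = Complex 0 (max Y 0 + 1)"
    have d: "det \<sigma> > 0" using assms by (simp add: SL2Z_def)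
    have z: "z \<in> uhp" "Im z > max Y 0" by (simp_all add: z_def uhp_iff)
    have "eventually (\<lambda>w. f (moebius \<sigma> w) \<noteq> 0) (at z)"
      by (intro eventually_moebius eventually_nonzero z d moebius_uhp)
    moreover have "eventually (\<lambda>w. w \<in> {w. Im w > max Y 0} - {z}) (at z)"
      using open_halfspace_Im_gt[of "max Y 0"] z by (intro eventually_at_in_open) auto
    ultimately have "eventually (\<lambda>w. False) (at z)"
    proof eventually_elim
      case (elim w)
      hence w: "Im w > Y" "w \<in> uhp" by (auto simp: uhp_iff)
      thus ?case using Y[OF w(1)] fac_nonzero[OF d w(2)] elim by (simp add: slash_eq)
    qed
    thus False by simp
  qed
  ultimately show ?thesis by (rule that)
qed

lemma cusp_order_qord:
  assumes "\<sigma> \<in> SL2Z" "cusp_matrix \<rho> = \<sigma>" "qord (slash f k \<sigma>) r"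
  shows "real_of_int (cusp_order (Gamma0 N) f \<rho>) = real (width N \<sigma>) * r"
proof -
  obtain L where L: "has_q_expansion (slash f k \<sigma>) (width N \<sigma>) L" "L \<noteq> 0" using ex_expansion[OF assms(1)] .
  have w: "width N \<sigma> > 0" using width_pos[OF N_pos] .
  have "r = of_int (fls_subdegree L) / real (width N \<sigma>)"
    using qord_unique[OF assms(3) qord_of_q_expansion[OF L w]] .
  moreover have "(THE L. has_q_expansion (slash f k \<sigma>) (width N \<sigma>) L) = L"
    using L(1) q_expansion_unique[OF _ L(1) w] by (rule the_equality)
  ultimately show ?thesis
    using w by (simp add: cusp_order_def Let_def assms(2) weight_eq cusp_width_eq[OF N_pos assms(1)])
qed

lemma ex_qord:
  assumes "\<sigma> \<in> SL2Z" shows "\<exists>r. qord (slash f k \<sigma>) r"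
  using ex_expansion[OF assms] qord_of_q_expansion width_pos[OF N_pos] by metis

text \<open>Since \<open>f\<close> is invariant under \<open>g\<close>, slashing by \<open>B\<close>
  amounts to slashing \<open>f|\<sigma>'\<close> by the triangular matrix.\<close>

lemma qord_transfer:
  assumes "g \<in> Gamma0 N" "\<sigma>' \<in> SL2Z" "a > 0" "d > 0" "g ** B = \<sigma>' ** mk a b 0 d" "qord (slash f k \<sigma>') r"
  shows "qord (slash f k B) (r * of_int a / of_int d)"
proof (rule qord_cong[OF qord_slash_upper[OF assms(6,3,4), of k b], of 0])
  fix \<tau> :: complex assume "Im \<tau> > 0"
  hence t: "\<tau> \<in> uhp" by (simp add: uhp_iff)
  have "det (g ** B) = a * d" unfolding assms(5) using assms(2) by (simp add: det_mul SL2Z_def)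
  hence B: "det B > 0" using Gamma0_det[OF assms(1)] assms(3,4) by (simp add: det_mul)
  have "slash (slash f k \<sigma>') k (mk a b 0 d) \<tau> = slash f k (\<sigma>' ** mk a b 0 d) \<tau>"
    using assms(2-4) t by (intro slash_mult) (auto simp: SL2Z_def)
  also have "\<dots> = slash f k B \<tau>" unfolding assms(5)[symmetric] by (rule slash_left) fact+
  finally show "slash (slash f k \<sigma>') k (mk a b 0 d) \<tau> = slash f k B \<tau>" .
qed

end

section \<open>Finiteness of the support\<close>

text \<open>The classical reduction: minimising \<open>|c z + d|\<close> makes the imaginary part
  maximal, and a translation brings the real part into the strip. Comparison with the inversion
  \<open>S\<close> then shows that the modulus is at least 1.\<close>

lemma ex_fundamental_domain:
  assumes z: "z \<in> uhp"
  obtains \<gamma> where "\<gamma> \<in> SL2Z" "\<bar>Re (moebius \<gamma> z)\<bar> \<le> 1 / 2" "Im (moebius \<gamma> z) \<ge> 1 / 2"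
proof -
  \<comment> \<open>The bound 1 makes the set of values finite, and the identity matrix shows that
    it is not empty.\<close>
  define V where "V = (\<lambda>\<gamma>. cmod (den \<gamma> z)) ` {\<gamma>\<in>SL2Z. cmod (den \<gamma> z) \<le> 1}"
  have "V \<subseteq> (\<lambda>(c, d). cmod (of_int c * z + of_int d)) ` {(c, d). cmod (of_int c * z + of_int d) \<le> 1}"
    by (force simp: V_def den_def)
  hence "finite V" using finite_lattice_points[OF z] finite_surj by blast
  moreover have "cmod (den (mat 1) z) \<in> V"
    unfolding V_def by (intro imageI) (auto simp: den_def)
  ultimately have V: "Min V \<in> V" "\<And>v. v \<in> V \<Longrightarrow> Min V \<le> v" "Min V \<le> 1" 
    using Min_in[of V] Min_le[of V] by (blast, blast, auto simp: den_def)
  then obtain \<gamma> where \<gamma>: "\<gamma> \<in> SL2Z" "cmod (den \<gamma> z) = Min V" by (auto simp: V_def)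
  have min: "cmod (den \<gamma> z) \<le> cmod (den \<gamma>' z)" if "\<gamma>' \<in> SL2Z" for \<gamma>'
  proof (cases "cmod (den \<gamma>' z) \<le> 1")
    case True
    thus ?thesis using V(2) that \<gamma>(2) by (auto simp: V_def)
  next
    case False
    thus ?thesis using V(3) \<gamma>(2) by simp
  qed
  define j where "j = - \<lfloor>Re (moebius \<gamma> z) + 1 / 2\<rfloor>"
  define T where "T = mk 1 j 0 1"
  define w where "w = moebius (T ** \<gamma>) z"
  have d: "det \<gamma> = 1" "det T = 1" using \<gamma> by (auto simp: SL2Z_def T_def)
  have mem: "T ** \<gamma> \<in> SL2Z" using d by (simp add: SL2Z_def det_mul)
  have w: "w = moebius \<gamma> z + of_int j" 
    using d z by (simp add: w_def moebius_mult) (simp add: T_def moebius_def)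
  have w_uhp: "w \<in> uhp" using mem z by (simp add: w_def SL2Z_def)
  have Re: "\<bar>Re w\<bar> \<le> 1 / 2"
  proof -
    have "Re w = Re (moebius \<gamma> z) - of_int \<lfloor>Re (moebius \<gamma> z) + 1 / 2\<rfloor>" by (simp add: w j_def)
    thus ?thesis by linarith
  qed
  define S where "S = mk 0 (-1) 1 0"
  have "S \<in> SL2Z" by (simp add: SL2Z_def S_def)
  hence "cmod (den \<gamma> z) \<le> cmod (den (S ** (T ** \<gamma>)) z)" by (intro min SL2Z_mult[OF _ mem])
  also have "den (S ** (T ** \<gamma>)) z = den S w * den (T ** \<gamma>) z"
    unfolding w_def using mem z by (intro den_mult) (auto simp: SL2Z_def)
  also have "den S w = w" by (simp add: S_def den_def)
  also have "den (T ** \<gamma>) z = den \<gamma> z" by (simp add: den_def T_def mult_nth)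
  finally have "cmod (den \<gamma> z) \<le> cmod w * cmod (den \<gamma> z)" by (simp add: norm_mult)
  moreover have "cmod (den \<gamma> z) > 0" using den_nonzero[of \<gamma> z] d z by simp
  ultimately have "cmod w \<ge> 1" by simp
  hence "1 \<le> (cmod w)\<^sup>2" by simp
  hence "1 \<le> (Re w)\<^sup>2 + (Im w)\<^sup>2" by (simp add: cmod_power2)
  moreover have "(Re w)\<^sup>2 \<le> (1 / 2)\<^sup>2" using Re by (simp add: abs_le_square_iff[symmetric])
  \<comment> \<open>The sharp bound would be half the square root of 3; 1/2 suffices to stay away
    from the real axis.\<close>
  moreover have "(1 / 2)\<^sup>2 + (1 / 2)\<^sup>2 \<le> (1 :: real)" by (simp add: power2_eq_square)
  ultimately have "(1 / 2)\<^sup>2 \<le> (Im w)\<^sup>2" by linarith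
  moreover have "0 \<le> Im w" using w_uhp by (simp add: uhp_iff)
  ultimately have "1 / 2 \<le> Im w" by (rule power2_le_imp_le)
  thus ?thesis using that[of "T ** \<gamma>"] mem Re by (simp add: w_def)
qed

context nonzero_form
begin

text \<open>The expansion at the cusp yields a height \<open>Y\<close> above which there are no
  zeros or poles; the rest of the strip is compact in the upper half-plane, where they are
  isolated.\<close>

lemma finite_zeros_strip:
  assumes "\<sigma> \<in> SL2Z"
  shows "finite {w. \<bar>Re w\<bar> \<le> 1 / 2 \<and> Im w \<ge> 1 / 2 \<and> zorder f (moebius \<sigma> w) \<noteq> 0}"
proof -
  define g where "g = slash f k \<sigma>"
  have d: "det \<sigma> > 0" using assms by (simp add: SL2Z_def)
  have zo: "zorder g w = zorder f (moebius \<sigma> w)" if "w \<in> uhp" for w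
    unfolding g_def using d that by (intro zorder_slash meromorphic eventually_nonzero) auto
  obtain r where "qord g r" using ex_qord[OF assms] by (auto simp: g_def)
  then obtain Y where Y: "g holomorphic_on {\<tau>. Im \<tau> > Y}" "\<And>\<tau>. Im \<tau> > Y \<Longrightarrow> g \<tau> \<noteq> 0"
    using qord_eventually by blast
  have z0: "zorder g w = 0" if "Im w > Y" for w
  proof (rule zorder_eq_0I)
    have "g analytic_on {\<tau>. Im \<tau> > Y}" using Y(1) open_halfspace_Im_gt by (simp add: analytic_on_open)
    thus "g analytic_on {w}" by (rule analytic_on_subset) (use that in auto)
  qed (use Y that in auto)
  define K where "K = cbox (Complex (- 1 / 2) (1 / 2)) (Complex (1 / 2) Y)"
  have K: "K \<subseteq> uhp" by (auto simp: K_def in_cbox_complex_iff uhp_iff)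
  have g: "g nicely_meromorphic_on uhp" unfolding g_def using nicely d by (rule nicely_meromorphic_slash)
  have "\<exists>\<tau>\<in>uhp. g \<tau> \<noteq> 0"
    by (rule bexI[of _ "Complex 0 (max Y 0 + 1)"]) (auto simp: Y uhp_iff)
  hence "eventually (\<lambda>w. g w \<noteq> 0) (cosparse uhp)"
    using nicely_meromorphic_imp_constant_or_avoid[OF g open_uhp connected_uhp, of 0] by blast
  moreover have "eventually (\<lambda>w. g analytic_on {w}) (cosparse uhp)"
    using g by (intro meromorphic_on_imp_analytic_cosparse) (auto simp: nicely_meromorphic_on_def)
  ultimately have "eventually (\<lambda>w. zorder g w = 0) (cosparse uhp)"
    by eventually_elim (rule zorder_eq_0I)
  hence "{w. zorder g w \<noteq> 0} sparse_in uhp" by (simp add: eventually_cosparse)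
  hence "{w. zorder g w \<noteq> 0} sparse_in K" using K sparse_in_subset by blast
  hence "finite (K \<inter> {w. zorder g w \<noteq> 0})" by (rule sparse_in_compact_finite) (simp add: K_def)
  moreover have "{w. \<bar>Re w\<bar> \<le> 1 / 2 \<and> Im w \<ge> 1 / 2 \<and> zorder f (moebius \<sigma> w) \<noteq> 0} \<subseteq> K \<inter> {w. zorder g w \<noteq> 0}"
  proof
    fix w assume "w \<in> {w. \<bar>Re w\<bar> \<le> 1 / 2 \<and> Im w \<ge> 1 / 2 \<and> zorder f (moebius \<sigma> w) \<noteq> 0}"
    hence w: "\<bar>Re w\<bar> \<le> 1 / 2" "Im w \<ge> 1 / 2" "zorder f (moebius \<sigma> w) \<noteq> 0" by auto
    hence "zorder g w \<noteq> 0" using zo[of w] by (simp add: uhp_iff)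
    moreover from this have "Im w \<le> Y" using z0 by (meson not_le)
    ultimately show "w \<in> K \<inter> {w. zorder g w \<noteq> 0}"
      using w by (auto simp: K_def in_cbox_complex_iff abs_le_iff)
  qed
  ultimately show ?thesis by (rule finite_subset[rotated])
qed

lemma zorder_Gamma0:
  assumes "g \<in> Gamma0 N" "z \<in> uhp"
  shows "zorder f (moebius g z) = zorder f z"
proof -
  have d: "det g > 0" using Gamma0_det[OF assms(1)] by simp
  have "zorder f (moebius g z) = zorder (slash f k g) z"
    using d assms(2) by (intro zorder_slash[symmetric] meromorphic eventually_nonzero) auto
  also have "\<dots> = zorder f z"
  proof (rule zorder_cong[OF _ refl])
    have "eventually (\<lambda>w. w \<in> uhp - {z}) (at z)"
      using assms(2) open_uhp by (intro eventually_at_in_open) auto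
    thus "eventually (\<lambda>w. slash f k g w = f w) (at z)"
      by eventually_elim (use slash_Gamma0[OF assms(1)] in auto)
  qed
  finally show ?thesis .
qed

text \<open>Every class contains \<open>B v\<close> with \<open>B\<close> in the finite set
  \<open>C\<close> and \<open>v\<close> either in the reduced strip or at infinity, and each
  \<open>B\<close> allows only finitely many \<open>v\<close> of non-zero order.\<close>

lemma finite_support: "finite {x \<in> modular_curve (Gamma0 N). order_at (Gamma0 N) f (class_rep x) \<noteq> 0}"
proof -
  obtain C where C: "finite C" "C \<subseteq> SL2Z" "\<And>A. A \<in> SL2Z \<Longrightarrow> \<exists>g\<in>Gamma0 N. \<exists>B\<in>C. A = g ** B"
    using finite_index[OF N_pos] by blast
  define Z where "Z = (\<lambda>\<sigma>. {w. \<bar>Re w\<bar> \<le> 1 / 2 \<and> Im w \<ge> 1 / 2 \<and> zorder f (moebius \<sigma> w) \<noteq> 0})"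
  define X where "X = (\<lambda>(B, v). orbit (Gamma0 N) (Inner (moebius B v))) ` (SIGMA B:C. Z B)
    \<union> (\<lambda>B. orbit (Gamma0 N) (act B Infty)) ` C"
  have "finite X" unfolding X_def Z_def using C finite_zeros_strip by (intro finite_UnI finite_imageI finite_SigmaI) auto
  moreover have "{x \<in> modular_curve (Gamma0 N). order_at (Gamma0 N) f (class_rep x) \<noteq> 0} \<subseteq> X"
  proof clarify
    fix x assume x: "x \<in> modular_curve (Gamma0 N)" and o: "order_at (Gamma0 N) f (class_rep x) \<noteq> 0"
    note rep = class_rep_in[OF x]
    show "x \<in> X"
    proof (cases "\<exists>z. class_rep x = Inner z")
      case True
      then obtain z where z: "class_rep x = Inner z" "z \<in> uhp" using rep(1) by (auto simp: ext_uhp_def)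
      obtain \<gamma> where \<gamma>: "\<gamma> \<in> SL2Z" "\<bar>Re (moebius \<gamma> z)\<bar> \<le> 1 / 2" "Im (moebius \<gamma> z) \<ge> 1 / 2"
        using ex_fundamental_domain[OF z(2)] .
      define v where "v = moebius \<gamma> z"
      have d: "det \<gamma> = 1" using \<gamma> by (simp add: SL2Z_def)
      \<comment> \<open>The adjugate is decomposed because \<open>\<gamma>\<close> leads from
        \<open>z\<close> to the strip and the way back is needed.\<close>
      obtain g B where B: "g \<in> Gamma0 N" "B \<in> C" "adj \<gamma> = g ** B" using C(3)[OF SL2Z_adj[OF \<gamma>(1)]] by blast
      have dB: "det B = 1" "det g = 1" using B C Gamma0_det by (auto simp: SL2Z_def)
      have v: "v \<in> uhp" using d z by (simp add: v_def)
      have "z = moebius (adj \<gamma>) v" using d z by (simp add: v_def mult_adj flip: moebius_mult)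
      hence zB: "z = moebius g (moebius B v)" unfolding B(3) using dB v by (simp add: moebius_mult)
      have Bv: "moebius B v \<in> uhp" using dB v by simp
      have "zorder f z \<noteq> 0" using o z by (auto simp: order_at_def)
      hence "zorder f (moebius B v) \<noteq> 0" unfolding zB zorder_Gamma0[OF B(1) Bv] .
      hence "v \<in> Z B" using \<gamma> by (simp add: Z_def v_def)
      moreover have "x = orbit (Gamma0 N) (Inner (moebius B v))"
      proof -
        have "x = orbit (Gamma0 N) (act g (Inner (moebius B v)))" using rep(2) z zB by simp
        thus ?thesis using B(1) Bv by (simp add: ext_uhp_def del: act.simps)
      qed
      ultimately show ?thesis using B(2) unfolding X_def by force
    next
      case False
      then obtain \<sigma> where \<sigma>: "\<sigma> \<in> SL2Z" "act \<sigma> Infty = class_rep x" using ex_cusp_matrix by blast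
      obtain g B where B: "g \<in> Gamma0 N" "B \<in> C" "\<sigma> = g ** B" using C(3)[OF \<sigma>(1)] by blast
      have dB: "det B = 1" "det g = 1" using B C Gamma0_det by (auto simp: SL2Z_def)
      have Inf: "Infty \<in> ext_uhp" by (simp add: ext_uhp_def)
      have "x = orbit (Gamma0 N) (act g (act B Infty))" using rep(2) \<sigma>(2) dB Inf by (simp add: B(3) act_mult)
      also have "\<dots> = orbit (Gamma0 N) (act B Infty)" using B(1) dB Inf by simp
      finally show ?thesis using B(2) unfolding X_def by blast
    qed
  qed
  ultimately show ?thesis by (rule finite_subset[rotated])
qed

text \<open>\<open>Abs_poly_mapping\<close> returns its argument on functions of finite support;
  this is where \<open>finite_support\<close> enters.\<close>

lemma lookup_divisor:
  "Poly_Mapping.lookup (divisor (Gamma0 N) f) x =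
    (if x \<in> modular_curve (Gamma0 N) then order_at (Gamma0 N) f (class_rep x) else 0)"
proof -
  have "{x. (if x \<in> modular_curve (Gamma0 N) then order_at (Gamma0 N) f (class_rep x) else 0) \<noteq> 0}
     = {x \<in> modular_curve (Gamma0 N). order_at (Gamma0 N) f (class_rep x) \<noteq> 0}" by auto
  hence "finite {x. (if x \<in> modular_curve (Gamma0 N) then order_at (Gamma0 N) f (class_rep x) else 0) \<noteq> 0}"
    using finite_support by simp
  thus ?thesis unfolding divisor_def by (simp add: Abs_poly_mapping_inverse)
qed

end

section \<open>The multiplicative Hecke operator\<close>

locale hecke_form = nonzero_form +
  fixes n :: nat and R :: "mat2 set"
  assumes n_pos: "n > 0" and coprime_n: "coprime n N" and reps: "hecke_reps N n R"
begin

lemma finite_R: "finite R"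
  using hecke_reps_finite[OF reps N_pos n_pos] .

lemma R_hecke_set: "A \<in> R \<Longrightarrow> A \<in> hecke_set N n"
  using hecke_reps_in[OF reps] .

lemma det_R: "A \<in> R \<Longrightarrow> det A > 0"
  using hecke_set_det[OF R_hecke_set] n_pos by simp

text \<open>The raw product. Identities are proved for \<open>F\<close> and carried over to the
  normalised \<open>P\<close>, which agrees with it in a punctured neighbourhood of every
  point.\<close>

definition F :: "complex \<Rightarrow> complex" where
  "F \<tau> = (\<Prod>A\<in>R. slash f k A \<tau>)"

abbreviation P where "P \<equiv> hecke_mult N R f"

abbreviation l where "l \<equiv> k * int (card R)"

lemma P_eq: "P = remove_sings F"
  by (simp add: hecke_mult_def weight_eq F_def[abs_def])

lemma meromorphic_F: "F meromorphic_on uhp"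
  unfolding F_def[abs_def] using det_R by (intro meromorphic_on_prod meromorphic_slash meromorphic)

lemma nicely_P: "P nicely_meromorphic_on uhp"
  unfolding P_eq using meromorphic_F by (rule remove_sings_nicely_meromorphic)

lemma eventually_P_eq_F:
  assumes "z \<in> uhp" shows "eventually (\<lambda>w. P w = F w) (at z)"
  unfolding P_eq using meromorphic_F assms
  by (intro eventually_remove_sings_eq_at) (auto simp: meromorphic_on_altdef)

lemma eventually_F_nonzero:
  assumes "z \<in> uhp" shows "eventually (\<lambda>w. F w \<noteq> 0) (at z)"
proof -
  have "eventually (\<lambda>w. \<forall>A\<in>R. slash f k A w \<noteq> 0) (at z)"
  proof (rule eventually_ball_finite[OF finite_R], intro ballI)
    fix A assume A: "A \<in> R"
    have "eventually (\<lambda>w. f (moebius A w) \<noteq> 0) (at z)"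
      using det_R[OF A] assms by (intro eventually_moebius eventually_nonzero) auto
    moreover have "eventually (\<lambda>w. w \<in> uhp - {z}) (at z)"
      using assms open_uhp by (intro eventually_at_in_open) auto
    ultimately show "eventually (\<lambda>w. slash f k A w \<noteq> 0) (at z)"
      by eventually_elim (use fac_nonzero[OF det_R[OF A]] in \<open>auto simp: slash_eq\<close>)
  qed
  thus ?thesis by eventually_elim (simp add: F_def finite_R)
qed

lemma fac_power:
  assumes "det B > 0" "\<tau> \<in> uhp"
  shows "fac (k * int m) B \<tau> = fac k B \<tau> ^ m"
proof -
  have "den B \<tau> powi (- (k * int m)) = (den B \<tau> powi (- k)) ^ m"
    using power_int_mult[of "den B \<tau>" "- k" "int m"] by simp
  moreover have "real_of_int (det B) powr (real_of_int (k * int m) / 2) = (real_of_int (det B) powr (real_of_int k / 2)) ^ m"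
    using assms(1) by (simp add: powr_power mult.commute)
  ultimately show ?thesis by (simp add: fac_def power_mult_distrib)
qed

lemma slash_F:
  assumes "det B > 0" "\<tau> \<in> uhp"
  shows "slash F l B \<tau> = (\<Prod>A\<in>R. slash f k (A ** B) \<tau>)"
proof -
  have "(\<Prod>A\<in>R. slash f k (A ** B) \<tau>) = (\<Prod>A\<in>R. fac k B \<tau> * slash f k A (moebius B \<tau>))"
    by (intro prod.cong refl) (use assms det_R in \<open>simp add: slash_eq fac_mult moebius_mult\<close>)
  also have "\<dots> = fac k B \<tau> ^ card R * F (moebius B \<tau>)" by (simp add: prod.distrib F_def)
  finally show ?thesis using fac_power[OF assms, of "card R"] by (simp add: slash_eq)
qed

text \<open>Right multiplication by \<open>g\<close> permutes the cosets represented by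
  \<open>R\<close>; the factors from \<open>Gamma0 N\<close> arising on the left are absorbed by the
  invariance of \<open>f\<close>.\<close>

lemma slash_F_Gamma0:
  assumes "g \<in> Gamma0 N" "\<tau> \<in> uhp"
  shows "slash F l g \<tau> = F \<tau>"
proof -
  have dg: "det g = 1" using assms(1) by (rule Gamma0_det)
  have "\<forall>A\<in>R. \<exists>A'. A' \<in> R \<and> (\<exists>h\<in>Gamma0 N. A ** g = h ** A')"
    using hecke_reps_obtain[OF reps hecke_set_mult_right[OF assms(1) R_hecke_set]] by metis
  then obtain \<pi> where \<pi>: "\<And>A. A \<in> R \<Longrightarrow> \<pi> A \<in> R" "\<And>A. A \<in> R \<Longrightarrow> \<exists>h\<in>Gamma0 N. A ** g = h ** \<pi> A"
    by metis
  have "inj_on \<pi> R"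
  proof (rule inj_onI)
    fix A B assume AB: "A \<in> R" "B \<in> R" "\<pi> A = \<pi> B"
    obtain h h' where h: "h \<in> Gamma0 N" "A ** g = h ** \<pi> A" "h' \<in> Gamma0 N" "B ** g = h' ** \<pi> A"
      using \<pi>(2)[OF AB(1)] \<pi>(2)[OF AB(2)] unfolding AB(3) by blast
    have "(h' ** adj h ** A) ** g = h' ** (adj h ** (h ** \<pi> A))"
      unfolding h(2)[symmetric] by (simp add: matrix_mul_assoc)
    also have "\<dots> = B ** g" using h Gamma0_det by simp
    finally have "B = h' ** adj h ** A" using mult_right_cancel_det[of g] dg by simp
    thus "A = B" using hecke_reps_unique[OF reps AB(1,2), of "h' ** adj h"] h by blast
  qed
  hence bij: "bij_betw \<pi> R R"
    using endo_inj_surj[OF finite_R, of \<pi>] \<pi>(1) by (auto simp: bij_betw_def)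
  have "slash F l g \<tau> = (\<Prod>A\<in>R. slash f k (A ** g) \<tau>)" using dg assms(2) by (intro slash_F) auto
  also have "\<dots> = (\<Prod>A\<in>R. slash f k (\<pi> A) \<tau>)"
  proof (rule prod.cong[OF refl])
    fix A assume A: "A \<in> R"
    then obtain h where "h \<in> Gamma0 N" "A ** g = h ** \<pi> A" using \<pi>(2) by blast
    thus "slash f k (A ** g) \<tau> = slash f k (\<pi> A) \<tau>" 
      using det_R[OF \<pi>(1)[OF A]] assms(2) by (simp add: slash_left)
  qed
  also have "\<dots> = F \<tau>" unfolding F_def by (rule prod.reindex_bij_betw[OF bij])
  finally show ?thesis .
qed

lemma slash_P_Gamma0:
  assumes "g \<in> Gamma0 N" "\<tau> \<in> uhp"
  shows "slash P l g \<tau> = P \<tau>"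
proof (rule nicely_meromorphic_eqI[OF _ nicely_P assms(2)])
  have dg: "det g > 0" using Gamma0_det[OF assms(1)] by simp
  show "slash P l g nicely_meromorphic_on uhp" using nicely_P dg by (rule nicely_meromorphic_slash)
  have "eventually (\<lambda>w. P (moebius g w) = F (moebius g w)) (at \<tau>)"
    using dg assms(2) by (intro eventually_moebius eventually_P_eq_F) auto
  moreover have "eventually (\<lambda>w. w \<in> uhp - {\<tau>}) (at \<tau>)"
    using assms(2) open_uhp by (intro eventually_at_in_open) auto
  ultimately show "eventually (\<lambda>w. slash P l g w = P w) (at \<tau>)"
    using eventually_P_eq_F[OF assms(2)]
  proof eventually_elim
    case (elim w)
    have "slash P l g w = slash F l g w" using elim(1) by (rule slash_cong)
    also have "\<dots> = F w" using elim assms(1) by (intro slash_F_Gamma0) auto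
    finally show ?case using elim by simp
  qed
qed

text \<open>High up, the product over \<open>A \<sigma>\<close> is holomorphic and hence already
  normalised, so that it equals \<open>P|\<sigma>\<close> pointwise and not just off a discrete
  set.\<close>

lemma qord_P:
  assumes "\<sigma> \<in> SL2Z" "\<And>A. A \<in> R \<Longrightarrow> qord (slash f k (A ** \<sigma>)) (r A)"
  shows "qord (slash P l \<sigma>) (\<Sum>A\<in>R. r A)"
proof -
  have d: "det \<sigma> > 0" using assms by (simp add: SL2Z_def)
  have G: "qord (\<lambda>\<tau>. \<Prod>A\<in>R. slash f k (A ** \<sigma>) \<tau>) (\<Sum>A\<in>R. r A)"
    by (intro qord_prod finite_R assms)
  then obtain Y where Y: "(\<lambda>\<tau>. \<Prod>A\<in>R. slash f k (A ** \<sigma>) \<tau>) holomorphic_on {\<tau>. Im \<tau> > Y}"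
    by (rule qord_eventually)
  define S where "S = {\<tau>. Im \<tau> > max Y 0}"
  have S: "open S" "S \<subseteq> uhp" using open_halfspace_Im_gt by (auto simp: S_def uhp_iff simp del: max_less_iff_conj)
  have "(\<lambda>\<tau>. \<Prod>A\<in>R. slash f k (A ** \<sigma>) \<tau>) analytic_on S"
    using holomorphic_on_subset[OF Y, of S] S(1) by (auto simp: analytic_on_open S_def)
  hence nG: "(\<lambda>\<tau>. \<Prod>A\<in>R. slash f k (A ** \<sigma>) \<tau>) nicely_meromorphic_on S"
    by (rule analytic_on_imp_nicely_meromorphic_on)
  have nP: "slash P l \<sigma> nicely_meromorphic_on S"
    using nicely_meromorphic_slash[OF nicely_P d] S(2) by (rule nicely_meromorphic_on_subset)
  show ?thesis
  proof (rule qord_cong[OF G])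
    fix \<tau> assume "Im \<tau> > max Y 0"
    hence \<tau>: "\<tau> \<in> S" by (simp add: S_def)
    hence \<tau>': "\<tau> \<in> uhp" using S by blast
    show "(\<Prod>A\<in>R. slash f k (A ** \<sigma>) \<tau>) = slash P l \<sigma> \<tau>"
    proof (rule nicely_meromorphic_eqI[OF nG nP \<tau>])
      have "eventually (\<lambda>w. P (moebius \<sigma> w) = F (moebius \<sigma> w)) (at \<tau>)"
        using d \<tau>' by (intro eventually_moebius eventually_P_eq_F) auto
      moreover have "eventually (\<lambda>w. w \<in> uhp - {\<tau>}) (at \<tau>)"
        using \<tau>' open_uhp by (intro eventually_at_in_open) auto
      ultimately show "eventually (\<lambda>w. (\<Prod>A\<in>R. slash f k (A ** \<sigma>) w) = slash P l \<sigma> w) (at \<tau>)"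
      proof eventually_elim
        case (elim w)
        have "slash P l \<sigma> w = slash F l \<sigma> w" using elim(1) by (rule slash_cong)
        also have "\<dots> = (\<Prod>A\<in>R. slash f k (A ** \<sigma>) w)" using elim d by (intro slash_F) auto
        finally show ?case ..
      qed
    qed
  qed
qed

text \<open>With \<open>\<sigma>'\<close> chosen for the cusp to which \<open>A \<sigma>\<close>
  carries infinity, the matrix \<open>M\<close> fixes infinity and is triangular, so the exponent
  comes from that of \<open>f|\<sigma>'\<close>.\<close>

lemma ex_qord_R:
  assumes "\<sigma> \<in> SL2Z" "A \<in> R"
  shows "\<exists>r. qord (slash f k (A ** \<sigma>)) r"
proof -
  have d: "det \<sigma> = 1" using assms by (simp add: SL2Z_def)
  have Inf: "Infty \<in> ext_uhp" by (simp add: ext_uhp_def)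
  have dA: "det A = int n" using hecke_set_det[OF R_hecke_set[OF assms(2)]] .
  have "act (A ** \<sigma>) Infty \<noteq> Inner z" for z by (simp add: act_Infty)
  then obtain \<sigma>' where \<sigma>': "\<sigma>' \<in> SL2Z" "act \<sigma>' Infty = act (A ** \<sigma>) Infty" using ex_cusp_matrix by metis
  have d': "det \<sigma>' = 1" using \<sigma>' by (simp add: SL2Z_def)
  define M where "M = adj \<sigma>' ** (A ** \<sigma>)"
  have dM: "det M = int n" by (simp add: M_def det_mul d d' dA)
  have "act M Infty = act (adj \<sigma>') (act \<sigma>' Infty)"
    unfolding \<sigma>'(2) M_def using d d' dA n_pos Inf by (intro act_mult) (auto simp: det_mul)
  also have "\<dots> = Infty" using d' Inf by (intro act_adj_eq) auto
  finally have M21: "M$2$1 = 0" by simp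
  have M: "\<sigma>' ** M = A ** \<sigma>" using d' by (simp add: M_def)
  obtain r where r: "qord (slash f k \<sigma>') r" using ex_qord[OF \<sigma>'(1)] by blast
  have pos: "int a > 0" "int (n div a) > 0" if "a dvd n" for a using that n_pos by (auto elim!: dvdE)
  from dM n_pos M21 show ?thesis
  proof (cases rule: upper_cases)
    case (1 a b)
    have "mat 1 ** (A ** \<sigma>) = \<sigma>' ** mk (int a) b 0 (int (n div a))"
      using M 1 by simp
    from qord_transfer[OF Gamma0_one \<sigma>'(1) pos[OF 1(1)] this r] show ?thesis by blast
  next
    case (2 a b)
    \<comment> \<open>A negative diagonal is corrected by \<open>- I\<close>, which belongs to
      \<open>Gamma0 N\<close>.\<close>
    have "(- mat 1) ** (A ** \<sigma>) = \<sigma>' ** mk (int a) b 0 (int (n div a))"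
      using M by (simp add: minus_mult2 flip: 2(2))
    moreover have "- mat 1 \<in> Gamma0 N" by simp
    ultimately show ?thesis using qord_transfer[OF _ \<sigma>'(1) pos[OF 2(1)] _ r] by blast
  qed
qed

text \<open>Meromorphy at the cusps comes from the product as a whole: its growth is the sum of
  those of the factors, and its invariance under \<open>Gamma0 N\<close> makes it periodic modulo
  the width.\<close>

lemma P_form: "nonzero_form N l P"
proof
  show "N > 0" by (rule N_pos)
  show "P \<in> mero_forms (Gamma0 N) l"
    unfolding mero_forms_def mem_Collect_eq
  proof (intro conjI ballI)
    show "P nicely_meromorphic_on uhp" by (rule nicely_P)
    show "slash P l g \<tau> = P \<tau>" if "g \<in> Gamma0 N" "\<tau> \<in> uhp" for g \<tau>
      using that by (rule slash_P_Gamma0)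
    fix \<sigma> assume \<sigma>: "\<sigma> \<in> SL2Z"
    have d: "det \<sigma> = 1" using \<sigma> by (simp add: SL2Z_def)
    obtain r where r: "\<And>A. A \<in> R \<Longrightarrow> qord (slash f k (A ** \<sigma>)) (r A)"
      using ex_qord_R[OF \<sigma>] by metis
    define h where "h = width N \<sigma>"
    \<comment> \<open>Translating by \<open>h\<close> before \<open>\<sigma>\<close> is the same as
      applying this element of \<open>Gamma0 N\<close> after it.\<close>
    define u where "u = \<sigma> ** mk 1 (int h) 0 1 ** adj \<sigma>"
    have u: "u \<in> Gamma0 N" using conj_unipotent_iff[OF N_pos \<sigma>, of "int h"] by (simp add: u_def h_def)
    have "slash P l \<sigma> (\<tau> + of_nat h) = slash P l \<sigma> \<tau>" if "Im \<tau> > 0" for \<tau>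
    proof -
      have \<tau>: "\<tau> \<in> uhp" using that by (simp add: uhp_iff)
      have "slash P l \<sigma> (\<tau> + of_nat h) = slash (slash P l \<sigma>) l (mk 1 (int h) 0 1) \<tau>"
        by (simp add: slash_eq[of "slash P l \<sigma>"] fac_def den_def moebius_def)
      also have "\<dots> = slash P l (\<sigma> ** mk 1 (int h) 0 1) \<tau>" using d \<tau> by (intro slash_mult) auto
      also have "\<sigma> ** mk 1 (int h) 0 1 = u ** \<sigma>" using d by (simp add: u_def)
      also have "slash P l (u ** \<sigma>) \<tau> = slash (slash P l u) l \<sigma> \<tau>"
        using d Gamma0_det[OF u] \<tau> by (intro slash_mult[symmetric]) auto
      also have "\<dots> = slash P l \<sigma> \<tau>" using u d \<tau> by (intro slash_cong slash_P_Gamma0) auto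
      finally show ?thesis .
    qed
    from ex_q_expansion[OF qord_P[OF \<sigma> r] this] width_pos[OF N_pos]
    show "\<exists>L. has_q_expansion (slash P l \<sigma>) (cusp_width (Gamma0 N) \<sigma>) L"
      by (simp add: cusp_width_eq[OF N_pos \<sigma>] h_def)
  qed
  have i: "\<i> \<in> uhp" by (simp add: uhp_iff)
  have "eventually (\<lambda>w. w \<in> uhp - {\<i>}) (at \<i>)"
    using i open_uhp by (intro eventually_at_in_open) auto
  with eventually_P_eq_F[OF i] eventually_F_nonzero[OF i]
  have "eventually (\<lambda>w. w \<in> uhp \<and> P w \<noteq> 0) (at \<i>)" by eventually_elim auto
  thus "\<exists>\<tau>\<in>uhp. P \<tau> \<noteq> 0" using eventually_happens[of _ "at \<i>"] by auto
qed

lemma zorder_P: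
  assumes "z \<in> uhp"
  shows "zorder P z = (\<Sum>A\<in>R. zorder f (moebius A z))"
proof -
  have "zorder P z = zorder F z" by (rule zorder_cong[OF eventually_P_eq_F[OF assms] refl])
  also have "\<dots> = (\<Sum>A\<in>R. zorder (slash f k A) z)"
    unfolding F_def[abs_def]
  proof (rule zorder_prod)
    fix A assume "A \<in> R"
    thus "slash f k A meromorphic_on {z}"
      using meromorphic_on_subset[OF meromorphic_slash[OF meromorphic det_R]] assms by blast
  qed (use eventually_F_nonzero[OF assms] in \<open>simp add: F_def\<close>)
  also have "\<dots> = (\<Sum>A\<in>R. zorder f (moebius A z))"
    using assms det_R by (intro sum.cong refl zorder_slash meromorphic eventually_nonzero) auto
  finally show ?thesis .
qed

end

section \<open>Comparing the two divisors\<close>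

context hecke_form
begin

interpretation P: nonzero_form N l P
  by (rule P_form)

lemma order_at_cusp_matrix:
  assumes "w \<in> ext_uhp" "\<And>z. w \<noteq> Inner z"
  shows "cusp_matrix w \<in> SL2Z" "act (cusp_matrix w) Infty = w"
    "order_at G g w = of_int (cusp_order G g w)"
proof -
  have "cusp_matrix w \<in> SL2Z \<and> act (cusp_matrix w) Infty = w"
    unfolding cusp_matrix_def by (rule someI_ex) (use ex_cusp_matrix[OF assms(2)] in blast)
  thus "cusp_matrix w \<in> SL2Z" "act (cusp_matrix w) Infty = w" by auto
  show "order_at G g w = of_int (cusp_order G g w)"
    using assms(2) by (cases w) (auto simp: order_at_def)
qed

text \<open>\<open>hits w z\<close> collects the factors of the product governed by the class of
  \<open>z\<close> at the point \<open>w\<close>; the size of \<open>hits z w\<close> is the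
  multiplicity of the class of \<open>w\<close> in the Hecke image of that of
  \<open>z\<close>.\<close>

definition hits :: "ext_point \<Rightarrow> ext_point \<Rightarrow> mat2 set" where
  "hits w z = {A \<in> R. orbit (Gamma0 N) (act A w) = orbit (Gamma0 N) z}"

lemma hits_mixed:
  assumes "z \<in> uhp" "w \<in> ext_uhp" "\<And>z. w \<noteq> Inner z"
  shows "hits (Inner z) w = {}" "hits w (Inner z) = {}"
proof -
  have z: "Inner z \<in> ext_uhp" using assms(1) by (simp add: ext_uhp_def)
  have c: "act A w \<noteq> Inner z'" if "det A > 0" for A z'
  proof -
    obtain p q where "coprime p q" "w = proj p q" using cusp_cases[OF assms(3)] by metis
    moreover from this have "p \<noteq> 0 \<or> q \<noteq> 0" by auto
    ultimately show ?thesis by (simp add: act_proj)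
  qed
  have False if "A \<in> hits (Inner z) w" for A
  proof -
    from that have A: "A \<in> R" "orbit (Gamma0 N) (act A (Inner z)) = orbit (Gamma0 N) w" by (auto simp: hits_def)
    then obtain g where "g \<in> Gamma0 N" "act g (act A (Inner z)) = w"
      using orbit_eq_iff[OF act_ext_uhp[OF det_R[OF A(1)] z] assms(2)] by blast
    thus False using assms(3) by (metis act.simps(1))
  qed
  thus "hits (Inner z) w = {}" by blast
  have False if "A \<in> hits w (Inner z)" for A
  proof -
    from that have A: "A \<in> R" "orbit (Gamma0 N) (act A w) = orbit (Gamma0 N) (Inner z)" by (auto simp: hits_def)
    then obtain g where "g \<in> Gamma0 N" "act g (act A w) = Inner z"
      using orbit_eq_iff[OF act_ext_uhp[OF det_R[OF A(1)] assms(2)] z] by blast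
    hence "act (g ** A) w = Inner z" "det (g ** A) > 0"
      using det_R[OF A(1)] assms(2) by (auto simp: act_mult det_mul Gamma0_det)
    thus False using c by blast
  qed
  thus "hits w (Inner z) = {}" by blast
qed

text \<open>All numerators equal the order of \<open>f\<close> at \<open>z\<close>; the change of
  ramification index is compensated by \<open>inner_count\<close>.\<close>

lemma inner_term:
  assumes "w \<in> uhp" "z \<in> ext_uhp"
  shows "(\<Sum>A\<in>hits (Inner w) z. real_of_int (zorder f (moebius A w)) / real (ramification (Gamma0 N) w))
     = real_of_rat (order_at (Gamma0 N) f z) * real (card (hits z (Inner w)))"
proof (cases "\<exists>u. z = Inner u")
  case False
  thus ?thesis using hits_mixed[OF assms] by simp
next
  case True
  then obtain u where u: "z = Inner u" "u \<in> uhp" using assms by (auto simp: ext_uhp_def)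
  have ext: "Inner u \<in> ext_uhp" "Inner w \<in> ext_uhp" using u assms by (auto simp: ext_uhp_def)
  let ?e = "\<lambda>z. real (ramification (Gamma0 N) z)"
  have e: "?e w > 0" "?e u > 0" using ramification_pos assms u by auto
  have "(\<Sum>A\<in>hits (Inner w) z. real_of_int (zorder f (moebius A w)) / ?e w)
     = (\<Sum>A\<in>hits (Inner w) z. real_of_int (zorder f u) / ?e w)"
  proof (rule sum.cong[OF refl])
    fix A assume "A \<in> hits (Inner w) z"
    hence A: "A \<in> R" "orbit (Gamma0 N) (act A (Inner w)) = orbit (Gamma0 N) (Inner u)" by (auto simp: hits_def u)
    then obtain g where g: "g \<in> Gamma0 N" "act g (act A (Inner w)) = Inner u"
      using orbit_eq_iff[OF act_ext_uhp[OF det_R[OF A(1)] ext(2)] ext(1)] by blast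
    have "moebius A w \<in> uhp" using det_R[OF A(1)] assms by simp
    hence "zorder f u = zorder f (moebius A w)" using zorder_Gamma0[OF g(1), of "moebius A w"] g(2) by simp
    thus "real_of_int (zorder f (moebius A w)) / ?e w = real_of_int (zorder f u) / ?e w" by simp
  qed
  also have "\<dots> = real_of_int (zorder f u) / ?e w * real (card (hits (Inner w) z))" by simp
  also have "\<dots> = real_of_int (zorder f u) / ?e u * real (card (hits z (Inner w)))"
  proof -
    have "ramification (Gamma0 N) u * card (hits (Inner w) z) = ramification (Gamma0 N) w * card (hits z (Inner w))"
      unfolding hits_def u(1) by (rule inner_count[OF n_pos coprime_n reps assms(1) u(2)])
    hence "?e u * real (card (hits (Inner w) z)) = ?e w * real (card (hits z (Inner w)))"
      by (simp only: flip: of_nat_mult)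
    thus ?thesis using e by (simp add: field_simps)
  qed
  finally show ?thesis by (simp add: u order_at_def of_rat_divide)
qed

text \<open>The factor indexed by \<open>(a, b)\<close> has exponent \<open>r' a / d\<close>. Scaled
  by the width \<open>h\<close> of \<open>w\<close>, this is the order \<open>h' r'\<close> of
  \<open>f\<close> at \<open>z\<close> times \<open>a h / (d h')\<close>, the weight summed in
  \<open>cusp_count\<close>.\<close>

lemma cusp_term:
  assumes "w \<in> ext_uhp" "\<And>z. w \<noteq> Inner z" "z \<in> ext_uhp" "\<sigma> = cusp_matrix w"
    and r: "\<And>A. A \<in> R \<Longrightarrow> qord (slash f k (A ** \<sigma>)) (r A)"
  shows "(\<Sum>A\<in>hits w z. real (width N \<sigma>) * r A)
     = real_of_rat (order_at (Gamma0 N) f z) * real (card (hits z w))"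
proof (cases "\<exists>u. z = Inner u")
  case True
  then obtain u where u: "z = Inner u" "u \<in> uhp" using assms by (auto simp: ext_uhp_def)
  thus ?thesis using hits_mixed[OF u(2) assms(1,2)] by simp
next
  case False
  define \<sigma>' where "\<sigma>' = cusp_matrix z"
  note \<sigma> = order_at_cusp_matrix(1,2)[OF assms(1,2), folded assms(4)]
  have \<sigma>': "\<sigma>' \<in> SL2Z" "act \<sigma>' Infty = z"
    using order_at_cusp_matrix(1,2)[OF assms(3)] False by (auto simp: \<sigma>'_def)
  obtain r' where r': "qord (slash f k \<sigma>') r'" using ex_qord[OF \<sigma>'(1)] by blast
  have ord: "real_of_rat (order_at (Gamma0 N) f z) = real (width N \<sigma>') * r'"
    using cusp_order_qord[OF \<sigma>'(1) \<sigma>'_def[symmetric] r'] order_at_cusp_matrix(3)[OF assms(3)] False by simp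
  obtain \<phi> where \<phi>: "bij_betw \<phi> (cusp_index N n \<sigma> \<sigma>') (hits w z)"
    "\<And>a b. (a, b) \<in> cusp_index N n \<sigma> \<sigma>' \<Longrightarrow>
       \<exists>g\<in>Gamma0 N. g ** \<phi> (a, b) ** \<sigma> = \<sigma>' ** mk (int a) b 0 (int (n div a))"
    using cusp_index_bij[OF N_pos n_pos reps \<sigma>(1) \<sigma>'(1)] unfolding \<sigma>(2) \<sigma>'(2) hits_def[symmetric] by metis
  have w: "width N \<sigma> > 0" "width N \<sigma>' > 0" using width_pos[OF N_pos] by auto
  have "(\<Sum>A\<in>hits w z. real (width N \<sigma>) * r A) = (\<Sum>x\<in>cusp_index N n \<sigma> \<sigma>'. real (width N \<sigma>) * r (\<phi> x))"
    by (rule sum.reindex_bij_betw[OF \<phi>(1), symmetric])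
  also have "\<dots> = (\<Sum>(a, b)\<in>cusp_index N n \<sigma> \<sigma>'. real (width N \<sigma>') * r' * (real (a * width N \<sigma>) / real (n div a * width N \<sigma>')))"
  proof (rule sum.cong[OF refl], clarify)
    fix a b assume ab: "(a, b) \<in> cusp_index N n \<sigma> \<sigma>'"
    hence "a dvd n" by (auto simp: cusp_index_def)
    hence pos: "a > 0" "n div a > 0" using n_pos by (auto elim!: dvdE)
    obtain g where g: "g \<in> Gamma0 N" "g ** \<phi> (a, b) ** \<sigma> = \<sigma>' ** mk (int a) b 0 (int (n div a))"
      using \<phi>(2)[OF ab] by blast
    have "\<phi> (a, b) \<in> R" using bij_betwE[OF \<phi>(1)] ab by (auto simp: hits_def)
    moreover have "qord (slash f k (\<phi> (a, b) ** \<sigma>)) (r' * of_int (int a) / of_int (int (n div a)))"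
      using pos g by (intro qord_transfer[OF g(1) \<sigma>'(1) _ _ _ r', of "int a" "int (n div a)"]) (auto simp: matrix_mul_assoc)
    ultimately have "r (\<phi> (a, b)) = r' * real a / real (n div a)" using qord_unique[OF r] by simp
    thus "real (width N \<sigma>) * r (\<phi> (a, b)) = 
       real (width N \<sigma>') * r' * (real (a * width N \<sigma>) / real (n div a * width N \<sigma>'))"
      using w by simp
  qed
  also have "\<dots> = real (width N \<sigma>') * r' * (\<Sum>(a, b)\<in>cusp_index N n \<sigma> \<sigma>'. real (a * width N \<sigma>) / real (n div a * width N \<sigma>'))"
    by (simp add: sum_distrib_left case_prod_unfold)
  also have "(\<Sum>(a, b)\<in>cusp_index N n \<sigma> \<sigma>'. real (a * width N \<sigma>) / real (n div a * width N \<sigma>')) = real (card (hits z w))"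
    unfolding cusp_count[OF N_pos n_pos coprime_n reps \<sigma>(1) \<sigma>'(1)] \<sigma>(2) \<sigma>'(2) hits_def ..
  finally show ?thesis by (simp add: ord)
qed

abbreviation D where "D \<equiv> divisor (Gamma0 N) f"

text \<open>Inner points and cusps are treated alike: \<open>\<psi> A\<close> is the share of
  \<open>A\<close> in the order of the product at \<open>w\<close>, and the shares are grouped by
  the class of \<open>A w\<close>. They are real because the exponents at cusps are; the result
  returns to the rationals by injectivity.\<close>

lemma order_at_P:
  assumes w: "w \<in> ext_uhp"
  shows "order_at (Gamma0 N) P w =
    (\<Sum>x\<in>Poly_Mapping.keys D. Poly_Mapping.lookup D x * of_nat (card (hits (class_rep x) w)))"
proof -
  have ex: "\<exists>\<psi>. real_of_rat (order_at (Gamma0 N) P w) = (\<Sum>A\<in>R. \<psi> A) \<and>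
     (\<forall>z\<in>ext_uhp. (\<Sum>A\<in>hits w z. \<psi> A) = real_of_rat (order_at (Gamma0 N) f z) * real (card (hits z w)))"
  proof (cases "\<exists>u. w = Inner u")
    case True
    then obtain u where u: "w = Inner u" "u \<in> uhp" using w by (auto simp: ext_uhp_def)
    have "real_of_rat (order_at (Gamma0 N) P w) 
      = (\<Sum>A\<in>R. real_of_int (zorder f (moebius A u)) / real (ramification (Gamma0 N) u))"
      by (simp add: u order_at_def zorder_P of_rat_divide of_rat_sum sum_divide_distrib)
    thus ?thesis using inner_term[OF u(2)] unfolding u(1) by blast
  next
    case False
    define \<sigma> where "\<sigma> = cusp_matrix w"
    have \<sigma>: "\<sigma> \<in> SL2Z" using order_at_cusp_matrix(1)[OF w] False by (simp add: \<sigma>_def)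
    obtain r where r: "\<And>A. A \<in> R \<Longrightarrow> qord (slash f k (A ** \<sigma>)) (r A)" using ex_qord_R[OF \<sigma>] by metis
    have "real_of_rat (order_at (Gamma0 N) P w) = (\<Sum>A\<in>R. real (width N \<sigma>) * r A)"
      using P.cusp_order_qord[OF \<sigma> \<sigma>_def[symmetric] qord_P[OF \<sigma> r]] order_at_cusp_matrix(3)[OF w] False
      by (simp add: sum_distrib_left)
    thus ?thesis using cusp_term[OF w _ _ \<sigma>_def r] False by blast
  qed
  then obtain \<psi> where \<psi>: "real_of_rat (order_at (Gamma0 N) P w) = (\<Sum>A\<in>R. \<psi> A)"
     "\<And>z. z \<in> ext_uhp \<Longrightarrow> (\<Sum>A\<in>hits w z. \<psi> A) = real_of_rat (order_at (Gamma0 N) f z) * real (card (hits z w))"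
    by blast
  \<comment> \<open>Classes in the support that no \<open>A w\<close> meets contribute an empty sum,
    and classes that are met but have order 0 contribute 0. Hence the sum over \<open>U\<close>
    equals both sums.\<close>
  define U where "U = (\<lambda>A. orbit (Gamma0 N) (act A w)) ` R \<union> Poly_Mapping.keys D"
  have U: "finite U" "U \<subseteq> modular_curve (Gamma0 N)"
    using finite_R w det_R by (auto simp: U_def modular_curve_def lookup_divisor in_keys_iff split: if_splits)
  have "(\<Sum>A\<in>R. \<psi> A) = (\<Sum>x\<in>U. \<Sum>A | A \<in> R \<and> orbit (Gamma0 N) (act A w) = x. \<psi> A)"
    by (rule sum.group[symmetric]) (use finite_R U in \<open>auto simp: U_def\<close>)
  also have "\<dots> = (\<Sum>x\<in>U. real_of_rat (Poly_Mapping.lookup D x * of_nat (card (hits (class_rep x) w))))"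
  proof (rule sum.cong[OF refl])
    fix x assume "x \<in> U"
    hence x: "x \<in> modular_curve (Gamma0 N)" using U by blast
    have "{A. A \<in> R \<and> orbit (Gamma0 N) (act A w) = x} = hits w (class_rep x)"
      unfolding hits_def using class_rep_in(2)[OF x] by simp
    thus "(\<Sum>A | A \<in> R \<and> orbit (Gamma0 N) (act A w) = x. \<psi> A)
        = real_of_rat (Poly_Mapping.lookup D x * of_nat (card (hits (class_rep x) w)))"
      using \<psi>(2)[OF class_rep_in(1)[OF x]] x by (simp add: lookup_divisor of_rat_mult)
  qed
  also have "\<dots> = real_of_rat (\<Sum>x\<in>U. Poly_Mapping.lookup D x * of_nat (card (hits (class_rep x) w)))"
    by (simp add: of_rat_sum)
  also have "(\<Sum>x\<in>U. Poly_Mapping.lookup D x * of_nat (card (hits (class_rep x) w)))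
     = (\<Sum>x\<in>Poly_Mapping.keys D. Poly_Mapping.lookup D x * of_nat (card (hits (class_rep x) w)))"
    by (rule sum.mono_neutral_right) (use U in \<open>auto simp: U_def in_keys_iff\<close>)
  finally show ?thesis unfolding \<psi>(1)[symmetric] by (simp only: of_rat_eq_iff)
qed

lemma hecke_divisor_eq: "hecke_divisor N R D = divisor (Gamma0 N) P"
proof (rule poly_mapping_eqI)
  fix y
  have "Poly_Mapping.lookup (hecke_divisor N R D) y = (\<Sum>x\<in>Poly_Mapping.keys D. \<Sum>A\<in>R.
      if orbit (Gamma0 N) (act A (class_rep x)) = y then Poly_Mapping.lookup D x else 0)"
    by (simp add: hecke_divisor_def lookup_sum lookup_single when_def)
  also have "\<dots> = (\<Sum>x\<in>Poly_Mapping.keys D. Poly_Mapping.lookup D x * 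
      of_nat (card {A\<in>R. orbit (Gamma0 N) (act A (class_rep x)) = y}))"
    using finite_R by (simp add: sum.If_cases Int_def mult.commute)
  also have "\<dots> = Poly_Mapping.lookup (divisor (Gamma0 N) P) y"
  proof (cases "y \<in> modular_curve (Gamma0 N)")
    case True
    note y = class_rep_in[OF True]
    have "{A\<in>R. orbit (Gamma0 N) (act A (class_rep x)) = y} = hits (class_rep x) (class_rep y)" for x
      using y(2) by (simp add: hits_def)
    thus ?thesis using order_at_P[OF y(1)] True by (simp add: P.lookup_divisor)
  next
    case False
    \<comment> \<open>Every \<open>A\<close> carries points of \<open>ext_uhp\<close> to such
      points, so a set outside the modular curve receives no contribution.\<close>
    have "{A\<in>R. orbit (Gamma0 N) (act A (class_rep x)) = y} = {}" if "x \<in> Poly_Mapping.keys D" for x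
    proof -
      have "x \<in> modular_curve (Gamma0 N)" using that by (auto simp: in_keys_iff lookup_divisor split: if_splits)
      from class_rep_in(1)[OF this] show ?thesis using False det_R by (auto simp: modular_curve_def)
    qed
    hence "(\<Sum>x\<in>Poly_Mapping.keys D. Poly_Mapping.lookup D x * 
       of_nat (card {A\<in>R. orbit (Gamma0 N) (act A (class_rep x)) = y})) = 0"
      by (intro sum.neutral ballI) (simp only: card.empty of_nat_0 mult_zero_right)
    thus ?thesis using False by (simp add: P.lookup_divisor)
  qed
  finally show "Poly_Mapping.lookup (hecke_divisor N R D) y = Poly_Mapping.lookup (divisor (Gamma0 N) P) y" .
qed

end

theorem theorem1p1:
  fixes N n :: nat and R :: "mat2 set" and f :: "complex \<Rightarrow> complex"
  assumes "N > 0" and "n > 0" and "coprime n N"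
    and "hecke_reps N n R"
    and "f \<in> all_mero_forms (Gamma0 N)"
    and "\<exists>\<tau>\<in>uhp. f \<tau> \<noteq> 0"
  shows "hecke_divisor N R (divisor (Gamma0 N) f) = divisor (Gamma0 N) (hecke_mult N R f)"
proof -
  from assms(5) obtain k where "f \<in> mero_forms (Gamma0 N) k" by (auto simp: all_mero_forms_def)
  then interpret hecke_form N k f n R
    using assms by unfold_locales auto
  show ?thesis by (rule hecke_divisor_eq)
qed

end
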